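(* Let $k \ge 1$, $d \ge 2$ and $n_1, \dots, n_k \ge 2$ be integers. Then a $\Sigma_k(n_1,\dots,n_k)$-equivariant map \[ C_k(d;n_1,\dots,n_k) \longrightarrow S(W_k(d;n_1,\dots,n_k)) \] does not exist if and only if $n_1, \dots, n_k$ are all powers of the same prime number.
   Context: For $n\ge 1$ let $W_n=\{x\in\mathbb{R}^n : x_1+\dots+x_n=0\}$ and let $F(\mathbb{R}^d,n)$ be the configuration space of $n$-tuples of pairwise distinct points of $\mathbb{R}^d$; the symmetric group $S_n$ acts on both by $\sigma\cdot(x_1,\dots,x_n)=(x_{\sigma^{-1}(1)},\dots,x_{\sigma^{-1}(n)})$. Wreath product action: if a group $G$ acts on a set $X$ and $S_n$ acts on a set $Y$, then the semidirect product $G^{\times n}\rtimes S_n$ (with $S_n$ permuting the factors of $G^{\times n}$, i.e. $\sigma\cdot(g_1,\dots,g_n)=(g_{\sigma^{-1}(1)},\dots,g_{\sigma^{-1}(n)})$, and multiplication $(g;\sigma)(h;\theta)=(g_1h_{\sigma^{-1}(1)},\dots,g_nh_{\sigma^{-1}(n)};\sigma\theta)$) acts on $X^{\times n}\times Y$ by $(g_1,\dots,g_n;\sigma)\cdot(x_1,\dots,x_n;y)=(g_1x_{\sigma^{-1}(1)},\dots,g_nx_{\sigma^{-1}(n)};\sigma y)$. Groups: $\Sigma_1(n_1)=S_{n_1}$ and, for $k\ge2$, $\Sigma_k(n_1,\dots,n_k)=\Sigma_{k-1}(n_1,\dots,n_{k-1})^{\times n_k}\rtimes S_{n_k}$. Spaces: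 $C_1(d;n_1)=F(\mathbb{R}^d,n_1)$ and $C_k(d;n_1,\dots,n_k)=C_{k-1}(d;n_1,\dots,n_{k-1})^{\times n_k}\times F(\mathbb{R}^d,n_k)$, with the inductively defined wreath product action of $\Sigma_k(n_1,\dots,n_k)$. Representations: $W_1(d;n_1)=W_{n_1}^{\oplus(d-1)}\cong\{(z_1,\dots,z_{n_1})\in(\mathbb{R}^{d-1})^{n_1}: z_1+\dots+z_{n_1}=0\}$ with $S_{n_1}$ permuting the $z_i$, and $W_k(d;n_1,\dots,n_k)=W_{k-1}(d;n_1,\dots,n_{k-1})^{\oplus n_k}\oplus W_{n_k}^{\oplus(d-1)}$ with the inductively defined wreath product action (linear). $S(V)$ denotes the unit sphere of $V$. *)

theory Defs
  imports "HOL-Analysis.Analysis" "HOL-Computational_Algebra.Primes"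
begin

text \<open>
Flat encoding of the iterated wreath-product data. The list ns = [n_1,...,n_k]
is indexed from 0, so level j (0 \<le> j < k) carries n_{j+1} = ns ! j.
A point of C_k(d;ns) consists, for every level j and every "full address"
a = [i_j, i_{j+1}, ..., i_{k-1}] with a ! t < ns ! (j+t), of a point of R^d;
for a fixed tail (i_{j+1},...,i_{k-1}) the n_j points x j (i # tail), i < ns ! j,
form one configuration in F(R^d, n_j).  Points are stored as functions
x :: nat \<Rightarrow> nat list \<Rightarrow> nat \<Rightarrow> real (level, address, coordinate),
vanishing outside the valid index range; the topology is the product topology,
which on this set is the Euclidean one.\<close>

definition valid_addr :: "nat list \<Rightarrow> nat \<Rightarrow> nat list \<Rightarrow> bool" where
  "valid_addr ns j a \<longleftrightarrow> list_all2 (\<lambda>i n. i < n) a (drop j ns)"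

type_synonym cfg = "nat \<Rightarrow> nat list \<Rightarrow> nat \<Rightarrow> real"

definition Cspace :: "nat \<Rightarrow> nat list \<Rightarrow> cfg set" where
  "Cspace d ns = {x.
     (\<forall>j a c. x j a c \<noteq> 0 \<longrightarrow> j < length ns \<and> valid_addr ns j a \<and> c < d) \<and>
     (\<forall>j < length ns. \<forall>tl. valid_addr ns (Suc j) tl \<longrightarrow>
        (\<forall>i i'. i < ns ! j \<and> i' < ns ! j \<and> i \<noteq> i' \<longrightarrow>
           (\<lambda>c. x j (i # tl) c) \<noteq> (\<lambda>c. x j (i' # tl) c)))}"

text \<open>W_k(d; n_1,...,n_k): each node at level j carries an element of
  W_{n_j}^{\<oplus>(d-1)}, i.e. n_j vectors of R^(d-1) summing to 0.\<close>
definition Wspace :: "nat \<Rightarrow> nat list \<Rightarrow> cfg set" where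
  "Wspace d ns = {z.
     (\<forall>j a c. z j a c \<noteq> 0 \<longrightarrow> j < length ns \<and> valid_addr ns j a \<and> c < d - 1) \<and>
     (\<forall>j < length ns. \<forall>tl. valid_addr ns (Suc j) tl \<longrightarrow>
        (\<forall>c. (\<Sum>i<ns ! j. z j (i # tl) c) = 0))}"

definition SW :: "nat \<Rightarrow> nat list \<Rightarrow> cfg set" where
  "SW d ns = {z \<in> Wspace d ns.
     (\<Sum>j<length ns. \<Sum>a\<in>{a. valid_addr ns j a}. \<Sum>c<d - 1. (z j a c)\<^sup>2) = 1}"

definition Sigma_grp :: "nat list \<Rightarrow> (nat \<Rightarrow> nat list \<Rightarrow> nat \<Rightarrow> nat) set" where
  "Sigma_grp ns = {\<sigma>. \<forall>j tl.
     (if j < length ns \<and> valid_addr ns (Suc j) tl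
      then \<sigma> j tl permutes {..<ns ! j} else \<sigma> j tl = id)}"

text \<open>Unfolded wreath-product action: the entry at address [i_j,...,i_{k-1}] of
  sigma . x is the entry of x at address [i'_j,...,i'_{k-1}] where
  i'_m = (sigma_m (i_{m+1},...,i_{k-1}))^{-1} (i_m).\<close>
definition reindex :: "(nat \<Rightarrow> nat list \<Rightarrow> nat \<Rightarrow> nat) \<Rightarrow> nat \<Rightarrow> nat list \<Rightarrow> nat list" where
  "reindex \<sigma> j a = map (\<lambda>t. inv (\<sigma> (j + t) (drop (Suc t) a)) (a ! t)) [0..<length a]"

definition act :: "nat list \<Rightarrow> (nat \<Rightarrow> nat list \<Rightarrow> nat \<Rightarrow> nat) \<Rightarrow> cfg \<Rightarrow> cfg" where
  "act ns \<sigma> x = (\<lambda>j a c. if j < length ns \<and> valid_addr ns j a then x j (reindex \<sigma> j a) c else 0)"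

end

theory Submission
  imports Defs "HOL-Combinatorics.Permutations"
begin

text \<open>
Suppose first that all \<open>n\<^sub>i\<close> are powers of \<open>p\<close>. Lift the Euclidean space of the first \<open>d - 1\<close> coordinates of all points to the
configuration space by one sheet for each group element, the last coordinate being used to separate nearby siblings.
Deform an equivariant map without zeros so that far away it becomes the identity of the first \<open>d - 1\<close> coordinates, and label the
vertices of a fine triangulation of each sheet by the position of the largest coordinate. By Sperner's lemma with signs, the
signed number of simplices with all labels on the identity sheet is 1. By equivariance this number is also a sum, over orbits of
simplices under the group, of the contributions of one simplex on all sheets. On a simplex with all labels the siblings at some
node fall into two distant clusters; the sheets do not see how the two clusters are shuffled, so these contributions add up to a
multiple of a binomial coefficient of a power of \<open>p\<close>, and \<open>p\<close> would divide 1.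

Otherwise the number \<open>N\<close> of leaves, the product of the \<open>n\<^sub>i\<close>, is not a prime power, and there are integers with
\<open>\<Sum>\<^sub>j a\<^sub>j (N choose j) = -1\<close>. Perturb the identity of the sum-zero space by bubbles of degree \<open>a\<^sub>j\<close> near the rays of the
\<open>j\<close>-element subsets. The result has degree 0, hence extends from the exterior of a ball to the whole space without zeros, and it
commutes with permutations as long as these do not exchange nearby entries. For \<open>N\<close> points in the plane, order nearby real
parts by the imaginary parts: this gives an equivariant map from planar configurations to nonzero sum-zero vectors. An iterated
configuration yields \<open>N\<close> distinct points of \<open>\<real>\<^sup>d\<close>, by shrinking lower levels; the values of the planar map together with the
remaining \<open>d - 2\<close> coordinates are never constant on the leaves, and comparing averages over subtrees turns them into a nonzero element
of the representation.
\<close>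

section \<open>A signed Sperner lemma\<close>

text \<open>Why two clusters appear: on a simplex with all labels the deformed map is nearly 0. It
  mixes the coordinates with a unit vector whose entries sum to 0 over siblings. Some coordinate
  must be large; if its siblings were all close to it, they would have one sign and a sum that the
  other part cannot cancel, so the weight of the coordinates would be nearly 0 and the unit vector
  would remain. The group acts freely on the lattice simplices, so the prime enters only through the
  number of shuffles of two clusters. In the converse, full equivariance of the perturbed identity
  is out of reach: a bubble needs a second vector besides its ray, and in general no choice is
  invariant under the stabilizer of a subset. It may depend on an order of the entries, because near
  the ray of a subset the entries inside each block are close, and for close real parts the
  imaginary parts of planar points supply an order. Symmetry makes the rays of all subsets of size j
  share one degree; hence the gcd of the binomial coefficients decides whether the degree 1 of the
  identity can be cancelled.\<close>

text \<open>A pair \<open>(u, \<theta>)\<close> encodes the Freudenthal simplex of the integer lattice with vertices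
  \<open>u + 1\<^bsub>{a. \<theta> (Some a) \<le> i}\<^esub>\<close>, \<open>i = 0, \<dots>, card A\<close>. Labels are elements of \<open>opts A\<close>, where \<open>None\<close> plays the role of
  the extra label 0. Relabelling the \<open>i\<close>-th vertex by \<open>None\<close> turns a facet with all labels \<open>Some a\<close> (a door) into a
  permutation of \<open>opts A\<close>, whose sign is the orientation of the door. The value of \<open>\<theta>\<close> outside \<open>opts A\<close> is fixed
  arbitrarily to make \<open>ranks A\<close> finite.\<close>

definition opts :: "'a set \<Rightarrow> 'a option set" where
  "opts A = insert None (Some ` A)"

definition ranks :: "'a set \<Rightarrow> ('a option \<Rightarrow> nat) set" where
  "ranks A = {\<theta>. bij_betw \<theta> (opts A) {..card A} \<and> \<theta> None = 0 \<and> (\<forall>p. p \<notin> opts A \<longrightarrow> \<theta> p = Suc (card A))}"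

definition vtx :: "('a \<Rightarrow> int) \<Rightarrow> ('a option \<Rightarrow> nat) \<Rightarrow> nat \<Rightarrow> 'a \<Rightarrow> int" where
  "vtx u \<theta> i = (\<lambda>a. u a + of_bool (\<theta> (Some a) \<le> i))"

definition lab_perm :: "'a set \<Rightarrow> (('a \<Rightarrow> int) \<Rightarrow> 'a option) \<Rightarrow> ('a \<Rightarrow> int) \<Rightarrow> ('a option \<Rightarrow> nat) \<Rightarrow> nat \<Rightarrow> 'a option \<Rightarrow> 'a option" where
  "lab_perm A l u \<theta> i = (\<lambda>p. if p \<notin> opts A then p else if \<theta> p = i then None else l (vtx u \<theta> (\<theta> p)))"

definition psign :: "'b set \<Rightarrow> ('b \<Rightarrow> 'b) \<Rightarrow> int" where
  "psign B q = (if q permutes B then sign q else 0)"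

text \<open>Stands in for the signed number of fully labelled simplices: by
  \<open>door_sum_nonzero_imp_full\<close> it vanishes on a simplex that misses a label, while doors
  are what neighbouring simplices share.\<close>

definition door_sum :: "'a set \<Rightarrow> (('a \<Rightarrow> int) \<Rightarrow> 'a option) \<Rightarrow> ('a \<Rightarrow> int) \<Rightarrow> ('a option \<Rightarrow> nat) \<Rightarrow> int" where
  "door_sum A l u \<theta> = (\<Sum>i\<le>card A. psign (opts A) (lab_perm A l u \<theta> i))"

definition lbox :: "'a set \<Rightarrow> int \<Rightarrow> ('a \<Rightarrow> int) set" where
  "lbox A N = {u. (\<forall>a\<in>A. \<bar>u a\<bar> \<le> N) \<and> (\<forall>a. a \<notin> A \<longrightarrow> u a = 0)}"

lemma Some_in_opts [simp]: "Some a \<in> opts A \<longleftrightarrow> a \<in> A" and None_in_opts [simp]: "None \<in> opts A"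
  by (auto simp: opts_def)

lemma finite_opts [simp]: "finite A \<Longrightarrow> finite (opts A)"
  by (simp add: opts_def)

lemma card_opts: "finite A \<Longrightarrow> card (opts A) = Suc (card A)"
  by (simp add: opts_def card_image)

lemma finite_lbox: "finite A \<Longrightarrow> finite (lbox A N)"
proof -
  assume "finite A"
  have "lbox A N \<subseteq> {f. \<forall>x. (x \<in> A \<longrightarrow> f x \<in> {-N..N}) \<and> (x \<notin> A \<longrightarrow> f x = 0)}"
    by (auto simp: lbox_def)
  moreover have "finite {f. \<forall>x. (x \<in> A \<longrightarrow> f x \<in> {-N..N}) \<and> (x \<notin> A \<longrightarrow> f x = 0)}"
    using \<open>finite A\<close> by (intro finite_set_of_finite_funs) auto
  ultimately show ?thesis by (rule finite_subset)
qed

lemma finite_ranks: "finite A \<Longrightarrow> finite (ranks A)"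
proof -
  assume "finite A"
  have "ranks A \<subseteq> {f. \<forall>x. (x \<in> opts A \<longrightarrow> f x \<in> {..card A}) \<and> (x \<notin> opts A \<longrightarrow> f x = Suc (card A))}"
    by (auto simp: ranks_def bij_betw_def)
  moreover have "finite {f. \<forall>x. (x \<in> opts A \<longrightarrow> f x \<in> {..card A}) \<and> (x \<notin> opts A \<longrightarrow> f x = Suc (card A))}"
    using \<open>finite A\<close> by (intro finite_set_of_finite_funs) auto
  ultimately show ?thesis by (rule finite_subset)
qed

lemma psign_compose_transpose:
  assumes "finite B" "x \<in> B" "y \<in> B" "x \<noteq> y"
  shows "psign B (q \<circ> Transposition.transpose x y) = - psign B q"
proof -
  have t: "Transposition.transpose x y permutes B" using assms by (simp add: permutes_swap_id)
  have "(q \<circ> Transposition.transpose x y) permutes B \<longleftrightarrow> q permutes B"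
  proof
    assume "(q \<circ> Transposition.transpose x y) permutes B"
    then have "(q \<circ> Transposition.transpose x y) \<circ> Transposition.transpose x y permutes B"
      using t permutes_compose by blast
    then show "q permutes B" by (simp add: comp_assoc)
  qed (use t permutes_compose in blast)
  moreover have "sign (q \<circ> Transposition.transpose x y) = - sign q" if "q permutes B"
  proof -
    have "permutation q" using that assms(1) permutation_permutes by blast
    then show ?thesis using assms by (simp add: sign_compose sign_swap_id permutation_swap_id)
  qed
  ultimately show ?thesis by (simp add: psign_def)
qed

lemma psign_eq_0:
  assumes "q x = q y" "x \<noteq> y"
  shows "psign B q = 0"
  using assms by (auto simp: psign_def dest: permutes_inj injD)

lemma ranks_inj: "\<lbrakk>\<theta> \<in> ranks A; p \<in> opts A; q \<in> opts A; \<theta> p = \<theta> q\<rbrakk> \<Longrightarrow> p = q"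
  by (auto simp: ranks_def bij_betw_def dest: inj_onD)

lemma ranks_le: "\<lbrakk>\<theta> \<in> ranks A; p \<in> opts A\<rbrakk> \<Longrightarrow> \<theta> p \<le> card A"
  by (auto simp: ranks_def bij_betw_def)

lemma ranks_surj: "\<lbrakk>\<theta> \<in> ranks A; i \<le> card A\<rbrakk> \<Longrightarrow> \<exists>p\<in>opts A. \<theta> p = i"
  unfolding ranks_def bij_betw_def by (smt (verit, best) atMost_iff imageE mem_Collect_eq)

lemma ranks_None: "\<theta> \<in> ranks A \<Longrightarrow> \<theta> None = 0"
  by (simp add: ranks_def)

lemma ranks_out: "\<lbrakk>\<theta> \<in> ranks A; p \<notin> opts A\<rbrakk> \<Longrightarrow> \<theta> p = Suc (card A)"
  by (simp add: ranks_def)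

lemma ranks_pos: "\<lbrakk>\<theta> \<in> ranks A; a \<in> A\<rbrakk> \<Longrightarrow> 0 < \<theta> (Some a)"
  by (metis gr0I image_eqI insertCI option.distinct(1) opts_def ranks_None ranks_inj)

lemma ranks_pos':
  assumes "\<theta> \<in> ranks A" "p \<noteq> None"
  shows "0 < \<theta> p"
proof -
  obtain a where p: "p = Some a" using assms by auto
  show ?thesis
    using ranks_pos[OF assms(1), of a] ranks_out[OF assms(1), of p] p by (cases "a \<in> A") auto
qed

lemma ranks_transpose:
  assumes "\<theta> \<in> ranks A" "0 < i" "i < card A"
  shows "Transposition.transpose i (Suc i) \<circ> \<theta> \<in> ranks A"
proof -
  have "bij_betw (Transposition.transpose i (Suc i)) {..card A} {..card A}"
    using assms by (intro permutes_imp_bij permutes_swap_id) auto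
  then show ?thesis using assms
    by (auto simp: ranks_def Transposition.transpose_def intro: bij_betw_trans)
qed

text \<open>Exchanging the ranks \<open>i\<close> and \<open>Suc i\<close> moves only vertex
  \<open>i\<close>, which gives the neighbour across the opposite facet. Both simplices see the same
  door, with opposite orientations. The bound \<open>0 < i\<close> keeps \<open>None\<close> at rank
  0.\<close>

lemma lab_perm_transpose:
  assumes th: "\<theta> \<in> ranks A" and i: "0 < i" "i < card A" and fin: "finite A"
  shows "psign (opts A) (lab_perm A l u (Transposition.transpose i (Suc i) \<circ> \<theta>) i) = - psign (opts A) (lab_perm A l u \<theta> i)"
proof -
  let ?t = "Transposition.transpose i (Suc i) \<circ> \<theta>"
  obtain x where x: "x \<in> opts A" "\<theta> x = i" using ranks_surj[OF th, of i] i by auto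
  obtain y where y: "y \<in> opts A" "\<theta> y = Suc i" using ranks_surj[OF th, of "Suc i"] i by auto
  have v: "vtx u ?t j = vtx u \<theta> j" if "j \<noteq> i" for j
    using that by (auto simp: vtx_def Transposition.transpose_def fun_eq_iff split: if_splits)
  have "lab_perm A l u ?t i = lab_perm A l u \<theta> i \<circ> Transposition.transpose x y"
  proof
    fix p
    consider "p \<notin> opts A" | "p = x" | "p = y" | "p \<in> opts A" "p \<noteq> x" "p \<noteq> y" by blast
    then show "lab_perm A l u ?t i p = (lab_perm A l u \<theta> i \<circ> Transposition.transpose x y) p"
    proof cases
      case 1
      then have "p \<noteq> x" "p \<noteq> y" using x y by auto
      then show ?thesis using 1 by (simp add: lab_perm_def)
    next
      case 2 then show ?thesis using x y i v[of "Suc i"] by (simp add: lab_perm_def)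
    next
      case 3 then show ?thesis using x y i by (simp add: lab_perm_def)
    next
      case 4
      then have "\<theta> p \<noteq> i" "\<theta> p \<noteq> Suc i" using ranks_inj[OF th] x y by metis+
      then show ?thesis using 4 v[of "\<theta> p"] by (simp add: lab_perm_def)
    qed
  qed
  then show ?thesis using psign_compose_transpose[of "opts A" x y] x y fin by force
qed

lemma sum_lab_perm_inner:
  assumes "0 < i" "i < card A" "finite A"
  shows "(\<Sum>\<theta>\<in>ranks A. psign (opts A) (lab_perm A l u \<theta> i)) = 0"
proof -
  let ?g = "\<lambda>\<theta>. psign (opts A) (lab_perm A l u \<theta> i)"
  have "(\<Sum>\<theta>\<in>ranks A. ?g \<theta>) = (\<Sum>\<theta>\<in>ranks A. ?g (Transposition.transpose i (Suc i) \<circ> \<theta>))"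
    by (rule sum.reindex_bij_witness[where i="(\<circ>) (Transposition.transpose i (Suc i))" and j="(\<circ>) (Transposition.transpose i (Suc i))"])
       (use assms ranks_transpose in \<open>auto simp: comp_assoc[symmetric]\<close>)
  also have "\<dots> = (\<Sum>\<theta>\<in>ranks A. - ?g \<theta>)"
    by (rule sum.cong) (use assms lab_perm_transpose in auto)
  finally show ?thesis by (simp add: sum_negf)
qed

text \<open>The neighbouring simplex across the facet opposite to vertex 0, whose last facet is that facet.\<close>

definition shift_up :: "'a set \<Rightarrow> ('a \<Rightarrow> int) \<times> ('a option \<Rightarrow> nat) \<Rightarrow> ('a \<Rightarrow> int) \<times> ('a option \<Rightarrow> nat)" where
  "shift_up A = (\<lambda>(u, \<theta>). (\<lambda>a. u a + of_bool (\<theta> (Some a) = 1),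
     \<lambda>p. if p = None then 0 else if \<theta> p = 1 then card A else if \<theta> p \<le> card A then \<theta> p - 1 else \<theta> p))"

definition shift_down :: "'a set \<Rightarrow> ('a \<Rightarrow> int) \<times> ('a option \<Rightarrow> nat) \<Rightarrow> ('a \<Rightarrow> int) \<times> ('a option \<Rightarrow> nat)" where
  "shift_down A = (\<lambda>(u, \<theta>). (\<lambda>a. u a - of_bool (\<theta> (Some a) = card A),
     \<lambda>p. if p = None then 0 else if \<theta> p = card A then 1 else if \<theta> p < card A then \<theta> p + 1 else \<theta> p))"

lemma bij_betw_finite_inj:
  assumes "inj_on f B" "f ` B \<subseteq> C" "finite C" "card B = card C"
  shows "bij_betw f B C"
  using assms by (simp add: bij_betw_def card_image card_subset_eq)

lemma shift_up_ranks:
  assumes "\<theta> \<in> ranks A" "finite A" "A \<noteq> {}"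
  shows "snd (shift_up A (u, \<theta>)) \<in> ranks A"
proof -
  have m: "card A > 0" using assms by (simp add: card_gt_0_iff)
  let ?t = "snd (shift_up A (u, \<theta>))"
  have pos: "p \<in> opts A \<Longrightarrow> p \<noteq> None \<Longrightarrow> \<theta> p > 0" for p
    using ranks_pos[OF assms(1)] by (auto simp: opts_def)
  have rng: "?t p \<le> card A" if "p \<in> opts A" for p
    using ranks_le[OF assms(1) that] m by (auto simp: shift_up_def)
  have "inj_on ?t (opts A)"
  proof (rule inj_onI)
    fix p q assume pq: "p \<in> opts A" "q \<in> opts A" "?t p = ?t q"
    have "\<theta> p = \<theta> q \<or> p = q"
      using pq(3) pos[OF pq(1)] pos[OF pq(2)] ranks_le[OF assms(1) pq(1)] ranks_le[OF assms(1) pq(2)] m ranks_None[OF assms(1)]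
      by (auto simp: shift_up_def split: if_splits)
    then show "p = q" using ranks_inj[OF assms(1) pq(1,2)] by auto
  qed
  moreover have "?t ` opts A \<subseteq> {..card A}"
    using rng by auto
  ultimately have "bij_betw ?t (opts A) {..card A}"
    by (intro bij_betw_finite_inj) (auto simp: card_opts assms)
  then show ?thesis using ranks_out[OF assms(1)] m by (auto simp: ranks_def shift_up_def opts_def)
qed

lemma shift_down_ranks:
  assumes "\<theta> \<in> ranks A" "finite A" "A \<noteq> {}"
  shows "snd (shift_down A (u, \<theta>)) \<in> ranks A"
proof -
  have m: "card A > 0" using assms by (simp add: card_gt_0_iff)
  let ?t = "snd (shift_down A (u, \<theta>))"
  have pos: "p \<in> opts A \<Longrightarrow> p \<noteq> None \<Longrightarrow> \<theta> p > 0" for p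
    using ranks_pos[OF assms(1)] by (auto simp: opts_def)
  have rng: "?t p \<le> card A" if "p \<in> opts A" for p
    using ranks_le[OF assms(1) that] m by (auto simp: shift_down_def)
  have "inj_on ?t (opts A)"
  proof (rule inj_onI)
    fix p q assume pq: "p \<in> opts A" "q \<in> opts A" "?t p = ?t q"
    have "\<theta> p = \<theta> q \<or> p = q"
      using pq(3) pos[OF pq(1)] pos[OF pq(2)] ranks_le[OF assms(1) pq(1)] ranks_le[OF assms(1) pq(2)] m ranks_None[OF assms(1)]
      by (auto simp: shift_down_def split: if_splits)
    then show "p = q" using ranks_inj[OF assms(1) pq(1,2)] by auto
  qed
  moreover have "?t ` opts A \<subseteq> {..card A}"
    using rng by auto
  ultimately have "bij_betw ?t (opts A) {..card A}"
    by (intro bij_betw_finite_inj) (auto simp: card_opts assms)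
  then show ?thesis using ranks_out[OF assms(1)] m by (auto simp: ranks_def shift_down_def opts_def)
qed

lemma shift_down_up:
  assumes "\<theta> \<in> ranks A" "finite A" "A \<noteq> {}"
  shows "shift_down A (shift_up A (u, \<theta>)) = (u, \<theta>)"
proof -
  have m: "card A > 0" using assms by (simp add: card_gt_0_iff)
  have pos: "p \<noteq> None \<Longrightarrow> \<theta> p > 0" for p
    using ranks_pos'[OF assms(1)] .
  have "(if p = None then 0 else if snd (shift_up A (u, \<theta>)) p = card A then 1
      else if snd (shift_up A (u, \<theta>)) p < card A then snd (shift_up A (u, \<theta>)) p + 1 else snd (shift_up A (u, \<theta>)) p) = \<theta> p" for p
    using pos[of p] m ranks_None[OF assms(1)] by (auto simp: shift_up_def)
  moreover have "snd (shift_up A (u, \<theta>)) (Some a) = card A \<longleftrightarrow> \<theta> (Some a) = 1" for a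
    using pos[of "Some a"] m by (auto simp: shift_up_def)
  ultimately show ?thesis
    by (intro prod_eqI ext) (simp_all add: shift_down_def[of A] split_beta, auto simp: shift_up_def)
qed

lemma shift_up_down:
  assumes "\<theta> \<in> ranks A" "finite A" "A \<noteq> {}"
  shows "shift_up A (shift_down A (u, \<theta>)) = (u, \<theta>)"
proof -
  have m: "card A > 0" using assms by (simp add: card_gt_0_iff)
  have pos: "p \<noteq> None \<Longrightarrow> \<theta> p > 0" for p
    using ranks_pos'[OF assms(1)] .
  have le: "\<theta> p \<le> Suc (card A)" for p
    using ranks_le[OF assms(1), of p] ranks_out[OF assms(1), of p] by force
  have "(if p = None then 0 else if snd (shift_down A (u, \<theta>)) p = 1 then card A
      else if snd (shift_down A (u, \<theta>)) p \<le> card A then snd (shift_down A (u, \<theta>)) p - 1 else snd (shift_down A (u, \<theta>)) p) = \<theta> p" for p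
    using pos[of p] m ranks_None[OF assms(1)] le[of p] by (auto simp: shift_down_def)
  moreover have "snd (shift_down A (u, \<theta>)) (Some a) = 1 \<longleftrightarrow> \<theta> (Some a) = card A" for a
    using pos[of "Some a"] m le[of "Some a"] by (auto simp: shift_down_def)
  ultimately show ?thesis
    by (intro prod_eqI ext) (simp_all add: shift_up_def[of A] split_beta, auto simp: shift_down_def)
qed

text \<open>The facet has the same vertices in both simplices. The omitted vertex belongs to
  \<open>None\<close> in one and to the element of rank 1 in the other, so the two permutations
  differ by one transposition.\<close>

lemma lab_perm_shift:
  assumes th: "\<theta> \<in> ranks A" and fin: "finite A" and ne: "A \<noteq> {}" and sh: "shift_up A (u, \<theta>) = (u', \<theta>')"
  shows "psign (opts A) (lab_perm A l u \<theta> 0) = - psign (opts A) (lab_perm A l u' \<theta>' (card A))"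
proof -
  have m: "card A > 0" using fin ne by (simp add: card_gt_0_iff)
  obtain x where x: "x \<in> opts A" "\<theta> x = 1" using ranks_surj[OF th, of 1] m by auto
  have N: "None \<in> opts A" by (simp add: opts_def)
  have xN: "x \<noteq> None"
  proof
    assume "x = None" then show False using x ranks_None[OF th] by simp
  qed
  have pos: "p \<noteq> None \<Longrightarrow> \<theta> p > 0" for p
    using ranks_pos'[OF th] .
  have th': "\<theta>' p = (if p = None then 0 else if \<theta> p = 1 then card A else if \<theta> p \<le> card A then \<theta> p - 1 else \<theta> p)" for p
    using sh by (auto simp: shift_up_def)
  have v: "vtx u' \<theta>' j = vtx u \<theta> (Suc j)" if "j < card A" for j
  proof
    fix a
    show "vtx u' \<theta>' j a = vtx u \<theta> (Suc j) a"
      using sh that pos[of "Some a"] by (auto simp: vtx_def shift_up_def split: if_splits)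
  qed
  have "lab_perm A l u \<theta> 0 = lab_perm A l u' \<theta>' (card A) \<circ> Transposition.transpose None x"
  proof
    fix p
    consider "p \<notin> opts A" | "p = None" | "p = x" | "p \<in> opts A" "p \<noteq> None" "p \<noteq> x" by blast
    then show "lab_perm A l u \<theta> 0 p = (lab_perm A l u' \<theta>' (card A) \<circ> Transposition.transpose None x) p"
    proof cases
      case 1
      then have "p \<noteq> x" "p \<noteq> None" using x(1) N by metis+
      then show ?thesis using 1 by (simp add: lab_perm_def)
    next
      case 2 then show ?thesis using x N xN m ranks_None[OF th] by (auto simp: lab_perm_def th')
    next
      case 3 then show ?thesis using x N xN m v[of 0] by (simp add: lab_perm_def th')
    next
      case 4
      then have "\<theta> p \<noteq> 1" "\<theta> p > 0" "\<theta> p \<le> card A" using ranks_inj[OF th] x pos[of p] ranks_le[OF th] by metis+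
      then have "\<theta>' p = \<theta> p - 1" "\<theta> p \<noteq> 0" "\<theta>' p \<noteq> card A" "\<theta>' p < card A" using 4 th' by auto
      then show ?thesis using 4 v[of "\<theta> p - 1"] by (simp add: lab_perm_def)
    qed
  qed
  then show ?thesis using psign_compose_transpose[of "opts A" None x "lab_perm A l u' \<theta>' (card A)"] x N xN fin by force
qed

text \<open>A door supplies every label \<open>Some a\<close>. If the vertex opposite to it is not
  labelled \<open>None\<close>, its label occurs exactly once more, at a vertex \<open>k\<close>;
  then the facets opposite to \<open>i\<close> and \<open>k\<close> are the only doors, and their
  signs cancel.\<close>

lemma door_sum_nonzero_imp_full:
  assumes th: "\<theta> \<in> ranks A" and fin: "finite A" and nz: "door_sum A l u \<theta> \<noteq> 0" and p: "p \<in> opts A"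
    and range: "\<And>v. l v \<in> opts A"
  shows "\<exists>i\<le>card A. l (vtx u \<theta> i) = p"
proof -
  let ?Q = "lab_perm A l u \<theta>"
  from nz obtain i where i: "i \<le> card A" "psign (opts A) (?Q i) \<noteq> 0"
    unfolding door_sum_def by (meson atMost_iff sum.neutral)
  then have perm: "?Q i permutes opts A" by (auto simp: psign_def split: if_splits)
  obtain x where x: "x \<in> opts A" "\<theta> x = i" using ranks_surj[OF th i(1)] by auto
  have some: "\<exists>j\<le>card A. j \<noteq> i \<and> l (vtx u \<theta> j) = Some a" if a: "a \<in> A" for a
  proof -
    have "Some a \<in> ?Q i ` opts A" unfolding permutes_image[OF perm] using a by (simp add: opts_def)
    then obtain q where "q \<in> opts A" "?Q i q = Some a" by force
    then show ?thesis using ranks_le[OF th] by (auto simp: lab_perm_def split: if_splits)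
  qed
  show ?thesis
  proof (cases "l (vtx u \<theta> i) = None")
    case True
    then show ?thesis using p some i by (auto simp: opts_def)
  next
    case False
    show ?thesis
    proof -
      from False range[of "vtx u \<theta> i"] have "\<exists>a\<in>A. l (vtx u \<theta> i) = Some a" by (auto simp: opts_def)
      then obtain a where a: "a \<in> A" "l (vtx u \<theta> i) = Some a" by blast
      then obtain k where k: "k \<le> card A" "k \<noteq> i" "l (vtx u \<theta> k) = Some a" using some by blast
      obtain y where y: "y \<in> opts A" "\<theta> y = k" using ranks_surj[OF th k(1)] by auto
      have xy: "x \<noteq> y" using x y k by auto
      have inj: "z \<in> opts A \<Longrightarrow> \<theta> z = \<theta> w \<Longrightarrow> w \<in> opts A \<Longrightarrow> z = w" for z w using ranks_inj[OF th] by blast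
      have o: "Some a \<in> opts A" "None \<in> opts A" using a by (auto simp: opts_def)
      have uniq: "?Q i z = Some a \<Longrightarrow> z = y" for z
      proof -
        assume "?Q i z = Some a"
        moreover have "?Q i y = Some a" using y k by (simp add: lab_perm_def)
        ultimately show "z = y" using permutes_inj[OF perm] by (simp add: inj_def)
      qed
      have uniqN: "?Q i z = None \<Longrightarrow> z = x" for z
      proof -
        assume "?Q i z = None"
        moreover have "?Q i x = None" using x by (simp add: lab_perm_def)
        ultimately show "z = x" using permutes_inj[OF perm] by (simp add: inj_def)
      qed
      have "?Q k = Transposition.transpose None (Some a) \<circ> ?Q i"
      proof
        fix z
        consider "z \<notin> opts A" | "z = x" | "z = y" | "z \<in> opts A" "z \<noteq> x" "z \<noteq> y" by blast
        then show "?Q k z = (Transposition.transpose None (Some a) \<circ> ?Q i) z"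
        proof cases
          case 1 then have "z \<noteq> None" "z \<noteq> Some a" using o by metis+
          then show ?thesis using 1 by (simp add: lab_perm_def)
        next
          case 2 then show ?thesis using x k a by (simp add: lab_perm_def)
        next
          case 3 then show ?thesis using y k by (simp add: lab_perm_def)
        next
          case 4
          then have "\<theta> z \<noteq> i" "\<theta> z \<noteq> k" using inj x y by metis+
          moreover have "?Q i z \<noteq> Some a" "?Q i z \<noteq> None" using 4 uniq uniqN by metis+
          ultimately show ?thesis using 4 by (simp add: lab_perm_def)
        qed
      qed
      then have "psign (opts A) (?Q k) = - psign (opts A) (?Q i)"
        using perm o fin permutes_compose[OF perm, of "Transposition.transpose None (Some a)"]
          permutation_permutes[of "?Q i"]
        by (auto simp: psign_def permutes_swap_id sign_compose sign_swap_id permutation_swap_id)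
      moreover have "psign (opts A) (?Q j) = 0" if "j \<le> card A" "j \<noteq> i" "j \<noteq> k" for j
      proof (rule psign_eq_0[of _ x y])
        show "?Q j x = ?Q j y" using x y that a k by (simp add: lab_perm_def)
      qed (use xy in auto)
      ultimately have "door_sum A l u \<theta> = 0"
        unfolding door_sum_def using i k
        by (subst sum.remove[of _ i], simp, simp, subst sum.remove[of _ k]) (auto intro!: sum.neutral)
      then show ?thesis using nz by simp
    qed
  qed
qed

lemma lbox_vtx:
  assumes "vtx u \<theta> i \<in> lbox A N" "\<theta> \<in> ranks A" "i \<le> card A"
  shows "u \<in> lbox A (N + 1)"
proof -
  have "\<bar>u a\<bar> \<le> \<bar>vtx u \<theta> i a\<bar> + 1" for a by (auto simp: vtx_def)
  moreover have "vtx u \<theta> i a = u a" if "a \<notin> A" for a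
  proof -
    have "\<theta> (Some a) = Suc (card A)" using that assms by (intro ranks_out) (auto simp: opts_def)
    then show ?thesis using assms(3) by (simp add: vtx_def)
  qed
  ultimately show ?thesis using assms(1) unfolding lbox_def by (auto intro: order_trans[OF _ add_right_mono])
qed

lemma lbox_shift_up:
  assumes "u \<in> lbox A N" "\<theta> \<in> ranks A" "A \<noteq> {}" "finite A"
  shows "fst (shift_up A (u, \<theta>)) \<in> lbox A (N + 1)"
proof -
  have "\<theta> (Some a) \<noteq> 1" if "a \<notin> A" for a
    using ranks_out[OF assms(2), of "Some a"] that assms(3,4) by auto
  moreover have "\<bar>u a + of_bool (\<theta> (Some a) = 1)\<bar> \<le> \<bar>u a\<bar> + 1" for a by auto
  ultimately show ?thesis using assms(1) unfolding lbox_def shift_up_def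
    by (auto intro: order_trans[OF _ add_right_mono])
qed

lemma lbox_shift_down:
  assumes "u \<in> lbox A N" "\<theta> \<in> ranks A"
  shows "fst (shift_down A (u, \<theta>)) \<in> lbox A (N + 1)"
proof -
  have "\<theta> (Some a) \<noteq> card A" if "a \<notin> A" for a
    using ranks_out[OF assms(2), of "Some a"] that by auto
  moreover have "\<bar>u a - of_bool (\<theta> (Some a) = card A)\<bar> \<le> \<bar>u a\<bar> + 1" for a by auto
  ultimately show ?thesis using assms(1) unfolding lbox_def shift_down_def
    by (auto intro: order_trans[OF _ add_right_mono])
qed

text \<open>Inner facets cancel for each fixed base point, and facet 0 cancels against the last
  facet of a neighbour. At the border of the box this fails for a single labelling, so it is applied
  to the difference of two, which vanishes there.\<close>

lemma door_sum_total_eq: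
  fixes A :: "'a set"
  assumes fin: "finite A" and ne: "A \<noteq> {}" and eq: "\<And>u. u \<notin> lbox A N \<Longrightarrow> l u = l' u"
  shows "(\<Sum>(u, \<theta>)\<in>lbox A (N + 2) \<times> ranks A. door_sum A l u \<theta>)
       = (\<Sum>(u, \<theta>)\<in>lbox A (N + 2) \<times> ranks A. door_sum A l' u \<theta>)"
proof -
  let ?P = "lbox A (N + 2) \<times> ranks A"
  define D where "D i w = psign (opts A) (lab_perm A l (fst w) (snd w) i) - psign (opts A) (lab_perm A l' (fst w) (snd w) i)"
    for i and w :: "('a \<Rightarrow> int) \<times> ('a option \<Rightarrow> nat)"
  have m: "card A > 0" using fin ne by (simp add: card_gt_0_iff)
  \<comment> \<open>The support leaves one layer free inside radius \<open>N + 2\<close>; a shift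
    changes a coordinate by at most 1, so shifted simplices stay in the sum.\<close>
  have supp: "fst w \<in> lbox A (N + 1)" if "D i w \<noteq> 0" "snd w \<in> ranks A" for i w
  proof (rule ccontr)
    assume no: "fst w \<notin> lbox A (N + 1)"
    have "lab_perm A l (fst w) (snd w) i = lab_perm A l' (fst w) (snd w) i"
    proof
      fix p
      show "lab_perm A l (fst w) (snd w) i p = lab_perm A l' (fst w) (snd w) i p"
      proof (cases "p \<in> opts A")
        case True
        then have "snd w p \<le> card A" using ranks_le[OF that(2)] by auto
        then have "vtx (fst w) (snd w) (snd w p) \<notin> lbox A N" using lbox_vtx[OF _ that(2)] no by blast
        then show ?thesis using eq by (simp add: lab_perm_def)
      qed (simp add: lab_perm_def)
    qed
    then show False using that by (simp add: D_def)
  qed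
  have inner: "(\<Sum>w\<in>?P. D i w) = 0" if "0 < i" "i < card A" for i
    using sum_lab_perm_inner[OF that fin]
    by (simp add: D_def sum_subtractf case_prod_unfold flip: sum.cartesian_product' )
       (simp add: sum.cartesian_product')
  have sh: "D 0 w = - D (card A) (shift_up A w)" if "snd w \<in> ranks A" for w
    using lab_perm_shift[OF that fin ne, of "fst w" "fst (shift_up A w)" "snd (shift_up A w)"] by (simp add: D_def)
  have "(\<Sum>w\<in>?P. D 0 w) = (\<Sum>w\<in>?P. - D (card A) w)"
  proof (rule sum.reindex_bij_witness_not_neutral[where i="shift_down A" and j="shift_up A"
        and S'="{w\<in>?P. D 0 w = 0}" and T'="{w\<in>?P. D (card A) w = 0}"])
    show "finite {w\<in>?P. D 0 w = 0}" "finite {w\<in>?P. D (card A) w = 0}"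
      using finite_lbox[OF fin] finite_ranks[OF fin] by (auto intro: finite_subset[of _ "lbox A (N + 2) \<times> ranks A"])
    fix w assume w: "w \<in> ?P - {w\<in>?P. D 0 w = 0}"
    then have r: "snd w \<in> ranks A" and d: "D 0 w \<noteq> 0" by auto
    show "shift_down A (shift_up A w) = w" using shift_down_up[OF r fin ne, of "fst w"] by simp
    have "fst (shift_up A w) \<in> lbox A (N + 2)" using lbox_shift_up[OF supp[OF d r] r ne fin] by (simp add: add.assoc)
    moreover have "snd (shift_up A w) \<in> ranks A" using shift_up_ranks[OF r fin ne, of "fst w"] by simp
    ultimately show "shift_up A w \<in> ?P - {w\<in>?P. D (card A) w = 0}" using sh[OF r] d
      by (auto simp: mem_Times_iff)
  next
    fix w assume w: "w \<in> ?P - {w\<in>?P. D (card A) w = 0}"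
    then have r: "snd w \<in> ranks A" and d: "D (card A) w \<noteq> 0" by auto
    show ud: "shift_up A (shift_down A w) = w" using shift_up_down[OF r fin ne, of "fst w"] by simp
    have "fst (shift_down A w) \<in> lbox A (N + 2)" using lbox_shift_down[OF supp[OF d r] r] by (simp add: add.assoc)
    moreover have r': "snd (shift_down A w) \<in> ranks A" using shift_down_ranks[OF r fin ne, of "fst w"] by simp
    ultimately show "shift_down A w \<in> ?P - {w\<in>?P. D 0 w = 0}" using sh[OF r'] d ud
      by (auto simp: mem_Times_iff)
  next
    fix w assume "w \<in> ?P"
    then show "- D (card A) (shift_up A w) = D 0 w" using sh by auto
  qed auto
  then have ends: "(\<Sum>w\<in>?P. D 0 w) + (\<Sum>w\<in>?P. D (card A) w) = 0" by (simp add: sum_negf)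
  have "(\<Sum>i\<le>card A. \<Sum>w\<in>?P. D i w) = (\<Sum>i\<in>{0, card A}. \<Sum>w\<in>?P. D i w)"
    by (rule sum.mono_neutral_right) (use inner in auto)
  also have "\<dots> = 0" using ends m by simp
  finally have "(\<Sum>w\<in>?P. \<Sum>i\<le>card A. D i w) = 0" by (subst sum.swap)
  then show ?thesis by (simp add: D_def door_sum_def sum_subtractf case_prod_unfold)
qed

text \<open>A relation and not a function, as ties between maximal coordinates are left open.
  \<open>None\<close> stands for an additional coordinate that is constantly 0 and wins its
  ties.\<close>

definition argmax_label :: "'a set \<Rightarrow> ('a \<Rightarrow> int) \<Rightarrow> 'a option \<Rightarrow> bool" where
  "argmax_label A u p \<longleftrightarrow> (case p of None \<Rightarrow> \<forall>a\<in>A. u a \<le> 0 | Some b \<Rightarrow> b \<in> A \<and> u b > 0 \<and> (\<forall>a\<in>A. u a \<le> u b))"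

lemma argmax_label_ex: "finite A \<Longrightarrow> \<exists>p. argmax_label A u p"
proof (cases "\<forall>a\<in>A. u a \<le> 0")
  case True then show ?thesis by (auto simp: argmax_label_def intro!: exI[of _ None])
next
  case False
  assume "finite A"
  then obtain b where b: "b \<in> A" "u b = Max (u ` A)" using Max_in[of "u ` A"] False by fastforce
  then have "\<forall>a\<in>A. u a \<le> u b" using \<open>finite A\<close> by auto
  moreover from False obtain a where "a \<in> A" "u a > 0" by auto
  ultimately show ?thesis using b by (intro exI[of _ "Some b"]) (force simp: argmax_label_def)
qed

lemma argmax_label_opts: "argmax_label A u p \<Longrightarrow> p \<in> opts A"
  by (auto simp: argmax_label_def opts_def split: option.splits)

lemma ranks_bij_Some:
  assumes th: "\<theta> \<in> ranks A"
  shows "bij_betw (\<lambda>a. \<theta> (Some a)) A {1..card A}"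
proof (rule bij_betw_finite_inj)
  show "inj_on (\<lambda>a. \<theta> (Some a)) A"
  proof (rule inj_onI)
    fix a b assume "a \<in> A" "b \<in> A" "\<theta> (Some a) = \<theta> (Some b)"
    then show "a = b" using ranks_inj[OF th, of "Some a" "Some b"] by simp
  qed
  show "(\<lambda>a. \<theta> (Some a)) ` A \<subseteq> {1..card A}"
    using ranks_pos[OF th] ranks_le[OF th] by (fastforce simp: Suc_le_eq)
qed auto

text \<open>The vertex labelled \<open>None\<close> forces \<open>u a \<le> 0\<close>, so the vertex
  \<open>J a\<close> with label \<open>Some a\<close> needs coordinate \<open>a\<close> already
  raised: \<open>u a = 0\<close> and \<open>\<theta> (Some a) \<le> J a\<close>. Both
  \<open>J\<close> and the ranks enumerate \<open>{1..card A}\<close>, so their sums agree and the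
  inequalities are equalities.\<close>

lemma full_argmax_simplex:
  assumes th: "\<theta> \<in> ranks A" and fin: "finite A" and u: "\<forall>a. a \<notin> A \<longrightarrow> u a = 0"
    and good: "\<And>u. argmax_label A u (l u)"
    and full: "\<And>p. p \<in> opts A \<Longrightarrow> \<exists>i\<le>card A. l (vtx u \<theta> i) = p"
  shows "u = (\<lambda>a. 0)" and "\<And>a. a \<in> A \<Longrightarrow> l (vtx u \<theta> (\<theta> (Some a))) = Some a"
proof -
  obtain i where i: "l (vtx u \<theta> i) = None" using full[of None] by (auto simp: opts_def)
  have le0: "u a \<le> 0" if "a \<in> A" for a
  proof -
    have "vtx u \<theta> i a \<le> 0" using good[of "vtx u \<theta> i"] i that by (auto simp: argmax_label_def)
    then show ?thesis by (auto simp: vtx_def of_bool_def split: if_splits)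
  qed
  have lab: "\<exists>j\<le>card A. l (vtx u \<theta> j) = Some a \<and> \<theta> (Some a) \<le> j \<and> u a = 0" if a: "a \<in> A" for a
  proof -
    obtain j where j: "j \<le> card A" "l (vtx u \<theta> j) = Some a" using full[of "Some a"] a by auto
    then have "vtx u \<theta> j a > 0" using good[of "vtx u \<theta> j"] by (auto simp: argmax_label_def)
    then have "u a = 0 \<and> \<theta> (Some a) \<le> j" using le0[OF a] by (auto simp: vtx_def of_bool_def split: if_splits)
    then show ?thesis using j by blast
  qed
  then show u0: "u = (\<lambda>a. 0)" using u by (metis (full_types))
  define J where "J a = (SOME j. j \<le> card A \<and> l (vtx u \<theta> j) = Some a \<and> \<theta> (Some a) \<le> j)" for a
  have J: "J a \<le> card A \<and> l (vtx u \<theta> (J a)) = Some a \<and> \<theta> (Some a) \<le> J a" if "a \<in> A" for a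
    unfolding J_def using lab[OF that] by (metis (mono_tags, lifting) someI_ex)
  have inj: "inj_on J A" using J by (metis inj_onI option.inject)
  have "J ` A \<subseteq> {1..card A}" using J ranks_pos[OF th] by fastforce
  then have "J ` A = {1..card A}" using inj by (intro card_subset_eq) (auto simp: card_image)
  then have "(\<Sum>a\<in>A. J a) = \<Sum>{1..card A}" using sum.reindex[OF inj, of "\<lambda>x. x"] by simp
  moreover have "(\<Sum>a\<in>A. \<theta> (Some a)) = \<Sum>{1..card A}"
    using sum.reindex_bij_betw[OF ranks_bij_Some[OF th], of "\<lambda>x. x"] by simp
  ultimately have eq: "(\<Sum>a\<in>A. J a) = (\<Sum>a\<in>A. \<theta> (Some a))" by simp
  fix a assume a: "a \<in> A"
  have "J a = \<theta> (Some a)"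
  proof (rule ccontr)
    assume "J a \<noteq> \<theta> (Some a)"
    then have "(\<Sum>a\<in>A. \<theta> (Some a)) < (\<Sum>a\<in>A. J a)"
      using J a fin by (intro sum_strict_mono_ex1) (auto intro!: bexI[of _ a] simp: order_less_le)
    then show False using eq by simp
  qed
  then show "l (vtx u \<theta> (\<theta> (Some a))) = Some a" using J[OF a] by simp
qed

text \<open>Ties on 0-1 vectors are broken by the enumeration \<open>e\<close>. A full simplex
  starts at 0 and raises the coordinates in the order of their labels; the tie rule forces this
  order to be \<open>e\<close>, so one simplex counts, and its only door gives the identity
  permutation.\<close>

lemma sum_argmax_simplices:
  fixes A :: "'a set"
  assumes fin: "finite A" and e: "bij_betw e A {1..card A}" and N: "N \<ge> 0"
    and l: "\<And>S b. S \<subseteq> A \<Longrightarrow> b \<in> S \<Longrightarrow> (\<forall>a\<in>S. e a \<le> e b) \<Longrightarrow> l (\<lambda>a. of_bool (a \<in> S)) = Some b"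
    and good: "\<And>u. argmax_label A u (l u)"
  shows "(\<Sum>(u, \<theta>)\<in>lbox A N \<times> ranks A. door_sum A l u \<theta>) = 1"
proof -
  define \<theta>0 where "\<theta>0 p = (case p of None \<Rightarrow> 0 | Some a \<Rightarrow> if a \<in> A then e a else Suc (card A))" for p
  have einj: "e a = e b \<Longrightarrow> a \<in> A \<Longrightarrow> b \<in> A \<Longrightarrow> a = b" for a b using e by (auto simp: bij_betw_def dest: inj_onD)
  have erng: "1 \<le> e a \<and> e a \<le> card A" if "a \<in> A" for a using e that by (auto simp: bij_betw_def)
  have epos [simp]: "e a \<noteq> 0" if "a \<in> A" for a using erng[OF that] by simp
  have \<theta>0: "\<theta>0 \<in> ranks A"
  proof -
    have "inj_on \<theta>0 (opts A)"
    proof (rule inj_onI)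
      fix p q assume pq: "p \<in> opts A" "q \<in> opts A" "\<theta>0 p = \<theta>0 q"
      have *: "e a = 0 \<Longrightarrow> a \<in> A \<Longrightarrow> False" "0 = e a \<Longrightarrow> a \<in> A \<Longrightarrow> False" for a using epos[of a] by auto
      show "p = q"
      proof (cases p)
        case None then show ?thesis using pq * by (cases q) (auto simp: \<theta>0_def)
      next
        case (Some a) then show ?thesis using pq * einj by (cases q) (auto simp: \<theta>0_def)
      qed
    qed
    moreover have "\<theta>0 ` opts A \<subseteq> {..card A}" using erng by (auto simp: \<theta>0_def opts_def)
    ultimately have "bij_betw \<theta>0 (opts A) {..card A}"
      by (intro bij_betw_finite_inj) (auto simp: card_opts fin)
    then show ?thesis by (auto simp: ranks_def \<theta>0_def split: option.splits)
  qed
  have zero: "l (\<lambda>a. 0) = None" using good[of "\<lambda>a. 0"] by (auto simp: argmax_label_def split: option.splits)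
  have vt: "vtx (\<lambda>a. 0) \<theta> i = (\<lambda>a. of_bool (a \<in> {a \<in> A. \<theta> (Some a) \<le> i}))" if "\<theta> \<in> ranks A" "i \<le> card A" for \<theta> i
  proof -
    have "\<not> \<theta> (Some a) \<le> i" if "a \<notin> A" for a
      using ranks_out[OF \<open>\<theta> \<in> ranks A\<close>, of "Some a"] that \<open>i \<le> card A\<close> by simp
    then show ?thesis by (auto simp: vtx_def fun_eq_iff)
  qed
  have uniq: "u = (\<lambda>a. 0) \<and> \<theta> = \<theta>0" if th: "\<theta> \<in> ranks A" and u: "u \<in> lbox A N" and nz: "door_sum A l u \<theta> \<noteq> 0" for u \<theta>
  proof -
    have full: "\<exists>i\<le>card A. l (vtx u \<theta> i) = p" if "p \<in> opts A" for p
      using door_sum_nonzero_imp_full[OF th fin nz that] argmax_label_opts[OF good] by blast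
    have u0: "u = (\<lambda>a. 0)" and lab: "\<And>a. a \<in> A \<Longrightarrow> l (vtx u \<theta> (\<theta> (Some a))) = Some a"
      using full_argmax_simplex[OF th fin _ good full] u by (auto simp: lbox_def)
    have ord: "e b \<le> e a" if ab: "a \<in> A" "b \<in> A" "\<theta> (Some b) \<le> \<theta> (Some a)" for a b
    proof -
      let ?S = "{c \<in> A. \<theta> (Some c) \<le> \<theta> (Some a)}"
      have "e ` ?S \<noteq> {}" "finite (e ` ?S)" using ab fin by auto
      then have "Max (e ` ?S) \<in> e ` ?S" by (intro Max_in) auto
      then obtain c where c: "c \<in> ?S" "Max (e ` ?S) = e c" by (rule imageE)
      have mx: "\<forall>d\<in>?S. e d \<le> e c"
        unfolding c(2)[symmetric] using fin by (intro ballI Max_ge) auto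
      have "l (vtx u \<theta> (\<theta> (Some a))) = Some c"
        unfolding u0 using vt[OF th, of "\<theta> (Some a)"] ranks_le[OF th, of "Some a"] ab l[OF _ c(1) mx] by simp
      then have "c = a" using lab[OF ab(1)] by simp
      then show ?thesis using mx ab by auto
    qed
    \<comment> \<open>All elements ranked up to \<open>a\<close> have \<open>e\<close>-value at most
      \<open>e a\<close>, and counting them bounds the rank. Two bijections onto
      \<open>{1..card A}\<close> that are comparable pointwise coincide.\<close>
    have "\<theta> (Some a) \<le> e a" if a: "a \<in> A" for a
    proof -
      note bij = ranks_bij_Some[OF th]
      have im: "(\<lambda>a. \<theta> (Some a)) ` {b \<in> A. \<theta> (Some b) \<le> \<theta> (Some a)} = {1..\<theta> (Some a)}"
      proof -
        have "i \<in> (\<lambda>a. \<theta> (Some a)) ` {b \<in> A. \<theta> (Some b) \<le> \<theta> (Some a)}" if "i \<in> {1..\<theta> (Some a)}" for i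
        proof -
          have "i \<in> (\<lambda>a. \<theta> (Some a)) ` A" using bij that ranks_le[OF th, of "Some a"] a by (auto simp: bij_betw_def)
          then show ?thesis using that by auto
        qed
        then show ?thesis using ranks_pos[OF th] by (intro subset_antisym) (auto simp: Suc_le_eq)
      qed
      have "card {b \<in> A. \<theta> (Some b) \<le> \<theta> (Some a)} = card {1..\<theta> (Some a)}"
        unfolding im[symmetric] by (rule card_image[symmetric]) (use bij in \<open>auto simp: bij_betw_def inj_on_def\<close>)
      moreover have "card {b \<in> A. \<theta> (Some b) \<le> \<theta> (Some a)} \<le> card {1..e a}"
      proof (rule card_inj_on_le)
        show "inj_on e {b \<in> A. \<theta> (Some b) \<le> \<theta> (Some a)}" using einj by (auto simp: inj_on_def)
      qed (use ord erng a in auto)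
      ultimately show ?thesis by simp
    qed
    moreover have "(\<Sum>a\<in>A. \<theta> (Some a)) = (\<Sum>a\<in>A. e a)"
      using sum.reindex_bij_betw[OF ranks_bij_Some[OF th], of "\<lambda>x. x"] sum.reindex_bij_betw[OF e, of "\<lambda>x. x"] by simp
    ultimately have "\<theta> (Some a) = e a" if "a \<in> A" for a
      using sum_mono_inv[of "\<lambda>a. \<theta> (Some a)" A e] that fin by blast
    then have "\<theta> p = \<theta>0 p" for p
      using ranks_None[OF th] ranks_out[OF th, of p] by (cases p) (auto simp: \<theta>0_def)
    then show ?thesis using u0 by auto
  qed
  have S: "l (vtx (\<lambda>a. 0) \<theta>0 (e a)) = Some a" if "a \<in> A" for a
    using l[of "{b \<in> A. \<theta>0 (Some b) \<le> e a}" a] vt[OF \<theta>0, of "e a"] that erng by (auto simp: \<theta>0_def)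
  have "lab_perm A l (\<lambda>a. 0) \<theta>0 0 = id"
  proof
    fix p show "lab_perm A l (\<lambda>a. 0) \<theta>0 0 p = id p"
      using S by (cases p) (simp_all add: lab_perm_def \<theta>0_def)
  qed
  moreover have "psign (opts A) (lab_perm A l (\<lambda>a. 0) \<theta>0 i) = 0" if i: "i \<in> {..card A} - {0}" for i
  proof -
    obtain p where p: "p \<in> opts A" "\<theta>0 p = i" using ranks_surj[OF \<theta>0, of i] i by auto
    then have "p \<noteq> None" using i by (intro notI) (simp add: \<theta>0_def)
    moreover have "l (vtx (\<lambda>a. 0) \<theta>0 0) = None"
    proof -
      have "vtx (\<lambda>a. 0) \<theta>0 0 = (\<lambda>a. 0)" using ranks_pos'[OF \<theta>0] by (auto simp: vtx_def fun_eq_iff)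
      then show ?thesis using zero by simp
    qed
    then have "lab_perm A l (\<lambda>a. 0) \<theta>0 i p = lab_perm A l (\<lambda>a. 0) \<theta>0 i None"
      using p i by (auto simp: lab_perm_def \<theta>0_def)
    ultimately show ?thesis by (intro psign_eq_0)
  qed
  ultimately have one: "door_sum A l (\<lambda>a. 0) \<theta>0 = 1"
    unfolding door_sum_def by (subst sum.remove[of _ 0]) (auto simp: psign_def permutes_id)
  have "(\<Sum>w\<in>lbox A N \<times> ranks A. door_sum A l (fst w) (snd w)) = (\<Sum>w\<in>{(\<lambda>a. 0, \<theta>0)}. door_sum A l (fst w) (snd w))"
  proof (rule sum.mono_neutral_right)
    show "finite (lbox A N \<times> ranks A)" using fin finite_lbox finite_ranks by blast
    show "{(\<lambda>a. 0, \<theta>0)} \<subseteq> lbox A N \<times> ranks A" using \<theta>0 N by (auto simp: lbox_def)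
    show "\<forall>w\<in>lbox A N \<times> ranks A - {(\<lambda>a. 0, \<theta>0)}. door_sum A l (fst w) (snd w) = 0"
      using uniq by (metis DiffE insertI1 mem_Times_iff prod.collapse)
  qed
  then show ?thesis using one by (simp add: case_prod_unfold)
qed

text \<open>By \<open>door_sum_total_eq\<close> only labels outside the box matter for the total;
  inside they are replaced by argmax labels with the tie rule on 0-1 vectors. The bound
  \<open>N \<ge> 1\<close> puts all these vectors inside the box.\<close>

theorem signed_sperner:
  fixes A :: "'a set"
  assumes fin: "finite A" and ne: "A \<noteq> {}" and N: "N \<ge> 1"
    and good: "\<And>u. u \<notin> lbox A N \<Longrightarrow> argmax_label A u (l u)"
  shows "(\<Sum>(u, \<theta>)\<in>lbox A (N + 2) \<times> ranks A. door_sum A l u \<theta>) = 1"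
proof -
  obtain e where e: "bij_betw e A {1..card A}"
    using ex_bij_betw_nat_finite_1[OF fin] bij_betw_inv_into by blast
  have einj: "e a = e b \<Longrightarrow> a \<in> A \<Longrightarrow> b \<in> A \<Longrightarrow> a = b" for a b using e by (auto simp: bij_betw_def dest: inj_onD)
  define top where "top S = (SOME b. b \<in> S \<and> (\<forall>a\<in>S. e a \<le> e b))" for S
  have top: "top S = b" if "S \<subseteq> A" "b \<in> S" "\<forall>a\<in>S. e a \<le> e b" for S b
  proof -
    have "top S \<in> S \<and> (\<forall>a\<in>S. e a \<le> e (top S))" unfolding top_def by (rule someI[of _ b]) (use that in auto)
    then show ?thesis using that einj by (meson order_antisym subsetD)
  qed
  have topex: "\<exists>b\<in>S. \<forall>a\<in>S. e a \<le> e b" if "S \<subseteq> A" "S \<noteq> {}" for S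
  proof -
    have f: "finite S" using that fin finite_subset by blast
    then have "Max (e ` S) \<in> e ` S" using that by (intro Max_in) auto
    then obtain b where "b \<in> S" "e b = Max (e ` S)" by (metis imageE)
    then show ?thesis using f by (intro bexI[of _ b]) auto
  qed
  define l' where "l' u = (if u \<notin> lbox A N then l u
     else if \<exists>S\<subseteq>A. S \<noteq> {} \<and> u = (\<lambda>a. of_bool (a \<in> S)) then Some (top {a \<in> A. u a = 1})
     else (SOME p. argmax_label A u p))" for u
  have "(\<Sum>(u, \<theta>)\<in>lbox A (N + 2) \<times> ranks A. door_sum A l u \<theta>)
      = (\<Sum>(u, \<theta>)\<in>lbox A (N + 2) \<times> ranks A. door_sum A l' u \<theta>)"
    by (rule door_sum_total_eq[OF fin ne, of N]) (simp add: l'_def)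
  also have "\<dots> = 1"
  proof (rule sum_argmax_simplices[OF fin e])
    show "N + 2 \<ge> 0" using N by simp
    fix S b assume S: "S \<subseteq> A" "b \<in> S" "\<forall>a\<in>S. e a \<le> e b"
    have "(\<lambda>a. of_bool (a \<in> S)) \<in> lbox A N" using N S by (auto simp: lbox_def)
    moreover have "{a \<in> A. of_bool (a \<in> S) = (1::int)} = S" using S by auto
    ultimately show "l' (\<lambda>a. of_bool (a \<in> S)) = Some b"
      using S top[OF S] unfolding l'_def by auto
  next
    fix u
    show "argmax_label A u (l' u)"
    proof (cases "u \<in> lbox A N \<and> (\<exists>S\<subseteq>A. S \<noteq> {} \<and> u = (\<lambda>a. of_bool (a \<in> S)))")
      case True
      then obtain S where S: "S \<subseteq> A" "S \<noteq> {}" "u = (\<lambda>a. of_bool (a \<in> S))" by auto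
      obtain b where b: "b \<in> S" "\<forall>a\<in>S. e a \<le> e b" using topex S by blast
      have "{a \<in> A. u a = 1} = S" using S by auto
      then have "l' u = Some b" using True top[OF S(1) b] unfolding l'_def by auto
      then show ?thesis using S b by (auto simp: argmax_label_def)
    next
      case False
      then show ?thesis using good someI_ex[OF argmax_label_ex[OF fin, of u]] unfolding l'_def by auto
    qed
  qed
  finally show ?thesis .
qed

section \<open>Sums over permutations modulo a prime\<close>

text \<open>If \<open>p\<close> did not divide the binomial coefficient,
  \<open>i * (n choose i) = n * (n - 1 choose (i - 1))\<close> would force \<open>p ^ e\<close> to
  divide \<open>i\<close>. Used in both directions: for the number of shuffles and for the gcd of
  binomial coefficients.\<close>

lemma prime_dvd_choose_of_power_dvd:
  fixes p n i :: nat
  assumes p: "prime p" and n: "p ^ e dvd n" and i: "0 < i" "i < p ^ e"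
  shows "p dvd (n choose i)"
proof (rule ccontr)
  assume "\<not> p dvd (n choose i)"
  then have "coprime (p ^ e) (n choose i)" using p prime_imp_coprime by auto
  moreover have "p ^ e dvd i * (n choose i)"
  proof (cases "n = 0")
    case False
    then have "i * (n choose i) = n * (n - 1 choose (i - 1))" using i times_binomial_minus1_eq by auto
    then show ?thesis using n by simp
  qed (use i in \<open>simp add: binomial_eq_0\<close>)
  ultimately have "p ^ e dvd i" using coprime_dvd_mult_left_iff by blast
  then show False using i dvd_imp_le by fastforce
qed

text \<open>Each point \<open>x\<close> of the orbit of \<open>y\<close> is carried to
  \<open>y\<close> by a unique group element \<open>S x\<close>, and covariance gives
  \<open>H e x = H (S x) y\<close>. So the sum of the single function \<open>H e\<close> over an
  orbit becomes a sum over the group at the single point \<open>y\<close>.\<close>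

lemma sum_free_orbits_dvd:
  fixes act :: "'g \<Rightarrow> 'd \<Rightarrow> 'd" and H :: "'g \<Rightarrow> 'd \<Rightarrow> int"
  assumes fin: "finite D" "finite G" and e: "e \<in> G" "\<And>x. x \<in> D \<Longrightarrow> act e x = x"
    and clos: "\<And>g x. g \<in> G \<Longrightarrow> x \<in> D \<Longrightarrow> act g x \<in> D"
    and comp: "\<And>g h. g \<in> G \<Longrightarrow> h \<in> G \<Longrightarrow> \<exists>k\<in>G. \<forall>x\<in>D. act h (act g x) = act k x"
    and free: "\<And>g h x. g \<in> G \<Longrightarrow> h \<in> G \<Longrightarrow> x \<in> D \<Longrightarrow> act g x = act h x \<Longrightarrow> g = h"
    and inj: "\<And>g. g \<in> G \<Longrightarrow> inj_on (act g) D"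
    and cov: "\<And>g x. g \<in> G \<Longrightarrow> x \<in> D \<Longrightarrow> H g (act g x) = H e x"
    and dvd: "\<And>x. x \<in> D \<Longrightarrow> k dvd (\<Sum>g\<in>G. H g x)"
  shows "k dvd (\<Sum>x\<in>D. H e x)"
proof -
  define Orb where "Orb x = (\<lambda>g. act g x) ` G" for x
  have finO: "finite (Orb x)" for x using fin by (simp add: Orb_def)
  have cardO: "card (Orb x) = card G" if "x \<in> D" for x
    unfolding Orb_def by (rule card_image) (use free that in \<open>auto simp: inj_on_def\<close>)
  have self: "x \<in> Orb x" if "x \<in> D" for x using e that unfolding Orb_def by force
  have sub: "Orb x \<subseteq> D" if "x \<in> D" for x using clos that by (auto simp: Orb_def)
  have eq: "Orb y = Orb x" if x: "x \<in> D" and y: "y \<in> Orb x" for x y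
  proof (rule card_subset_eq[OF finO])
    from y obtain g where g: "y = act g x" "g \<in> G" unfolding Orb_def by (rule imageE)
    show "Orb y \<subseteq> Orb x"
    proof
      fix z assume "z \<in> Orb y"
      then obtain h where h: "z = act h y" "h \<in> G" unfolding Orb_def by (rule imageE)
      from comp[OF g(2) h(2)] obtain k' where k': "k' \<in> G" "\<forall>x\<in>D. act h (act g x) = act k' x" by (rule bexE)
      then have "z = act k' x" using x h(1) g(1) by simp
      then show "z \<in> Orb x" unfolding Orb_def using k'(1) by (rule image_eqI)
    qed
    show "card (Orb y) = card (Orb x)" using cardO[OF x] cardO[OF subsetD[OF sub[OF x] y]] by simp
  qed
  have "D = \<Union>(Orb ` D)" using self sub by blast
  then have "(\<Sum>x\<in>D. H e x) = (\<Sum>x\<in>\<Union>(Orb ` D). H e x)" by (rule arg_cong)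
  also have "\<dots> = (\<Sum>O'\<in>Orb ` D. \<Sum>x\<in>O'. H e x)"
  proof (rule sum.Union_disjoint[unfolded comp_def])
    show "\<forall>A\<in>Orb ` D. \<forall>B\<in>Orb ` D. A \<noteq> B \<longrightarrow> A \<inter> B = {}"
    proof (intro ballI impI)
      fix A B assume AB: "A \<in> Orb ` D" "B \<in> Orb ` D" "A \<noteq> B"
      then obtain x y where xy: "x \<in> D" "A = Orb x" "y \<in> D" "B = Orb y" by blast
      have False if "z \<in> A" "z \<in> B" for z
        using eq[OF xy(1), of z] eq[OF xy(3), of z] that xy AB(3) by simp
      then show "A \<inter> B = {}" by blast
    qed
  qed (use finO in auto)
  finally have total: "(\<Sum>x\<in>D. H e x) = (\<Sum>O'\<in>Orb ` D. \<Sum>x\<in>O'. H e x)" .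
  have "(\<Sum>x\<in>Orb y. H e x) = (\<Sum>g\<in>G. H g y)" if y: "y \<in> D" for y
  proof -
    define S where "S x = (THE g. g \<in> G \<and> act g x = y)" for x
    have S: "S x \<in> G \<and> act (S x) x = y" if "x \<in> Orb y" for x
    proof -
      have x: "x \<in> D" using sub y that by blast
      have "y \<in> Orb x" using eq[OF y that] self[OF y] by simp
      then obtain g where "act g x = y" "g \<in> G" unfolding Orb_def by (metis imageE)
      have "S x = g" unfolding S_def
      proof (rule the_equality)
        fix h assume "h \<in> G \<and> act h x = y"
        then show "h = g" using \<open>g \<in> G\<close> \<open>act g x = y\<close> by (intro free[OF _ _ x]) auto
      qed (use \<open>g \<in> G\<close> \<open>act g x = y\<close> in simp)
      then show ?thesis using \<open>g \<in> G\<close> \<open>act g x = y\<close> by simp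
    qed
    have "inj_on S (Orb y)"
    proof (rule inj_onI)
      fix a b assume ab: "a \<in> Orb y" "b \<in> Orb y" "S a = S b"
      then have "act (S a) a = act (S a) b" using S[OF ab(1)] S[OF ab(2)] by simp
      then show "a = b" using inj_onD[OF inj[of "S a"]] S[OF ab(1)] ab subsetD[OF sub[OF y]] by blast
    qed
    moreover have "S ` Orb y \<subseteq> G" using S by auto
    ultimately have "bij_betw S (Orb y) G" using cardO[OF y] fin by (intro bij_betw_finite_inj) auto
    then have "(\<Sum>g\<in>G. H g y) = (\<Sum>x\<in>Orb y. H (S x) y)"
      by (rule sum.reindex_bij_betw[symmetric])
    also have "\<dots> = (\<Sum>x\<in>Orb y. H e x)"
    proof (rule sum.cong)
      fix x assume x: "x \<in> Orb y"
      then show "H (S x) y = H e x" using S[OF x] cov[of "S x" x] subsetD[OF sub[OF y] x] by simp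
    qed simp
    finally show ?thesis by simp
  qed
  then show ?thesis unfolding total by (intro dvd_sum[of "Orb ` D"]) (use dvd in auto)
qed

lemma ex_mono_bij:
  fixes I J :: "nat set"
  assumes "finite I" "finite J" "card I = card J"
  shows "\<exists>f. bij_betw f I J \<and> (\<forall>x\<in>I. \<forall>y\<in>I. x < y \<longleftrightarrow> f x < f y)"
proof -
  obtain f where f: "bij_betw f {..<card I} I" "strict_mono_on {..<card I} f"
    using ex_bij_betw_strict_mono_card[OF assms(1)] by blast
  obtain g where g: "bij_betw g {..<card I} J" "strict_mono_on {..<card I} g"
    using ex_bij_betw_strict_mono_card[OF assms(2)] assms(3) by metis
  let ?k = "inv_into {..<card I} f"
  have k: "bij_betw ?k I {..<card I}" using f(1) by (rule bij_betw_inv_into)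
  have fk: "f (?k x) = x \<and> ?k x \<in> {..<card I}" if "x \<in> I" for x
    using that f(1) by (metis bij_betw_def f_inv_into_f inv_into_into)
  have "x < y \<longleftrightarrow> g (?k x) < g (?k y)" if "x \<in> I" "y \<in> I" for x y
    using fk[OF that(1)] fk[OF that(2)] strict_mono_on_less[OF f(2)] strict_mono_on_less[OF g(2)] by metis
  moreover have "bij_betw (g \<circ> ?k) I J" using k g(1) by (rule bij_betw_trans)
  ultimately show ?thesis by (intro exI[of _ "g \<circ> ?k"]) auto
qed

text \<open>Supplies the coset representatives for \<open>shuffle_sum_dvd\<close>: composing with
  them relocates the image of \<open>I\<close> but keeps the orders that \<open>h\<close> can
  see.\<close>

lemma shuffle_permutation:
  assumes I: "I \<subseteq> {..<n}" and J: "J \<subseteq> {..<n}" "card I = card J"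
  shows "\<exists>s. s permutes {..<n::nat} \<and> s ` I = J \<and> (\<forall>x\<in>I. \<forall>y\<in>I. x < y \<longleftrightarrow> s x < s y)
     \<and> (\<forall>x\<in>{..<n}-I. \<forall>y\<in>{..<n}-I. x < y \<longleftrightarrow> s x < s y)"
proof -
  have fin: "finite I" "finite J" using I J finite_subset by blast+
  obtain f where f: "bij_betw f I J" "\<forall>x\<in>I. \<forall>y\<in>I. x < y \<longleftrightarrow> f x < f y"
    using ex_mono_bij[OF fin J(2)] by blast
  have "card ({..<n} - I) = card ({..<n} - J)" using fin I J by (simp add: card_Diff_subset)
  then obtain g where g: "bij_betw g ({..<n}-I) ({..<n}-J)" "\<forall>x\<in>{..<n}-I. \<forall>y\<in>{..<n}-I. x < y \<longleftrightarrow> g x < g y"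
    using ex_mono_bij[of "{..<n}-I" "{..<n}-J"] by blast
  define s where "s x = (if x \<in> I then f x else if x < n then g x else x)" for x
  have "bij_betw s I J" using f(1) by (rule bij_betw_cong[THEN iffD1, rotated]) (simp add: s_def)
  moreover have "bij_betw s ({..<n}-I) ({..<n}-J)"
    using g(1) by (rule bij_betw_cong[THEN iffD1, rotated]) (simp add: s_def)
  ultimately have "bij_betw s (I \<union> ({..<n}-I)) (J \<union> ({..<n}-J))" by (rule bij_betw_combine) auto
  then have "bij_betw s {..<n} {..<n}" using I J by (simp add: Un_absorb1)
  then have "s permutes {..<n}" by (rule bij_imp_permutes) (use I in \<open>auto simp: s_def\<close>)
  moreover have "s ` I = J" using \<open>bij_betw s I J\<close> by (simp add: bij_betw_def)
  ultimately show ?thesis using f(2) g(2) by (intro exI[of _ s]) (auto simp: s_def)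
qed

text \<open>Each value of \<open>h\<close> is attained on a full set of shuffles of \<open>I\<close> with its complement, and their number is the binomial
  coefficient \<open>n choose card I\<close>.\<close>

lemma shuffle_sum_dvd:
  fixes h :: "(nat \<Rightarrow> nat) \<Rightarrow> int"
  assumes p: "prime p" and n: "n = p ^ e" and I: "I \<subseteq> {..<n}" "I \<noteq> {}" "I \<noteq> {..<n}"
    and inv: "\<And>s s'. s permutes {..<n} \<Longrightarrow> s' permutes {..<n}
      \<Longrightarrow> (\<And>x y. x \<in> I \<Longrightarrow> y \<in> I \<Longrightarrow> s x < s y \<longleftrightarrow> s' x < s' y)
      \<Longrightarrow> (\<And>x y. x \<in> {..<n}-I \<Longrightarrow> y \<in> {..<n}-I \<Longrightarrow> s x < s y \<longleftrightarrow> s' x < s' y) \<Longrightarrow> h s = h s'"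
  shows "int p dvd (\<Sum>s | s permutes {..<n}. h s)"
proof -
  let ?P = "{s. s permutes {..<n}}" and ?B = "{b. b permutes {..<n} \<and> b ` I = I}"
  let ?K = "{J. J \<subseteq> {..<n} \<and> card J = card I}"
  have finP: "finite ?P" by (simp add: finite_permutations)
  have finI: "finite I" using I finite_subset by blast
  have K: "s ` I \<in> ?K" if "s \<in> ?P" for s
  proof -
    have s: "s permutes {..<n}" using that by simp
    have "s ` I \<subseteq> s ` {..<n}" using I(1) by (rule image_mono)
    then have "s ` I \<subseteq> {..<n}" by (simp add: permutes_image[OF s])
    moreover have "card (s ` I) = card I" by (rule card_image) (rule inj_on_subset[OF permutes_inj[OF s]], simp)
    ultimately show ?thesis by simp
  qed
  have fiber: "(\<Sum>s\<in>{s \<in> ?P. s ` I = J}. h s) = (\<Sum>b\<in>?B. h b)" if J: "J \<in> ?K" for J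
  proof -
    obtain t where t: "t permutes {..<n}" "t ` I = J" "\<forall>x\<in>I. \<forall>y\<in>I. x < y \<longleftrightarrow> t x < t y"
      "\<forall>x\<in>{..<n}-I. \<forall>y\<in>{..<n}-I. x < y \<longleftrightarrow> t x < t y"
      using shuffle_permutation[OF I(1), of J] J by auto
    have hb: "h (t \<circ> b) = h b" if b: "b permutes {..<n}" "b ` I = I" for b
    proof (rule inv)
      show "t \<circ> b permutes {..<n}" using permutes_compose[OF b(1) t(1)] .
      fix x y
      { assume "x \<in> I" "y \<in> I"
        then have "b x \<in> I" "b y \<in> I" using b(2) by auto
        then show "(t \<circ> b) x < (t \<circ> b) y \<longleftrightarrow> b x < b y" using t(3) by auto }
      { assume xy: "x \<in> {..<n}-I" "y \<in> {..<n}-I"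
        have "b z \<in> {..<n} - I" if "z \<in> {..<n} - I" for z
          using that b permutes_inj[OF b(1)] by (metis Diff_iff inj_image_mem_iff permutes_in_image)
        then show "(t \<circ> b) x < (t \<circ> b) y \<longleftrightarrow> b x < b y" using t(4) xy by auto }
    qed (use b in auto)
    have "(\<Sum>s\<in>{s \<in> ?P. s ` I = J}. h s) = (\<Sum>b\<in>?B. h (t \<circ> b))"
    proof (rule sum.reindex_bij_witness[where i="\<lambda>b. t \<circ> b" and j="\<lambda>s. Hilbert_Choice.inv t \<circ> s"])
      fix s assume s: "s \<in> {s \<in> ?P. s ` I = J}"
      show "t \<circ> (Hilbert_Choice.inv t \<circ> s) = s" using permutes_inv_o[OF t(1)] by (simp add: o_assoc)
      then show "h (t \<circ> (Hilbert_Choice.inv t \<circ> s)) = h s" by simp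
      have tJ: "Hilbert_Choice.inv t ` J = I" unfolding t(2)[symmetric] image_comp permutes_inv_o(2)[OF t(1)] by simp
      have "(Hilbert_Choice.inv t \<circ> s) ` I = Hilbert_Choice.inv t ` (s ` I)" by (simp add: image_comp)
      then have "(Hilbert_Choice.inv t \<circ> s) ` I = I" using s tJ by simp
      then show "Hilbert_Choice.inv t \<circ> s \<in> ?B" using s permutes_compose[of s _ "Hilbert_Choice.inv t"] permutes_inv[OF t(1)]
        by simp
    next
      fix b assume b: "b \<in> ?B"
      show "Hilbert_Choice.inv t \<circ> (t \<circ> b) = b" using permutes_inv_o[OF t(1)] by (simp add: o_assoc)
      have "(t \<circ> b) ` I = t ` (b ` I)" by (simp add: image_comp)
      then show "t \<circ> b \<in> {s \<in> ?P. s ` I = J}" using b t permutes_compose[of b _ t] by simp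
    qed
    also have "\<dots> = (\<Sum>b\<in>?B. h b)" by (rule sum.cong) (use hb in auto)
    finally show ?thesis .
  qed
  have finK: "finite ?K" by (rule finite_subset[of _ "Pow {..<n}"]) auto
  have "(\<Sum>s\<in>?P. h s) = (\<Sum>J\<in>?K. \<Sum>s\<in>{s \<in> ?P. s ` I = J}. h s)"
    by (rule sum.group[symmetric]) (use finP finK K in auto)
  also have "\<dots> = (\<Sum>J\<in>?K. \<Sum>b\<in>?B. h b)" by (rule sum.cong) (use fiber in auto)
  also have "\<dots> = int (n choose card I) * (\<Sum>b\<in>?B. h b)"
    using n_subsets[of "{..<n}" "card I"] by simp
  finally have eq: "(\<Sum>s\<in>?P. h s) = int (n choose card I) * (\<Sum>b\<in>?B. h b)" .
  have "card I < n" using I psubset_card_mono[of "{..<n}" I] by auto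
  then have "p dvd (n choose card I)"
    using prime_dvd_choose_of_power_dvd[OF p, of e n "card I"] n I finI by (simp add: card_gt_0_iff)
  then show ?thesis unfolding eq by simp
qed

section \<open>Addresses and the wreath product action\<close>

lemma reindex_Nil [simp]: "reindex \<sigma> j [] = []"
  by (simp add: reindex_def)

lemma reindex_Cons [simp]: "reindex \<sigma> j (i # ts) = inv (\<sigma> j ts) i # reindex \<sigma> (Suc j) ts"
proof -
  have "[0..<length (i # ts)] = 0 # map Suc [0..<length ts]" by (simp add: upt_conv_Cons map_Suc_upt del: upt_Suc)
  then show ?thesis by (simp add: reindex_def comp_def)
qed

lemma length_reindex [simp]: "length (reindex \<sigma> j a) = length a"
  by (simp add: reindex_def)

lemma drop_reindex: "drop t (reindex \<sigma> j a) = reindex \<sigma> (j + t) (drop t a)"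
proof (induction t arbitrary: j a)
  case (Suc t) then show ?case by (cases a) auto
qed simp

lemma valid_addr_Cons [simp]:
  "j < length ns \<Longrightarrow> valid_addr ns j (i # ts) \<longleftrightarrow> i < ns ! j \<and> valid_addr ns (Suc j) ts"
  by (simp add: valid_addr_def Cons_nth_drop_Suc[symmetric])

lemma valid_addr_Nil [simp]: "valid_addr ns j [] \<longleftrightarrow> length ns \<le> j"
  by (simp add: valid_addr_def)

lemma valid_addr_length: "valid_addr ns j a \<Longrightarrow> length a = length ns - j"
  by (auto simp: valid_addr_def dest: list_all2_lengthD)

lemma valid_addr_ge: "length ns \<le> j \<Longrightarrow> valid_addr ns j a \<longleftrightarrow> a = []"
  by (simp add: valid_addr_def)

lemma valid_addr_cases:
  assumes "valid_addr ns j a"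
  obtains "length ns \<le> j" "a = []" | i ts where "j < length ns" "a = i # ts" "i < ns ! j" "valid_addr ns (Suc j) ts"
  using assms by (cases "j < length ns"; cases a) (auto simp: valid_addr_ge)

lemma valid_addr_drop: "valid_addr ns j a \<Longrightarrow> valid_addr ns (j + t) (drop t a)"
  unfolding valid_addr_def by (metis add.commute drop_drop list_all2_dropI)

lemma finite_valid_addr: "finite {a. valid_addr ns j a}"
proof -
  have "{a. valid_addr ns j a} \<subseteq> {a. set a \<subseteq> {..<Max (insert 0 (set ns))} \<and> length a = length ns - j}"
  proof safe
    fix a x assume a: "valid_addr ns j a" and "x \<in> set a"
    then obtain t where "t < length a" "x = a ! t" by (auto simp: in_set_conv_nth)
    then have "x < drop j ns ! t" "t < length (drop j ns)" using a by (auto simp: valid_addr_def list_all2_conv_all_nth)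
    then have "x < y" "y \<in> set ns" if "y = drop j ns ! t" for y
      using that by (auto dest: nth_mem in_set_dropD)
    then show "x < Max (insert 0 (set ns))" by (meson List.finite_set Max_ge finite.insertI insertI2 order_less_le_trans)
  qed (auto dest: valid_addr_length)
  then show ?thesis by (rule finite_subset) (rule finite_lists_length_eq, simp)
qed

lemma Sigma_grp_permutes:
  "\<sigma> \<in> Sigma_grp ns \<Longrightarrow> j < length ns \<Longrightarrow> valid_addr ns (Suc j) ts \<Longrightarrow> \<sigma> j ts permutes {..<ns ! j}"
  by (auto simp: Sigma_grp_def)

lemma valid_addr_reindex:
  assumes "\<sigma> \<in> Sigma_grp ns"
  shows "valid_addr ns j a \<Longrightarrow> valid_addr ns j (reindex \<sigma> j a)"
proof (induction a arbitrary: j)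
  case Nil then show ?case by simp
next
  case (Cons i a)
  then have j: "j < length ns" using valid_addr_cases by blast
  then have "i < ns ! j" "valid_addr ns (Suc j) a" using Cons by auto
  moreover have "inv (\<sigma> j a) permutes {..<ns ! j}"
    using Sigma_grp_permutes[OF assms j] calculation by (simp add: permutes_inv)
  ultimately show ?case using j Cons.IH permutes_in_image by fastforce
qed

lemma reindex_inject:
  assumes "\<sigma> \<in> Sigma_grp ns"
  shows "valid_addr ns j a \<Longrightarrow> valid_addr ns j b \<Longrightarrow> reindex \<sigma> j a = reindex \<sigma> j b \<Longrightarrow> a = b"
proof (induction a arbitrary: j b)
  case Nil then show ?case by (cases b) auto
next
  case (Cons i a)
  then have j: "j < length ns" using valid_addr_cases by blast
  obtain i' b' where b: "b = i' # b'" using Cons by (cases b) auto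
  have "a = b'" using Cons b j by auto
  moreover have "inv (\<sigma> j a) permutes {..<ns ! j}"
    using Sigma_grp_permutes[OF assms j] Cons j by (simp add: permutes_inv)
  then have "inj (inv (\<sigma> j a))" by (rule permutes_inj)
  ultimately show ?case using Cons b by (auto dest: injD)
qed

text \<open>The product in the wreath product. The second factor is read at the reindexed tail
  because the first one moves the nodes; on addresses the order of the factors is reversed.\<close>

definition sigma_comp :: "nat list \<Rightarrow> (nat \<Rightarrow> nat list \<Rightarrow> nat \<Rightarrow> nat) \<Rightarrow> (nat \<Rightarrow> nat list \<Rightarrow> nat \<Rightarrow> nat) \<Rightarrow> nat \<Rightarrow> nat list \<Rightarrow> nat \<Rightarrow> nat" where
  "sigma_comp ns \<sigma> \<tau> j ts = (if j < length ns \<and> valid_addr ns (Suc j) ts then \<sigma> j ts \<circ> \<tau> j (reindex \<sigma> (Suc j) ts) else id)"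

lemma sigma_comp_in: "\<sigma> \<in> Sigma_grp ns \<Longrightarrow> \<tau> \<in> Sigma_grp ns \<Longrightarrow> sigma_comp ns \<sigma> \<tau> \<in> Sigma_grp ns"
proof -
  assume s: "\<sigma> \<in> Sigma_grp ns" and t: "\<tau> \<in> Sigma_grp ns"
  have "\<sigma> j ts \<circ> \<tau> j (reindex \<sigma> (Suc j) ts) permutes {..<ns ! j}" if "j < length ns" "valid_addr ns (Suc j) ts" for j ts
    using Sigma_grp_permutes[OF s that] Sigma_grp_permutes[OF t that(1) valid_addr_reindex[OF s that(2)]] permutes_compose by blast
  then show ?thesis by (auto simp: Sigma_grp_def sigma_comp_def)
qed

lemma reindex_sigma_comp:
  assumes s: "\<sigma> \<in> Sigma_grp ns" and t: "\<tau> \<in> Sigma_grp ns"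
  shows "valid_addr ns j a \<Longrightarrow> reindex (sigma_comp ns \<sigma> \<tau>) j a = reindex \<tau> j (reindex \<sigma> j a)"
proof (induction a arbitrary: j)
  case (Cons i a)
  then have j: "j < length ns" using valid_addr_cases by blast
  then have v: "valid_addr ns (Suc j) a" using Cons by auto
  have "bij (\<sigma> j a)" "bij (\<tau> j (reindex \<sigma> (Suc j) a))"
    using Sigma_grp_permutes[OF s j v] Sigma_grp_permutes[OF t j valid_addr_reindex[OF s v]] permutes_bij by blast+
  then show ?case using Cons j v by (simp add: sigma_comp_def o_inv_distrib)
qed simp

lemma id_in_Sigma_grp: "(\<lambda>j ts. id) \<in> Sigma_grp ns"
  by (simp add: Sigma_grp_def permutes_id)

lemma reindex_id [simp]: "reindex (\<lambda>j ts. id) j a = a"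
  by (induction a arbitrary: j) simp_all

lemma Sigma_grp_eqI:
  assumes s: "\<sigma> \<in> Sigma_grp ns" and t: "\<tau> \<in> Sigma_grp ns"
    and eq: "\<And>j a. j < length ns \<Longrightarrow> valid_addr ns j a \<Longrightarrow> reindex \<sigma> j a = reindex \<tau> j a"
  shows "\<sigma> = \<tau>"
proof (intro ext)
  fix j ts i
  show "\<sigma> j ts i = \<tau> j ts i"
  proof (cases "j < length ns \<and> valid_addr ns (Suc j) ts")
    case True
    then have ps: "\<sigma> j ts permutes {..<ns ! j}" "\<tau> j ts permutes {..<ns ! j}"
      using Sigma_grp_permutes s t by auto
    have "inv (\<sigma> j ts) x = inv (\<tau> j ts) x" for x
    proof (cases "x < ns ! j")
      case x: True
      then show ?thesis using eq[of j "x # ts"] True by simp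
    next
      case False
      then show ?thesis using permutes_not_in[OF permutes_inv[OF ps(1)]] permutes_not_in[OF permutes_inv[OF ps(2)]] by simp
    qed
    then have "inv (\<sigma> j ts) = inv (\<tau> j ts)" by auto
    then have "\<sigma> j ts = \<tau> j ts" using permutes_inv_inv[OF ps(1)] permutes_inv_inv[OF ps(2)] by metis
    then show ?thesis by simp
  next
    case False
    then have "\<sigma> j ts = id" "\<tau> j ts = id" using s t by (auto simp: Sigma_grp_def)
    then show ?thesis by simp
  qed
qed

lemma bij_betw_reindex:
  assumes "\<sigma> \<in> Sigma_grp ns"
  shows "bij_betw (reindex \<sigma> j) {a. valid_addr ns j a} {a. valid_addr ns j a}"
proof (rule bij_betw_finite_inj)
  show "inj_on (reindex \<sigma> j) {a. valid_addr ns j a}" using reindex_inject[OF assms] by (auto simp: inj_on_def)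
qed (use valid_addr_reindex[OF assms] finite_valid_addr in auto)

type_synonym slot = "nat \<times> nat list \<times> nat"

definition slots :: "nat list \<Rightarrow> nat \<Rightarrow> slot set" where
  "slots ns D = {(j, a, c). j < length ns \<and> valid_addr ns j a \<and> c < D}"

text \<open>A group element as a permutation of the coordinates of a Euclidean space; other triples
  stay fixed so that it permutes the whole type.\<close>

definition slot_map :: "nat list \<Rightarrow> nat \<Rightarrow> (nat \<Rightarrow> nat list \<Rightarrow> nat \<Rightarrow> nat) \<Rightarrow> slot \<Rightarrow> slot" where
  "slot_map ns D \<sigma> s = (case s of (j, a, c) \<Rightarrow> if s \<in> slots ns D then (j, reindex \<sigma> j a, c) else s)"

lemma finite_slots: "finite (slots ns D)"
proof -
  have "slots ns D = (\<Union>j<length ns. (\<lambda>(a, c). (j, a, c)) ` ({a. valid_addr ns j a} \<times> {..<D}))"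
    by (auto simp: slots_def)
  then show ?thesis using finite_valid_addr by simp
qed

lemma slot_map_permutes:
  assumes "\<sigma> \<in> Sigma_grp ns"
  shows "slot_map ns D \<sigma> permutes slots ns D"
proof (rule bij_imp_permutes)
  show "bij_betw (slot_map ns D \<sigma>) (slots ns D) (slots ns D)"
  proof (rule bij_betw_finite_inj)
    show "inj_on (slot_map ns D \<sigma>) (slots ns D)"
      using reindex_inject[OF assms] by (auto simp: inj_on_def slot_map_def slots_def)
    show "slot_map ns D \<sigma> ` slots ns D \<subseteq> slots ns D"
      using valid_addr_reindex[OF assms] by (auto simp: slot_map_def slots_def)
  qed (auto simp: finite_slots)
qed (auto simp: slot_map_def)

lemma slot_map_comp:
  assumes "\<sigma> \<in> Sigma_grp ns" "\<tau> \<in> Sigma_grp ns"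
  shows "slot_map ns D \<tau> (slot_map ns D \<sigma> s) = slot_map ns D (sigma_comp ns \<sigma> \<tau>) s"
proof -
  obtain j a c where "s = (j, a, c)" by (cases s)
  then show ?thesis
    using valid_addr_reindex[OF assms(1), of j a] reindex_sigma_comp[OF assms, of j a]
    by (simp add: slot_map_def slots_def)
qed

lemma slot_map_id [simp]: "slot_map ns D (\<lambda>j ts. id) s = s"
  by (auto simp: slot_map_def split: prod.split)

lemma slot_map_inject:
  assumes s: "\<sigma> \<in> Sigma_grp ns" "\<tau> \<in> Sigma_grp ns" and D: "D > 0"
    and eq: "\<And>s. s \<in> slots ns D \<Longrightarrow> slot_map ns D \<sigma> s = slot_map ns D \<tau> s"
  shows "\<sigma> = \<tau>"
proof (rule Sigma_grp_eqI[OF s])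
  fix j a assume "j < length ns" "valid_addr ns j a"
  then show "reindex \<sigma> j a = reindex \<tau> j a" using eq[of "(j, a, 0)"] D by (simp add: slot_map_def slots_def)
qed

lemma finite_Sigma_grp: "finite (Sigma_grp ns)"
proof (rule inj_on_finite[of "slot_map ns 1" _ "{p. p permutes slots ns 1}"])
  show "inj_on (slot_map ns 1) (Sigma_grp ns)" using slot_map_inject[of _ ns _ 1] by (auto simp: inj_on_def)
qed (use slot_map_permutes finite_permutations[OF finite_slots] in auto)

definition sigma_upd :: "(nat \<Rightarrow> nat list \<Rightarrow> nat \<Rightarrow> nat) \<Rightarrow> nat \<Rightarrow> nat list \<Rightarrow> (nat \<Rightarrow> nat) \<Rightarrow> nat \<Rightarrow> nat list \<Rightarrow> nat \<Rightarrow> nat" where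
  "sigma_upd \<sigma> j0 tl0 s = (\<lambda>j ts. if j = j0 \<and> ts = tl0 then s else \<sigma> j ts)"

text \<open>The group is fibred over the elements that are trivial at the chosen node, with the
  permutations there as fibres, and \<open>shuffle_sum_dvd\<close> applies in each fibre.\<close>

lemma sum_Sigma_grp_node_dvd:
  fixes h :: "(nat \<Rightarrow> nat list \<Rightarrow> nat \<Rightarrow> nat) \<Rightarrow> int"
  assumes p: "prime p" and n: "ns ! j = p ^ e" and j: "j < length ns" and tl: "valid_addr ns (Suc j) ts"
    and I: "I \<subseteq> {..<ns ! j}" "I \<noteq> {}" "I \<noteq> {..<ns ! j}"
    and inv: "\<And>\<sigma> s s'. \<sigma> \<in> Sigma_grp ns \<Longrightarrow> s permutes {..<ns ! j} \<Longrightarrow> s' permutes {..<ns ! j}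
      \<Longrightarrow> (\<And>x y. x \<in> I \<Longrightarrow> y \<in> I \<Longrightarrow> inv s x < inv s y \<longleftrightarrow> inv s' x < inv s' y)
      \<Longrightarrow> (\<And>x y. x \<in> {..<ns ! j}-I \<Longrightarrow> y \<in> {..<ns ! j}-I \<Longrightarrow> inv s x < inv s y \<longleftrightarrow> inv s' x < inv s' y)
      \<Longrightarrow> h (sigma_upd \<sigma> j ts s) = h (sigma_upd \<sigma> j ts s')"
  shows "int p dvd (\<Sum>\<sigma>\<in>Sigma_grp ns. h \<sigma>)"
proof -
  let ?S0 = "{\<sigma> \<in> Sigma_grp ns. \<sigma> j ts = id}" and ?P = "{s. s permutes {..<ns ! j}}"
  have upd: "sigma_upd (sigma_upd \<sigma> j ts s) j ts s' = sigma_upd \<sigma> j ts s'" "sigma_upd \<sigma> j ts (\<sigma> j ts) = \<sigma>"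
    "sigma_upd \<sigma> j ts s j ts = s" for \<sigma> s s'
    by (auto simp: sigma_upd_def fun_eq_iff)
  have in0: "sigma_upd \<sigma> j ts s \<in> Sigma_grp ns" if "\<sigma> \<in> Sigma_grp ns" "s permutes {..<ns ! j}" for \<sigma> s
    using that j tl by (auto simp: sigma_upd_def Sigma_grp_def)
  have "(\<Sum>\<sigma>\<in>Sigma_grp ns. h \<sigma>) = (\<Sum>(\<sigma>, s)\<in>?S0 \<times> ?P. h (sigma_upd \<sigma> j ts s))"
    by (rule sum.reindex_bij_witness[where i="\<lambda>(\<sigma>, s). sigma_upd \<sigma> j ts s" and j="\<lambda>\<sigma>. (sigma_upd \<sigma> j ts id, \<sigma> j ts)"])
       (use Sigma_grp_permutes[OF _ j tl] in0 upd in \<open>auto simp: permutes_id\<close>, metis upd(2))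
  also have "\<dots> = (\<Sum>\<sigma>\<in>?S0. \<Sum>s\<in>?P. h (sigma_upd \<sigma> j ts s))" by (simp add: sum.cartesian_product)
  \<comment> \<open>The action orders siblings by the inverse of the local permutation, so the fibre
    is summed over inverses.\<close>
  also have "\<dots> = (\<Sum>\<sigma>\<in>?S0. \<Sum>s\<in>?P. h (sigma_upd \<sigma> j ts (Hilbert_Choice.inv s)))"
    by (rule sum.cong[OF refl], rule sum_permutations_inverse)
  finally have eq: "(\<Sum>\<sigma>\<in>Sigma_grp ns. h \<sigma>) = (\<Sum>\<sigma>\<in>?S0. \<Sum>s\<in>?P. h (sigma_upd \<sigma> j ts (Hilbert_Choice.inv s)))" .
  show ?thesis unfolding eq
  proof (rule dvd_sum)
    fix \<sigma> assume \<sigma>: "\<sigma> \<in> ?S0"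
    show "int p dvd (\<Sum>s\<in>?P. h (sigma_upd \<sigma> j ts (Hilbert_Choice.inv s)))"
    proof (rule shuffle_sum_dvd[OF p n I])
      fix s s' assume s: "s permutes {..<ns ! j}" "s' permutes {..<ns ! j}"
        and "\<And>x y. x \<in> I \<Longrightarrow> y \<in> I \<Longrightarrow> s x < s y \<longleftrightarrow> s' x < s' y"
        and "\<And>x y. x \<in> {..<ns ! j}-I \<Longrightarrow> y \<in> {..<ns ! j}-I \<Longrightarrow> s x < s y \<longleftrightarrow> s' x < s' y"
      then show "h (sigma_upd \<sigma> j ts (Hilbert_Choice.inv s)) = h (sigma_upd \<sigma> j ts (Hilbert_Choice.inv s'))"
        using \<sigma> permutes_inv_inv[OF s(1)] permutes_inv_inv[OF s(2)]
        by (intro inv) (auto simp: permutes_inv)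
    qed
  qed
qed

lemma valid_addrE:
  assumes "j < length ns" "valid_addr ns j a"
  obtains i ts where "a = i # ts" "i < ns ! j" "valid_addr ns (Suc j) ts"
  using assms by (cases a) auto

section \<open>Sheets over the first coordinates\<close>

text \<open>The sheet of \<open>\<sigma>\<close> lifts arbitrary values \<open>z\<close> of the first \<open>D\<close> coordinates to a configuration in dimension
  \<open>Suc D\<close>: the last coordinate separates siblings that are close in the first \<open>D\<close> coordinates, in the order prescribed
  by \<open>\<sigma>\<close>. Since only close siblings interact, the sheet does not depend on how \<open>\<sigma>\<close> shuffles two clusters that are far
  apart.\<close>

definition prox :: "nat \<Rightarrow> (slot \<Rightarrow> real) \<Rightarrow> nat \<Rightarrow> nat list \<Rightarrow> nat list \<Rightarrow> real" where
  "prox D z j a b = max 0 (1 - (\<Sum>c<D. \<bar>z (j, a, c) - z (j, b, c)\<bar>))"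

definition height :: "nat list \<Rightarrow> nat \<Rightarrow> (nat \<Rightarrow> nat list \<Rightarrow> nat \<Rightarrow> nat) \<Rightarrow> (slot \<Rightarrow> real) \<Rightarrow> nat \<Rightarrow> nat list \<Rightarrow> real" where
  "height ns D \<sigma> z j a = (\<Sum>i'<ns ! j. prox D z j a (i' # tl a) *
     sgn (real (hd (reindex \<sigma> j a)) - real (hd (reindex \<sigma> j (i' # tl a)))))"

definition sheet :: "nat list \<Rightarrow> nat \<Rightarrow> (nat \<Rightarrow> nat list \<Rightarrow> nat \<Rightarrow> nat) \<Rightarrow> (slot \<Rightarrow> real) \<Rightarrow> cfg" where
  "sheet ns D \<sigma> z = (\<lambda>j a c. if j < length ns \<and> valid_addr ns j a \<and> c \<le> D
     then if c < D then z (j, a, c) else height ns D \<sigma> z j a else 0)"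

text \<open>Siblings that agree in the first \<open>D\<close> coordinates have the same proximities
  to all siblings and proximity 1 to each other. Their heights are therefore strictly ordered, as
  \<open>inv\<close> of the local permutation orders them.\<close>

lemma sheet_in_Cspace:
  assumes \<sigma>: "\<sigma> \<in> Sigma_grp ns"
  shows "sheet ns D \<sigma> z \<in> Cspace (Suc D) ns"
proof -
  have "(\<lambda>c. sheet ns D \<sigma> z j (i # ts) c) \<noteq> (\<lambda>c. sheet ns D \<sigma> z j (i' # ts) c)"
    if j: "j < length ns" and tl: "valid_addr ns (Suc j) ts" and i: "i < ns ! j" "i' < ns ! j" "i \<noteq> i'" for j ts i i'
  proof
    assume eq: "(\<lambda>c. sheet ns D \<sigma> z j (i # ts) c) = (\<lambda>c. sheet ns D \<sigma> z j (i' # ts) c)"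
    have z: "z (j, i # ts, c) = z (j, i' # ts, c)" if "c < D" for c
      using fun_cong[OF eq, of c] that j tl i by (simp add: sheet_def)
    have pr: "prox D z j (i # ts) b = prox D z j (i' # ts) b" for b
      using z by (simp add: prox_def)
    have self: "prox D z j (i # ts) (i # ts) = 1" "prox D z j (i' # ts) (i # ts) = 1"
      unfolding pr[of "i # ts", symmetric] by (simp_all add: prox_def)
    let ?s = "\<sigma> j ts"
    have perm: "inv ?s permutes {..<ns ! j}" using Sigma_grp_permutes[OF \<sigma> j tl] by (rule permutes_inv)
    let ?p = "\<lambda>x. real (inv ?s x)"
    have ne: "?p i \<noteq> ?p i'" using i permutes_inj[OF perm] by (auto dest: injD)
    have hs: "height ns D \<sigma> z j (i # ts) = height ns D \<sigma> z j (i' # ts)"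
      using fun_cong[OF eq, of D] j tl i by (simp add: sheet_def)
    have h: "height ns D \<sigma> z j (x # ts) = (\<Sum>k<ns ! j. prox D z j (x # ts) (k # ts) * sgn (?p x - ?p k))" for x
      by (simp add: height_def)
    have lt: "height ns D \<sigma> z j (x # ts) < height ns D \<sigma> z j (y # ts)"
      if xy: "?p x < ?p y" "x < ns ! j" "y < ns ! j" "\<And>b. prox D z j (x # ts) b = prox D z j (y # ts) b" "prox D z j (y # ts) (y # ts) = 1" for x y
      unfolding h
    proof (rule sum_strict_mono_ex1)
      show "\<forall>k\<in>{..<ns ! j}. prox D z j (x # ts) (k # ts) * sgn (?p x - ?p k) \<le> prox D z j (y # ts) (k # ts) * sgn (?p y - ?p k)"
        using xy by (auto simp: prox_def sgn_if intro!: mult_left_mono)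
      \<comment> \<open>The term \<open>k = y\<close> is strict: it is -1 for \<open>x\<close> and 0
        for \<open>y\<close>.\<close>
      show "\<exists>k\<in>{..<ns ! j}. prox D z j (x # ts) (k # ts) * sgn (?p x - ?p k) < prox D z j (y # ts) (k # ts) * sgn (?p y - ?p k)"
        using xy by (intro bexI[of _ y]) auto
    qed simp
    have "prox D z j (i' # ts) (i' # ts) = 1" by (simp add: prox_def)
    then have "?p i < ?p i' \<Longrightarrow> False" "?p i' < ?p i \<Longrightarrow> False"
      using lt[of i i'] lt[of i' i] hs i pr self by simp_all
    then show False using ne by linarith
  qed
  then show ?thesis by (auto simp: Cspace_def sheet_def split: if_splits)
qed

lemma prox_slot_map:
  assumes "j < length ns" "valid_addr ns j a" "valid_addr ns j b"
  shows "prox D (\<lambda>s. z (slot_map ns D \<sigma> s)) j a b = prox D z j (reindex \<sigma> j a) (reindex \<sigma> j b)"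
  using assms by (simp add: prox_def slot_map_def slots_def)

text \<open>Every sheet is a translate of the identity sheet; so equivariance of the labels relates
  a simplex on one sheet to its permuted copy on another.\<close>

lemma act_sheet:
  assumes \<sigma>: "\<sigma> \<in> Sigma_grp ns"
  shows "act ns \<sigma> (sheet ns D (\<lambda>j ts. id) z) = sheet ns D \<sigma> (\<lambda>s. z (slot_map ns D \<sigma> s))"
proof (intro ext)
  fix j a c
  show "act ns \<sigma> (sheet ns D (\<lambda>j ts. id) z) j a c = sheet ns D \<sigma> (\<lambda>s. z (slot_map ns D \<sigma> s)) j a c"
  proof (cases "j < length ns \<and> valid_addr ns j a \<and> c \<le> D")
    case True
    then have j: "j < length ns" and v: "valid_addr ns j a" by auto
    obtain i ts where a: "a = i # ts" "i < ns ! j" "valid_addr ns (Suc j) ts"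
      using valid_addrE[OF j v] .
    let ?s = "\<sigma> j ts"
    have perm: "inv ?s permutes {..<ns ! j}" using Sigma_grp_permutes[OF \<sigma> j a(3)] by (rule permutes_inv)
    have "height ns D (\<lambda>j ts. id) z j (reindex \<sigma> j a) = height ns D \<sigma> (\<lambda>s. z (slot_map ns D \<sigma> s)) j a"
    proof -
      let ?F = "\<lambda>k. prox D z j (reindex \<sigma> j a) (k # reindex \<sigma> (Suc j) ts) * sgn (real (inv ?s i) - real k)"
      have "height ns D \<sigma> (\<lambda>s. z (slot_map ns D \<sigma> s)) j a = (\<Sum>k<ns ! j. ?F (inv ?s k))"
        unfolding height_def
        by (rule sum.cong) (use a j v prox_slot_map in auto)
      also have "\<dots> = (\<Sum>k<ns ! j. ?F k)" using sum.permute[OF perm, of ?F] by (simp add: comp_def)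
      also have "\<dots> = height ns D (\<lambda>j ts. id) z j (reindex \<sigma> j a)" by (simp add: height_def a)
      finally show ?thesis by simp
    qed
    then show ?thesis using True valid_addr_reindex[OF \<sigma> v]
      by (simp add: act_def sheet_def slot_map_def slots_def)
  qed (auto simp: act_def sheet_def valid_addr_reindex[OF \<sigma>])
qed

lemma sgn_diff_cong:
  fixes a b c d :: nat
  assumes "(a < b \<longleftrightarrow> c < d) \<and> (b < a \<longleftrightarrow> d < c)"
  shows "sgn (real a - real b) = sgn (real c - real d)"
  using assms by (cases a b rule: linorder_cases; cases c d rule: linorder_cases) auto

text \<open>A height only compares pairs of positive proximity. Pairs inside one cluster keep their
  order by assumption, and pairs across the clusters have proximity 0.\<close>

lemma sheet_upd_eq:
  assumes j: "j < length ns"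
    and s: "s permutes {..<ns ! j}" "s' permutes {..<ns ! j}"
    and I: "\<And>x y. x \<in> I \<Longrightarrow> y \<in> I \<Longrightarrow> inv s x < inv s y \<longleftrightarrow> inv s' x < inv s' y"
    and C: "\<And>x y. x \<in> {..<ns ! j}-I \<Longrightarrow> y \<in> {..<ns ! j}-I \<Longrightarrow> inv s x < inv s y \<longleftrightarrow> inv s' x < inv s' y"
    and far: "\<And>x y. x \<in> I \<Longrightarrow> y \<in> {..<ns ! j}-I \<Longrightarrow> prox D z j (x # tl0) (y # tl0) = 0"
  shows "sheet ns D (sigma_upd \<sigma> j tl0 s) z = sheet ns D (sigma_upd \<sigma> j tl0 s') z"
proof -
  have sym: "prox D z j a b = prox D z j b a" for a b by (simp add: prox_def abs_minus_commute)
  have key: "prox D z j (x # tl0) (y # tl0) * sgn (real (inv s x) - real (inv s y))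
      = prox D z j (x # tl0) (y # tl0) * sgn (real (inv s' x) - real (inv s' y))" if "x < ns ! j" "y < ns ! j" for x y
  proof (cases "(x \<in> I) = (y \<in> I)")
    case True
    have "(inv s x < inv s y \<longleftrightarrow> inv s' x < inv s' y) \<and> (inv s y < inv s x \<longleftrightarrow> inv s' y < inv s' x)"
    proof (cases "x \<in> I")
      case xI: True
      then have yI: "y \<in> I" using True by simp
      show ?thesis using I[OF xI yI] I[OF yI xI] by blast
    next
      case False
      then have "x \<in> {..<ns ! j}-I" "y \<in> {..<ns ! j}-I" using True that by simp_all
      then show ?thesis using C by blast
    qed
    then have "sgn (real (inv s x) - real (inv s y)) = sgn (real (inv s' x) - real (inv s' y))"
      by (rule sgn_diff_cong)
    then show ?thesis by simp
  next
    case False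
    then have "prox D z j (x # tl0) (y # tl0) = 0"
      using far[of x y] far[of y x] sym[of "x # tl0" "y # tl0"] that by (cases "x \<in> I") simp_all
    then show ?thesis by simp
  qed
  have "height ns D (sigma_upd \<sigma> j tl0 s) z j' a = height ns D (sigma_upd \<sigma> j tl0 s') z j' a"
    if v: "j' < length ns" "valid_addr ns j' a" for j' a
  proof -
    obtain i ts where a: "a = i # ts" "i < ns ! j'" using valid_addrE[OF v] .
    show ?thesis
    proof (cases "j' = j \<and> ts = tl0")
      case True
      have u: "reindex (sigma_upd \<sigma> j tl0 s'') j (k # tl0) = inv s'' k # reindex (sigma_upd \<sigma> j tl0 s'') (Suc j) tl0" for s'' k
        by (simp add: sigma_upd_def)
      from True have e: "j' = j" "a = i # tl0" using a by simp_all
      show ?thesis unfolding height_def e u list.sel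
        by (rule sum.cong[OF refl]) (use key a True in simp)
    next
      case False
      then have "sigma_upd \<sigma> j tl0 s j' ts = sigma_upd \<sigma> j tl0 s' j' ts" by (auto simp: sigma_upd_def)
      then show ?thesis using a by (simp add: height_def)
    qed
  qed
  note h = this
  show ?thesis
  proof (intro ext)
    fix j' a c
    show "sheet ns D (sigma_upd \<sigma> j tl0 s) z j' a c = sheet ns D (sigma_upd \<sigma> j tl0 s') z j' a c"
      unfolding sheet_def using h[of j' a] by (simp only: cong: if_cong conj_cong)
  qed
qed

lemma continuous_on_sheet: "continuous_on UNIV (sheet ns D \<sigma>)"
proof -
  have [continuous_intros]: "continuous_on UNIV (\<lambda>z :: slot \<Rightarrow> real. z s)" for s
    by simp
  have pr: "continuous_on UNIV (\<lambda>z. prox D z j a b)" for j a b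
    unfolding prox_def by (intro continuous_intros)
  have h: "continuous_on UNIV (\<lambda>z. height ns D \<sigma> z j a)" for j a
    unfolding height_def by (intro continuous_intros pr)
  have "continuous_on UNIV (\<lambda>z. sheet ns D \<sigma> z j a c)" for j a c
  proof (cases "j < length ns \<and> valid_addr ns j a \<and> c \<le> D")
    case True
    then show ?thesis by (cases "c < D") (simp_all add: sheet_def h)
  next
    case False
    then have "(\<lambda>z. sheet ns D \<sigma> z j a c) = (\<lambda>z. 0)" by (auto simp: sheet_def fun_eq_iff)
    then show ?thesis by (metis continuous_on_const)
  qed
  then show ?thesis
    by (intro continuous_on_coordinatewise_then_product)
qed

lemma compact_slot_box:
  "compact {z :: slot \<Rightarrow> real. (\<forall>s\<in>A. \<bar>z s\<bar> \<le> r) \<and> (\<forall>s. s \<notin> A \<longrightarrow> z s = 0)}"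
proof -
  let ?S = "\<lambda>s. if s \<in> A then {-r..r} else {0::real}"
  have "compactin (product_topology (\<lambda>_. euclidean) UNIV) (PiE UNIV ?S)"
    by (subst compactin_PiE) auto
  moreover have "PiE UNIV ?S = {z. (\<forall>s\<in>A. \<bar>z s\<bar> \<le> r) \<and> (\<forall>s. s \<notin> A \<longrightarrow> z s = 0)}"
  proof -
    have "z s \<in> ?S s \<longleftrightarrow> (s \<in> A \<longrightarrow> \<bar>z s\<bar> \<le> r) \<and> (s \<notin> A \<longrightarrow> z s = 0)" for z s
      by (simp add: abs_le_iff) linarith
    then show ?thesis unfolding PiE_UNIV_domain by blast
  qed
  ultimately show ?thesis
    by (simp add: euclidean_product_topology)
qed

text \<open>The metric on functions over a countable type is a weighted sum along an enumeration:
  finitely many terms are bounded by the coordinates, and the tail is geometric. The bound does not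
  depend on the number of slots.\<close>

lemma dist_slot_le:
  fixes z z' :: "slot \<Rightarrow> real"
  assumes "\<And>s. \<bar>z s - z' s\<bar> \<le> e"
  shows "dist z z' \<le> 2 * e"
proof (rule field_le_epsilon)
  fix \<epsilon> :: real assume "\<epsilon> > 0"
  then obtain N where N: "(1/2) ^ N < \<epsilon>" using real_arch_pow_inv[of \<epsilon> "1/2"] by auto
  let ?M = "{dist (z (from_nat n)) (z' (from_nat n)) |n. n \<le> N}"
  have "?M = (\<lambda>n. dist (z (from_nat n)) (z' (from_nat n))) ` {..N}" by auto
  then have "finite ?M" "?M \<noteq> {}" by auto
  moreover have "x \<le> e" if x: "x \<in> ?M" for x
  proof -
    obtain n where "x = dist (z (from_nat n)) (z' (from_nat n))" using x by blast
    then show ?thesis using assms[of "from_nat n"] by (simp add: dist_real_def)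
  qed
  ultimately have "Max ?M \<le> e" by (meson Max_in)
  then have "dist z z' \<le> 2 * e + (1/2) ^ N" using dist_fun_le_dist_first_terms[of z z' N] by linarith
  then show "dist z z' \<le> 2 * e + \<epsilon>" using N by linarith
qed

text \<open>Uniform continuity on a compact box, with one mesh for finitely many functions. The mesh
  is \<open>1 / real L\<close> so that the grid is the scaled integer lattice.\<close>

lemma uniformly_close_on_box:
  fixes g :: "'i \<Rightarrow> (slot \<Rightarrow> real) \<Rightarrow> real"
  assumes J: "finite J" and g: "\<And>i. i \<in> J \<Longrightarrow> continuous_on UNIV (g i)" and e: "e > 0"
  shows "\<exists>L\<ge>1. \<forall>i\<in>J. \<forall>z z'. (\<forall>s\<in>A. \<bar>z s\<bar> \<le> r \<and> \<bar>z' s\<bar> \<le> r \<and> \<bar>z s - z' s\<bar> \<le> 1 / real L) \<longrightarrow> (\<forall>s. s \<notin> A \<longrightarrow> z s = 0 \<and> z' s = 0)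
    \<longrightarrow> \<bar>g i z - g i z'\<bar> \<le> e"
proof -
  let ?K = "{z :: slot \<Rightarrow> real. (\<forall>s\<in>A. \<bar>z s\<bar> \<le> r) \<and> (\<forall>s. s \<notin> A \<longrightarrow> z s = 0)}"
  have "\<exists>d>0. \<forall>z\<in>?K. \<forall>z'\<in>?K. dist z' z < d \<longrightarrow> dist (g i z') (g i z) < e" if "i \<in> J" for i
  proof -
    have "uniformly_continuous_on ?K (g i)"
      by (intro compact_uniformly_continuous continuous_on_subset[OF g[OF that]] compact_slot_box subset_UNIV)
    then show ?thesis using e unfolding uniformly_continuous_on_def by (elim allE[of _ e]) simp
  qed
  then have "\<forall>i\<in>J. \<exists>d. d > 0 \<and> (\<forall>z\<in>?K. \<forall>z'\<in>?K. dist z' z < d \<longrightarrow> dist (g i z') (g i z) < e)" by blast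
  from bchoice[OF this] obtain d where
    dd: "\<forall>i\<in>J. d i > 0 \<and> (\<forall>z\<in>?K. \<forall>z'\<in>?K. dist z' z < d i \<longrightarrow> dist (g i z') (g i z) < e)" ..
  have d: "\<And>i. i \<in> J \<Longrightarrow> d i > 0" using dd by blast
  define d0 where "d0 = Min (insert 1 (d ` J))"
  have d0: "d0 > 0" "\<And>i. i \<in> J \<Longrightarrow> d0 \<le> d i" using J d by (auto simp: d0_def)
  obtain L where L: "2 / d0 < real L" using reals_Archimedean2 by blast
  then have L1: "L \<ge> 1" using d0(1) by (cases L) (auto simp: divide_less_0_iff)
  have Ld: "2 * (1 / real L) < d0" using L L1 d0(1) by (simp add: field_simps)
  show ?thesis
  proof (intro exI[of _ L] conjI L1 ballI allI impI)
    fix i and z z' :: "slot \<Rightarrow> real"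
    assume i: "i \<in> J" and z: "\<forall>s\<in>A. \<bar>z s\<bar> \<le> r \<and> \<bar>z' s\<bar> \<le> r \<and> \<bar>z s - z' s\<bar> \<le> 1 / real L"
      and z0: "\<forall>s. s \<notin> A \<longrightarrow> z s = 0 \<and> z' s = 0"
    have le: "\<bar>z s - z' s\<bar> \<le> 1 / real L" for s
    proof (cases "s \<in> A")
      case True then show ?thesis using z by blast
    next
      case False then have "z s = 0" "z' s = 0" using z0 by blast+
      then show ?thesis by simp
    qed
    have K: "z \<in> ?K" "z' \<in> ?K" using z z0 by blast+
    have "dist z z' < d i" using dist_slot_le[of z z' "1 / real L", OF le] Ld d0(2)[OF i] by linarith
    then have "dist (g i z) (g i z') < e" using dd i K by (simp only: bex_simps ball_simps) blast
    then show "\<bar>g i z - g i z'\<bar> \<le> e" unfolding dist_real_def by linarith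
  qed
qed

lemma slot_map_in: "\<sigma> \<in> Sigma_grp ns \<Longrightarrow> slot_map ns D \<sigma> s \<in> slots ns D \<longleftrightarrow> s \<in> slots ns D"
  by (rule permutes_in_image[OF slot_map_permutes])

section \<open>Equivariant labels of configurations\<close>

definition addr_key :: "cfg \<Rightarrow> slot \<Rightarrow> nat \<times> (nat \<Rightarrow> real) list \<times> nat" where
  "addr_key x s = (case s of (j, a, c) \<Rightarrow> (j, map (\<lambda>t. x (j + t) (drop t a)) [0..<length a], c))"

definition argmax_slots :: "slot set \<Rightarrow> (slot \<Rightarrow> real) \<Rightarrow> slot set" where
  "argmax_slots A y = {s \<in> A. y s > 0 \<and> (\<forall>t\<in>A. y t \<le> y s)}"

text \<open>Ties are broken by a choice among the keys of the maximal slots. A key records the points along an address instead of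
  the address itself, so the choice commutes with the action; keys determine slots by injectivity of configurations.\<close>

definition cfg_label :: "slot set \<Rightarrow> (cfg \<Rightarrow> slot \<Rightarrow> real) \<Rightarrow> cfg \<Rightarrow> slot option" where
  "cfg_label A \<Psi> x = (if argmax_slots A (\<Psi> x) = {} then None
     else Some (THE s. s \<in> argmax_slots A (\<Psi> x) \<and> addr_key x s = (SOME k. k \<in> addr_key x ` argmax_slots A (\<Psi> x))))"

text \<open>The tails are settled first; once they agree, the heads index siblings of one node, and
  siblings are distinct points.\<close>

lemma points_inject:
  assumes x: "x \<in> Cspace d ns"
  shows "valid_addr ns j a \<Longrightarrow> valid_addr ns j b \<Longrightarrow>
    map (\<lambda>t. x (j + t) (drop t a)) [0..<length a] = map (\<lambda>t. x (j + t) (drop t b)) [0..<length b] \<Longrightarrow> a = b"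
proof (induction a arbitrary: j b)
  case Nil then show ?case by (cases b) auto
next
  case (Cons i a)
  then have j: "j < length ns" using valid_addr_cases by blast
  obtain i' b' where b: "b = i' # b'" using Cons by (cases b) auto
  have U: "[0..<length (k # l)] = 0 # map Suc [0..<length l]" for k and l :: "nat list"
    by (simp add: upt_conv_Cons map_Suc_upt del: upt_Suc)
  have *: "map (\<lambda>t. x (j + t) (drop t (k # l))) [0..<length (k # l)]
      = x j (k # l) # map (\<lambda>t. x (Suc j + t) (drop t l)) [0..<length l]" for k l
    unfolding U by (simp add: comp_def)
  have eqs: "x j (i # a) = x j (i' # b')"
    "map (\<lambda>t. x (Suc j + t) (drop t a)) [0..<length a] = map (\<lambda>t. x (Suc j + t) (drop t b')) [0..<length b']"
    using Cons.prems(3) unfolding b * by simp_all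
  have v: "i < ns ! j" "valid_addr ns (Suc j) a" "i' < ns ! j" "valid_addr ns (Suc j) b'"
    using Cons.prems(1,2) b j by simp_all
  have ab: "a = b'" using Cons.IH[OF v(2,4) eqs(2)] .
  have "i = i'"
  proof (rule ccontr)
    assume "i \<noteq> i'"
    then have "(\<lambda>c. x j (i # a) c) \<noteq> (\<lambda>c. x j (i' # a) c)" using x j v unfolding Cspace_def by blast
    then show False using eqs(1) ab by simp
  qed
  then show ?case using ab b by simp
qed

lemma addr_key_inject:
  assumes "x \<in> Cspace d ns" "s \<in> slots ns D" "t \<in> slots ns D" "addr_key x s = addr_key x t"
  shows "s = t"
proof -
  obtain j a c where s: "s = (j, a, c)" by (cases s)
  obtain j' a' c' where t: "t = (j', a', c')" by (cases t)
  have e: "j = j'" "c = c'" "map (\<lambda>t. x (j + t) (drop t a)) [0..<length a] = map (\<lambda>t. x (j + t) (drop t a')) [0..<length a']"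
    using assms(4) by (auto simp: addr_key_def s t)
  have "valid_addr ns j a" "valid_addr ns j a'" using assms(2,3) s t e by (simp_all add: slots_def)
  then show ?thesis using points_inject[OF assms(1) _ _ e(3)] s t e by simp
qed

lemma addr_key_act:
  assumes \<sigma>: "\<sigma> \<in> Sigma_grp ns" and s: "s \<in> slots ns D"
  shows "addr_key (act ns \<sigma> x) s = addr_key x (slot_map ns D \<sigma> s)"
proof -
  obtain j a c where e: "s = (j, a, c)" by (cases s)
  then have v: "valid_addr ns j a" "j < length ns" "c < D" using s by (simp_all add: slots_def)
  have "act ns \<sigma> x (j + t) (drop t a) = x (j + t) (drop t (reindex \<sigma> j a))" if "t < length a" for t
  proof -
    have "j + t < length ns" using that valid_addr_length[OF v(1)] v(2) by simp
    then show ?thesis using valid_addr_drop[OF v(1), of t] by (simp add: act_def drop_reindex fun_eq_iff)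
  qed
  then have "map (\<lambda>t. act ns \<sigma> x (j + t) (drop t a)) [0..<length a]
      = map (\<lambda>t. x (j + t) (drop t (reindex \<sigma> j a))) [0..<length (reindex \<sigma> j a)]" by simp
  then show ?thesis using v by (simp add: addr_key_def e slot_map_def slots_def)
qed

lemma cfg_label_cases:
  assumes x: "x \<in> Cspace d ns" and A: "A = slots ns D"
  shows "(case cfg_label A \<Psi> x of None \<Rightarrow> \<forall>s\<in>A. \<Psi> x s \<le> 0 | Some s \<Rightarrow> s \<in> argmax_slots A (\<Psi> x))"
    and "cfg_label A \<Psi> x = Some s \<Longrightarrow> addr_key x s = (SOME k. k \<in> addr_key x ` argmax_slots A (\<Psi> x))"
proof -
  let ?M = "argmax_slots A (\<Psi> x)" and ?k = "SOME k. k \<in> addr_key x ` argmax_slots A (\<Psi> x)"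
  have the: "(THE s. s \<in> ?M \<and> addr_key x s = ?k) \<in> ?M \<and> addr_key x (THE s. s \<in> ?M \<and> addr_key x s = ?k) = ?k" if neM: "?M \<noteq> {}"
  proof (rule theI')
    obtain s0 where "s0 \<in> ?M" using neM by blast
    then have "?k \<in> addr_key x ` ?M" by (intro someI[of "\<lambda>k. k \<in> addr_key x ` ?M" "addr_key x s0"] imageI)
    then obtain s where s': "?k = addr_key x s" and s: "s \<in> ?M" by (rule imageE)
    note s = s s'[symmetric]
    show "\<exists>!s. s \<in> ?M \<and> addr_key x s = ?k"
    proof (rule ex1I[of _ s])
      fix t assume "t \<in> ?M \<and> addr_key x t = ?k"
      then show "t = s" using s addr_key_inject[OF x, of t D s] A by (simp add: argmax_slots_def)
    qed (use s in simp)
  qed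
  show "case cfg_label A \<Psi> x of None \<Rightarrow> \<forall>s\<in>A. \<Psi> x s \<le> 0 | Some s \<Rightarrow> s \<in> ?M"
  proof (cases "?M = {}")
    case True
    have "\<Psi> x s \<le> 0" if s: "s \<in> A" for s
    proof (rule ccontr)
      assume pos: "\<not> \<Psi> x s \<le> 0"
      have fin: "finite A" by (simp add: A finite_slots)
      have "Max (\<Psi> x ` A) \<in> \<Psi> x ` A" using s fin by (intro Max_in) auto
      then obtain b where b: "Max (\<Psi> x ` A) = \<Psi> x b" "b \<in> A" by (rule imageE)
      have "\<forall>t\<in>A. \<Psi> x t \<le> \<Psi> x b" unfolding b(1)[symmetric] using fin by (intro ballI Max_ge) auto
      then have "b \<in> ?M" using b(2) s pos by (force simp: argmax_slots_def)
      then show False using True by simp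
    qed
    then show ?thesis using True by (simp add: cfg_label_def)
  next
    case False then show ?thesis using the by (simp add: cfg_label_def)
  qed
  show "cfg_label A \<Psi> x = Some s \<Longrightarrow> addr_key x s = ?k"
    using the by (auto simp: cfg_label_def split: if_splits)
qed

text \<open>The action permutes the maximal slots but leaves the set of their keys unchanged, so
  \<open>SOME\<close> picks the same key before and after it.\<close>

lemma cfg_label_act:
  assumes \<sigma>: "\<sigma> \<in> Sigma_grp ns" and x: "x \<in> Cspace d ns" and ax: "act ns \<sigma> x \<in> Cspace d ns" and A: "A = slots ns D"
    and \<Psi>: "\<And>s. s \<in> A \<Longrightarrow> \<Psi> (act ns \<sigma> x) s = \<Psi> x (slot_map ns D \<sigma> s)"
  shows "map_option (slot_map ns D \<sigma>) (cfg_label A \<Psi> (act ns \<sigma> x)) = cfg_label A \<Psi> x"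
proof -
  let ?R = "slot_map ns D \<sigma>" and ?y = "act ns \<sigma> x"
  let ?M = "argmax_slots A (\<Psi> x)" and ?N = "argmax_slots A (\<Psi> ?y)"
  have img: "?R ` A = A" unfolding A by (rule permutes_image[OF slot_map_permutes[OF \<sigma>]])
  have N: "s \<in> ?N \<longleftrightarrow> ?R s \<in> ?M" for s
  proof -
    have "(\<forall>t\<in>A. \<Psi> ?y t \<le> \<Psi> ?y s) \<longleftrightarrow> (\<forall>t\<in>A. \<Psi> x t \<le> \<Psi> x (?R s))" if "s \<in> A"
    proof -
      have "(\<forall>t\<in>A. \<Psi> x t \<le> \<Psi> x (?R s)) \<longleftrightarrow> (\<forall>t\<in>?R ` A. \<Psi> x t \<le> \<Psi> x (?R s))" unfolding img ..
      then show ?thesis using \<Psi> that by simp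
    qed
    then show ?thesis using \<Psi>[of s] slot_map_in[OF \<sigma>, of D s] A by (auto simp: argmax_slots_def)
  qed
  have RN: "?R ` ?N = ?M"
  proof
    show "?M \<subseteq> ?R ` ?N"
    proof
      fix m assume m: "m \<in> ?M"
      then have "m \<in> ?R ` A" unfolding img by (simp add: argmax_slots_def)
      then show "m \<in> ?R ` ?N" using m N by auto
    qed
  qed (use N in auto)
  have keys: "addr_key ?y ` ?N = addr_key x ` ?M"
  proof -
    have "addr_key ?y s = addr_key x (?R s)" if "s \<in> ?N" for s
      using addr_key_act[OF \<sigma>, of s D x] that A by (simp add: argmax_slots_def)
    then have "addr_key ?y ` ?N = (\<lambda>s. addr_key x (?R s)) ` ?N" by (rule image_cong[OF refl])
    also have "\<dots> = addr_key x ` ?R ` ?N" by (simp add: image_image)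
    finally show ?thesis by (simp only: RN)
  qed
  show ?thesis
  proof (cases "?M = {}")
    case True
    then have "?N = {}" using RN by simp
    then show ?thesis using True by (simp add: cfg_label_def)
  next
    case False
    then have "?N \<noteq> {}" using RN by auto
    then obtain s where s: "cfg_label A \<Psi> ?y = Some s" by (simp add: cfg_label_def)
    obtain t where t: "cfg_label A \<Psi> x = Some t" using False by (simp add: cfg_label_def)
    have "s \<in> ?N" "t \<in> ?M" using cfg_label_cases(1)[OF ax A, of \<Psi>] cfg_label_cases(1)[OF x A, of \<Psi>] s t by simp_all
    moreover have "addr_key ?y s = addr_key x t"
      using cfg_label_cases(2)[OF ax A s] cfg_label_cases(2)[OF x A t] keys by simp
    moreover have "addr_key ?y s = addr_key x (?R s)"
      using addr_key_act[OF \<sigma>, of s D x] \<open>s \<in> ?N\<close> A by (simp add: argmax_slots_def)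
    moreover have "?R s \<in> ?M" using N \<open>s \<in> ?N\<close> by simp
    ultimately have "?R s = t" using addr_key_inject[OF x, of "?R s" D t] A by (simp add: argmax_slots_def)
    then show ?thesis using s t by simp
  qed
qed

section \<open>Door sums under permutations of the coordinates\<close>

lemma psign_conjugate:
  assumes q: "q permutes B" and B: "finite B" and eq: "\<And>p. q (Q' p) = Q (q p)"
  shows "psign B Q' = psign B Q"
proof -
  have Q: "Q = q \<circ> (Q' \<circ> inv q)" using eq permutes_inverses[OF q] by (auto simp: fun_eq_iff)
  have Q': "Q' = inv q \<circ> (Q \<circ> q)" by (simp add: fun_eq_iff eq[symmetric] permutes_inverses[OF q])
  have iff: "Q permutes B \<longleftrightarrow> Q' permutes B"
    using Q Q' permutes_compose permutes_inv[OF q] q by metis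
  have "sign Q = sign Q'" if "Q' permutes B"
  proof -
    have P: "permutation q" "permutation Q'" "permutation (inv q)"
      using q that permutes_inv[OF q] B permutation_permutes by blast+
    have "sign Q = sign q * (sign Q' * sign (inv q))"
      unfolding Q using P by (simp add: sign_compose permutation_compose)
    then show ?thesis using P by (simp add: sign_inverse)
  qed
  then show ?thesis using iff by (simp add: psign_def)
qed

lemma door_sum_cong:
  assumes "\<theta> \<in> ranks A" "\<And>i. i \<le> card A \<Longrightarrow> l (vtx u \<theta> i) = l' (vtx u \<theta> i)"
  shows "door_sum A l u \<theta> = door_sum A l' u \<theta>"
proof -
  have "lab_perm A l u \<theta> i p = lab_perm A l' u \<theta> i p" for i p
  proof (cases "p \<in> opts A")
    case True
    then show ?thesis using assms(2)[of "\<theta> p"] ranks_le[OF assms(1) True] by (simp add: lab_perm_def)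
  qed (simp add: lab_perm_def)
  then have "lab_perm A l u \<theta> = lab_perm A l' u \<theta>" by (intro ext)
  then show ?thesis by (simp add: door_sum_def)
qed

lemma permutes_map_option:
  assumes "R permutes A"
  shows "map_option R permutes opts A"
proof (rule bij_imp_permutes)
  have "inj_on (map_option R) (opts A)"
    using permutes_inj[OF assms] by (intro inj_on_subset[OF option.inj_map]) auto
  moreover have "map_option R ` opts A = opts A"
    unfolding opts_def by (simp add: image_image image_comp[symmetric] permutes_image[OF assms] flip: image_image[of Some R])
  ultimately show "bij_betw (map_option R) (opts A) (opts A)" by (simp add: bij_betw_def)
next
  fix p assume "p \<notin> opts A"
  then show "map_option R p = p" using permutes_not_in[OF assms] by (cases p) auto
qed

text \<open>A permutation of the coordinates acts on the order of the vertices and on the labels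
  alike. So \<open>lab_perm\<close> is conjugated, and no sign appears even if \<open>R\<close> is
  odd.\<close>

lemma door_sum_permute:
  assumes R: "R permutes A" and A: "finite A"
    and l: "\<And>w. map_option R (l' (\<lambda>s. w (R s))) = l w"
  shows "door_sum A l' (\<lambda>s. u (R s)) (\<lambda>p. \<theta> (map_option R p)) = door_sum A l u \<theta>"
proof -
  have v: "vtx (\<lambda>s. u (R s)) (\<lambda>p. \<theta> (map_option R p)) i = (\<lambda>s. vtx u \<theta> i (R s))" for i
    by (simp add: vtx_def)
  have mR: "map_option R permutes opts A" by (rule permutes_map_option[OF R])
  have "psign (opts A) (lab_perm A l' (\<lambda>s. u (R s)) (\<lambda>p. \<theta> (map_option R p)) i) = psign (opts A) (lab_perm A l u \<theta> i)" for i
  proof (rule psign_conjugate[OF mR])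
    fix p
    have "map_option R p \<in> opts A \<longleftrightarrow> p \<in> opts A" by (rule permutes_in_image[OF mR])
    then show "map_option R (lab_perm A l' (\<lambda>s. u (R s)) (\<lambda>p. \<theta> (map_option R p)) i p) = lab_perm A l u \<theta> i (map_option R p)"
      unfolding lab_perm_def v by (simp add: l)
  qed (use A in simp)
  then show ?thesis by (simp add: door_sum_def)
qed

lemma ranks_permute:
  assumes R: "R permutes A" and th: "\<theta> \<in> ranks A"
  shows "(\<lambda>p. \<theta> (map_option R p)) \<in> ranks A"
proof -
  have mR: "map_option R permutes opts A" by (rule permutes_map_option[OF R])
  have "bij_betw (\<theta> \<circ> map_option R) (opts A) {..card A}"
    using permutes_imp_bij[OF mR] th by (intro bij_betw_trans) (auto simp: ranks_def)
  moreover have "\<theta> (map_option R p) = Suc (card A)" if "p \<notin> opts A" for p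
    using that permutes_not_in[OF mR that] th by (simp add: ranks_def)
  ultimately show ?thesis using th by (simp add: ranks_def comp_def)
qed

text \<open>Labels are controlled only at points supported in \<open>A\<close>; the vertices of the
  simplices in the sum are such points, so the labels elsewhere may be replaced.\<close>

lemma signed_sperner_supported:
  fixes A :: "'a set"
  assumes fin: "finite A" and ne: "A \<noteq> {}" and N: "N \<ge> 1"
    and good: "\<And>u. (\<And>a. a \<notin> A \<Longrightarrow> u a = 0) \<Longrightarrow> u \<notin> lbox A N \<Longrightarrow> argmax_label A u (l u)"
  shows "(\<Sum>(u, \<theta>)\<in>lbox A (N + 2) \<times> ranks A. door_sum A l u \<theta>) = 1"
proof -
  define l' where "l' u = (if \<forall>a. a \<notin> A \<longrightarrow> u a = 0 then l u else (SOME p. argmax_label A u p))" for u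
  have "door_sum A l u \<theta> = door_sum A l' u \<theta>" if "u \<in> lbox A (N + 2)" "\<theta> \<in> ranks A" for u \<theta>
  proof (rule door_sum_cong[OF that(2)])
    fix i assume i: "i \<le> card A"
    have "vtx u \<theta> i a = 0" if "a \<notin> A" for a
      using ranks_out[OF \<open>\<theta> \<in> ranks A\<close>, of "Some a"] that i \<open>u \<in> lbox A (N + 2)\<close> by (simp add: vtx_def lbox_def)
    then show "l (vtx u \<theta> i) = l' (vtx u \<theta> i)" by (simp add: l'_def)
  qed
  then have "(\<Sum>(u, \<theta>)\<in>lbox A (N + 2) \<times> ranks A. door_sum A l u \<theta>) = (\<Sum>(u, \<theta>)\<in>lbox A (N + 2) \<times> ranks A. door_sum A l' u \<theta>)"
    by (intro sum.cong) auto
  also have "\<dots> = 1"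
  proof (rule signed_sperner[OF fin ne N])
    fix u assume "u \<notin> lbox A N"
    then show "argmax_label A u (l' u)" using good someI_ex[OF argmax_label_ex[OF fin, of u]] by (auto simp: l'_def)
  qed
  finally show ?thesis .
qed

section \<open>Powers of one prime: no equivariant map\<close>

definition cval :: "cfg \<Rightarrow> slot \<Rightarrow> real" where
  "cval x s = x (fst s) (fst (snd s)) (snd (snd s))"

lemma continuous_on_cval:
  assumes "continuous_on S h"
  shows "continuous_on S (\<lambda>z. cval (h z) s)"
  unfolding cval_def
  by (rule continuous_on_product_then_coordinatewise[where i="snd (snd s)", OF
        continuous_on_product_then_coordinatewise[where i="fst (snd s)", OF
          continuous_on_product_then_coordinatewise[where i="fst s", OF assms]]])

lemma sum_slots:
  "(\<Sum>s\<in>slots ns D. g s) = (\<Sum>j<length ns. \<Sum>a\<in>{a. valid_addr ns j a}. \<Sum>c<D. g (j, a, c))"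
proof -
  have "slots ns D = (SIGMA j:{..<length ns}. {a. valid_addr ns j a} \<times> {..<D})"
    by (auto simp: slots_def)
  then have "(\<Sum>s\<in>slots ns D. g s) = (\<Sum>j<length ns. \<Sum>r\<in>{a. valid_addr ns j a} \<times> {..<D}. g (j, r))"
    using finite_valid_addr by (simp only:) (subst sum.Sigma, auto simp: case_prod_unfold)
  also have "\<dots> = (\<Sum>j<length ns. \<Sum>a\<in>{a. valid_addr ns j a}. \<Sum>c<D. g (j, a, c))"
    by (rule sum.cong[OF refl]) (simp only: sum.cartesian_product case_prod_unfold prod.collapse)
  finally show ?thesis .
qed

lemma cval_act:
  assumes "s \<in> slots ns D"
  shows "cval (act ns \<sigma> x) s = cval x (slot_map ns D \<sigma> s)"
  using assms by (auto simp: cval_def act_def slot_map_def slots_def)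

lemma SW_large_coordinate:
  assumes "z \<in> SW (Suc D) ns"
  shows "\<exists>s\<in>slots ns D. 1 / real (card (slots ns D)) \<le> \<bar>cval z s\<bar>"
proof (rule ccontr)
  let ?A = "slots ns D"
  assume neg: "\<not> ?thesis"
  have one: "(\<Sum>s\<in>?A. (cval z s)\<^sup>2) = 1"
    using assms by (simp add: SW_def sum_slots cval_def)
  then have ne: "?A \<noteq> {}" by auto
  then have c: "card ?A > 0" using finite_slots by (simp add: card_gt_0_iff)
  have "(cval z s)\<^sup>2 < 1 / real (card ?A)" if s: "s \<in> ?A" for s
  proof -
    have lt: "\<bar>cval z s\<bar> < 1 / real (card ?A)" using neg s by force
    also have "\<dots> \<le> 1" using c by simp
    finally have "\<bar>cval z s\<bar> * \<bar>cval z s\<bar> \<le> \<bar>cval z s\<bar>" by (intro mult_left_le) auto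
    then show ?thesis using lt by (simp add: power2_eq_square)
  qed
  then have "(\<Sum>s\<in>?A. (cval z s)\<^sup>2) < (\<Sum>s\<in>?A. 1 / real (card ?A))"
    using ne finite_slots by (intro sum_strict_mono) auto
  then show False using one c by simp
qed

text \<open>Pigeonhole: without a gap, each of the \<open>n\<close> disjoint intervals of length 2
  stacked above \<open>t lo\<close> contains a value, and none of these values comes from the index
  \<open>lo\<close>.\<close>

lemma value_gap:
  fixes t :: "nat \<Rightarrow> real"
  assumes lo: "lo < n" and hi: "hi < n" and spread: "t lo + 2 * real n < t hi"
  shows "\<exists>g. t lo \<le> g \<and> g + 2 < t hi \<and> (\<forall>i<n. t i \<le> g \<or> g + 2 < t i)"
proof (rule ccontr)
  assume neg: "\<not> ?thesis"
  have gap: "\<exists>i<n. g < t i \<and> t i \<le> g + 2" if "t lo \<le> g" "g + 2 < t hi" for g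
    using neg that by (meson linorder_not_le)
  have "\<exists>i<n. t lo + 2 * real k < t i \<and> t i \<le> t lo + 2 * real k + 2" if "k < n" for k
  proof -
    have "real k + 1 \<le> real n" using that by linarith
    then have "t lo + 2 * real k + 2 \<le> t lo + 2 * real n" by linarith
    then have "t lo + 2 * real k + 2 < t hi" using spread by linarith
    then show ?thesis using gap[of "t lo + 2 * real k"] by simp
  qed
  then obtain h where h: "\<And>k. k < n \<Longrightarrow> h k < n \<and> t lo + 2 * real k < t (h k) \<and> t (h k) \<le> t lo + 2 * real k + 2"
    by metis
  have "inj_on h {..<n}"
  proof (rule inj_onI)
    fix k l assume kl: "k \<in> {..<n}" "l \<in> {..<n}" "h k = h l"
    have a: "t lo + 2 * real k < t (h k)" "t (h k) \<le> t lo + 2 * real k + 2" using h[of k] kl by auto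
    have b: "t lo + 2 * real l < t (h k)" "t (h k) \<le> t lo + 2 * real l + 2" using h[of l] kl by auto
    have "real k < real l + 1" "real l < real k + 1" using a b by linarith+
    then show "k = l" by linarith
  qed
  moreover have "h ` {..<n} \<subseteq> {..<n} - {lo}" using h by fastforce
  ultimately have "card {..<n} \<le> card ({..<n} - {lo})" by (intro card_inj_on_le) auto
  then show False using lo by simp
qed

theorem no_equivariant_map:
  assumes ne: "ns \<noteq> []" and D: "D > 0" and p: "prime p" and pow: "\<forall>n\<in>set ns. n \<ge> 2 \<and> (\<exists>e. n = p ^ e)"
    and cont: "continuous_on (Cspace (Suc D) ns) f" and img: "f ` Cspace (Suc D) ns \<subseteq> SW (Suc D) ns"
    and equiv: "\<And>\<sigma> x. \<sigma> \<in> Sigma_grp ns \<Longrightarrow> x \<in> Cspace (Suc D) ns \<Longrightarrow> f (act ns \<sigma> x) = act ns \<sigma> (f x)"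
  shows False
proof -
  let ?G = "Sigma_grp ns" and ?C = "Cspace (Suc D) ns"
  define A where "A = slots ns D"
  \<comment> \<open>Siblings within \<open>2 * n\<close> of an entry beyond \<open>R\<close> have
    its sign and still exceed 1 in absolute value, for every \<open>n\<close> in
    \<open>ns\<close>.\<close>
  define R :: nat where "R = 2 * sum_list ns + 3"
  \<comment> \<open>The weight is 0 while no coordinate exceeds \<open>R\<close> and 1 once one of
    them reaches \<open>R + 1\<close>. So \<open>\<Psi>\<close> is \<open>f\<close> near the origin
    and the identity of the first \<open>D\<close> coordinates far away.\<close>
  define \<beta> where "\<beta> x = min 1 (\<Sum>s\<in>A. max 0 (\<bar>cval x s\<bar> - real R))" for x
  define \<Psi> where "\<Psi> x s = \<beta> x * cval x s + (1 - \<beta> x) * cval (f x) s" for x s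
  have finA: "finite A" by (simp add: A_def finite_slots)
  have nsj: "ns ! j \<ge> 2" "ns ! j \<le> sum_list ns" "\<exists>e. ns ! j = p ^ e" if "j < length ns" for j
    using pow that member_le_sum_list[of "ns ! j" ns] by auto
  have neA: "A \<noteq> {}"
  proof -
    have "(length ns - 1, [0], 0) \<in> A" using nsj[of "length ns - 1"] ne D by (simp add: A_def slots_def)
    then show ?thesis by auto
  qed
  define \<kappa> where "\<kappa> = 1 / real (card A)"
  have \<kappa>: "\<kappa> > 0" using finA neA by (simp add: \<kappa>_def card_gt_0_iff)
  \<comment> \<open>The tolerance for nearly zero values: the total error
    \<open>\<eta> * (real R + 3)\<close> in the last estimate must stay below
    \<open>\<kappa>\<close>, which bounds the largest coordinate of a unit vector from
    below.\<close>
  define \<eta> where "\<eta> = \<kappa> / (2 * (real R + 4))"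
  have \<eta>: "\<eta> > 0" "\<eta> * (real R + 3) < \<kappa>"
    using \<kappa> by (auto simp: \<eta>_def field_simps intro!: add_nonneg_pos)
  have \<kappa>1: "\<kappa> \<le> 1" using finA neA by (simp add: \<kappa>_def card_gt_0_iff Suc_le_eq)
  have sh: "sheet ns D \<sigma> z \<in> ?C" if "\<sigma> \<in> ?G" for \<sigma> z using sheet_in_Cspace[OF that] .
  have \<beta>_act: "\<beta> (act ns \<sigma> x) = \<beta> x" if "\<sigma> \<in> ?G" for \<sigma> x
  proof -
    have "(\<Sum>s\<in>A. max 0 (\<bar>cval (act ns \<sigma> x) s\<bar> - real R)) = (\<Sum>s\<in>A. max 0 (\<bar>cval x (slot_map ns D \<sigma> s)\<bar> - real R))"
      by (rule sum.cong) (simp_all add: A_def cval_act)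
    also have "\<dots> = (\<Sum>s\<in>A. max 0 (\<bar>cval x s\<bar> - real R))"
      using sum.permute[OF slot_map_permutes[OF that, of D], of "\<lambda>s. max 0 (\<bar>cval x s\<bar> - real R)"] by (simp add: A_def comp_def)
    finally show ?thesis by (simp add: \<beta>_def)
  qed
  have \<Psi>_act: "\<Psi> (act ns \<sigma> x) s = \<Psi> x (slot_map ns D \<sigma> s)" if "\<sigma> \<in> ?G" "x \<in> ?C" "s \<in> A" for \<sigma> x s
    using that by (simp add: \<Psi>_def \<beta>_act equiv cval_act A_def)
  have cont_\<Psi>: "continuous_on UNIV (\<lambda>z. \<Psi> (sheet ns D \<sigma> z) s)" if "\<sigma> \<in> ?G" for \<sigma> s
  proof -
    have c1: "continuous_on UNIV (\<lambda>z. cval (sheet ns D \<sigma> z) t)" for t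
      by (rule continuous_on_cval[OF continuous_on_sheet])
    have "continuous_on UNIV (\<lambda>z. f (sheet ns D \<sigma> z))"
      by (rule continuous_on_compose2[OF cont continuous_on_sheet]) (use sh[OF that] in auto)
    then have c2: "continuous_on UNIV (\<lambda>z. cval (f (sheet ns D \<sigma> z)) t)" for t
      by (rule continuous_on_cval)
    show ?thesis unfolding \<Psi>_def \<beta>_def by (intro continuous_intros c1 c2)
  qed
  \<comment> \<open>The radius is \<open>R + 4\<close>: after scaling, base points in
    \<open>lbox A (N + 2)\<close> reach at most \<open>R + 3\<close>, and the vertices of a simplex
    differ from its base point by at most \<open>1 / L\<close>.\<close>
  obtain L where L: "L \<ge> 1" and close: "\<forall>i\<in>?G \<times> A. \<forall>z z'. (\<forall>s\<in>A. \<bar>z s\<bar> \<le> real R + 4 \<and> \<bar>z' s\<bar> \<le> real R + 4 \<and> \<bar>z s - z' s\<bar> \<le> 1 / real L)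
    \<longrightarrow> (\<forall>s. s \<notin> A \<longrightarrow> z s = 0 \<and> z' s = 0) \<longrightarrow> \<bar>\<Psi> (sheet ns D (fst i) z) (snd i) - \<Psi> (sheet ns D (fst i) z') (snd i)\<bar> \<le> \<eta>"
  proof -
    have "\<exists>L\<ge>1. \<forall>i\<in>?G \<times> A. \<forall>z z'. (\<forall>s\<in>A. \<bar>z s\<bar> \<le> real R + 4 \<and> \<bar>z' s\<bar> \<le> real R + 4 \<and> \<bar>z s - z' s\<bar> \<le> 1 / real L)
    \<longrightarrow> (\<forall>s. s \<notin> A \<longrightarrow> z s = 0 \<and> z' s = 0) \<longrightarrow> \<bar>\<Psi> (sheet ns D (fst i) z) (snd i) - \<Psi> (sheet ns D (fst i) z') (snd i)\<bar> \<le> \<eta>"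
    proof (rule uniformly_close_on_box)
      show "finite (?G \<times> A)" using finite_Sigma_grp finA by blast
      show "continuous_on UNIV (\<lambda>z. \<Psi> (sheet ns D (fst i) z) (snd i))" if "i \<in> ?G \<times> A" for i
        using cont_\<Psi>[of "fst i" "snd i"] that by (simp add: mem_Times_iff)
    qed (rule \<eta>(1))
    then show ?thesis using that by blast
  qed
  define l where "l \<sigma> u = cfg_label A \<Psi> (sheet ns D \<sigma> (\<lambda>s. real_of_int (u s) / real L))" for \<sigma> and u :: "slot \<Rightarrow> int"
  define N where "N = int (L * (R + 1))"
  have "1 \<le> L * (R + 1)" using L by simp
  then have N1: "N \<ge> 1" unfolding N_def by (metis of_nat_1 of_nat_le_iff)
  let ?id = "\<lambda>j ts. id :: nat \<Rightarrow> nat"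
  have lcase: "case l \<sigma> u of None \<Rightarrow> \<forall>s\<in>A. \<Psi> (sheet ns D \<sigma> (\<lambda>s. real_of_int (u s) / real L)) s \<le> 0
      | Some s \<Rightarrow> s \<in> argmax_slots A (\<Psi> (sheet ns D \<sigma> (\<lambda>s. real_of_int (u s) / real L)))" if "\<sigma> \<in> ?G" for \<sigma> u
    unfolding l_def by (rule cfg_label_cases(1)[OF sh[OF that]]) (simp add: A_def)
  have lopts: "l \<sigma> u \<in> opts A" if "\<sigma> \<in> ?G" for \<sigma> u
    using lcase[OF that, of u] by (auto simp: argmax_slots_def split: option.splits)
  have cvs: "cval (sheet ns D \<sigma> z) s = z s" if "s \<in> A" for \<sigma> z s
    using that by (auto simp: A_def slots_def cval_def sheet_def)
  \<comment> \<open>Outside \<open>lbox A N\<close> some coordinate exceeds \<open>R + 1\<close>, so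
    the weight is 1 and the label is an argmax label of the grid point itself.\<close>
  have total: "(\<Sum>(u, \<theta>)\<in>lbox A (N + 2) \<times> ranks A. door_sum A (l ?id) u \<theta>) = 1"
  proof (rule signed_sperner_supported[OF finA neA N1])
    fix u :: "slot \<Rightarrow> int"
    assume supp: "\<And>a. a \<notin> A \<Longrightarrow> u a = 0" and out: "u \<notin> lbox A N"
    let ?x = "sheet ns D ?id (\<lambda>s. real_of_int (u s) / real L)"
    obtain s0 where s0: "s0 \<in> A" "\<bar>u s0\<bar> > N" using out supp by (auto simp: lbox_def not_le)
    have "real_of_int \<bar>u s0\<bar> > real_of_int N" using s0(2) by (simp only: of_int_less_iff)
    then have "\<bar>real_of_int (u s0)\<bar> / real L > (real L * (real R + 1)) / real L"
      using L by (intro divide_strict_right_mono) (auto simp: N_def distrib_left)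
    then have "\<bar>cval ?x s0\<bar> > real R + 1" using cvs[OF s0(1)] L by simp
    then have "1 \<le> max 0 (\<bar>cval ?x s0\<bar> - real R)" by simp
    also have "\<dots> \<le> (\<Sum>s\<in>A. max 0 (\<bar>cval ?x s\<bar> - real R))"
      by (rule member_le_sum[OF s0(1)]) (use finA in auto)
    finally have "\<beta> ?x = 1" by (simp add: \<beta>_def)
    then have \<Psi>x: "\<Psi> ?x s = real_of_int (u s) / real L" if "s \<in> A" for s using cvs[OF that] by (simp add: \<Psi>_def)
    have pos: "real L > 0" using L by simp
    have "l ?id u = None \<Longrightarrow> \<forall>s\<in>A. u s \<le> 0"
      using lcase[OF id_in_Sigma_grp, of u] \<Psi>x pos by (auto simp: divide_le_0_iff)
    moreover have "s \<in> A \<and> u s > 0 \<and> (\<forall>t\<in>A. u t \<le> u s)" if "l ?id u = Some s" for s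
    proof -
      have "s \<in> argmax_slots A (\<Psi> ?x)" using lcase[OF id_in_Sigma_grp, of u] that by simp
      then have sA: "s \<in> A" and p0: "\<Psi> ?x s > 0" and mx: "\<forall>t\<in>A. \<Psi> ?x t \<le> \<Psi> ?x s"
        by (simp_all add: argmax_slots_def)
      have "u t \<le> u s" if "t \<in> A" for t
      proof -
        have "real_of_int (u t) / real L \<le> real_of_int (u s) / real L"
          using mx that \<Psi>x[OF that] \<Psi>x[OF sA] by force
        then show ?thesis using pos by (simp add: divide_le_cancel)
      qed
      moreover have "u s > 0" using p0 \<Psi>x[OF sA] pos by (simp add: zero_less_divide_iff)
      ultimately show ?thesis using sA by blast
    qed
    ultimately show "argmax_label A u (l ?id u)" unfolding argmax_label_def by (auto split: option.splits)
  qed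

  \<comment> \<open>Two distant clusters on a fully labelled simplex\<close>
  have node: "\<exists>j ts I. j < length ns \<and> valid_addr ns (Suc j) ts \<and> I \<subseteq> {..<ns ! j} \<and> I \<noteq> {} \<and> I \<noteq> {..<ns ! j} \<and>
      (\<forall>i\<le>card A. \<forall>x\<in>I. \<forall>y\<in>{..<ns ! j}-I. prox D (\<lambda>s. real_of_int (vtx u \<theta> i s) / real L) j (x # ts) (y # ts) = 0)"
    if \<sigma>: "\<sigma> \<in> ?G" and u: "u \<in> lbox A (N + 2)" and th: "\<theta> \<in> ranks A" and nz: "door_sum A (l \<sigma>) u \<theta> \<noteq> 0" for \<sigma> u \<theta>
  proof -
    define z where "z i s = real_of_int (vtx u \<theta> i s) / real L" for i s
    define x where "x i = sheet ns D \<sigma> (z i)" for i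
    have pos: "real L > 0" using L by simp
    have full: "\<exists>i\<le>card A. l \<sigma> (vtx u \<theta> i) = q" if "q \<in> opts A" for q
      using door_sum_nonzero_imp_full[OF th finA nz that lopts[OF \<sigma>]] .
    have lz: "l \<sigma> (vtx u \<theta> i) = cfg_label A \<Psi> (x i)" for i
      by (simp add: l_def x_def z_def[abs_def])
    have xC: "x i \<in> ?C" for i unfolding x_def by (rule sh[OF \<sigma>])
    have supp: "z i s = 0" if "s \<notin> A" "i \<le> card A" for i s
    proof -
      have "u s = 0" using u that(1) unfolding lbox_def by blast
      then show ?thesis using ranks_out[OF th, of "Some s"] that by (simp add: z_def vtx_def)
    qed
    have z0: "z 0 s = real_of_int (u s) / real L" for s
      using ranks_pos'[OF th, of "Some s"] by (simp add: z_def vtx_def)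
    have zi: "z 0 s \<le> z i s \<and> z i s \<le> z 0 s + 1 / real L" for i s
      unfolding z0 using pos by (auto simp: z_def vtx_def add_divide_distrib)
    have L1: "1 / real L \<le> 1" using L by simp
    have zb: "\<bar>z i s\<bar> \<le> real R + 4" if "s \<in> A" for i s
    proof -
      have "\<bar>u s\<bar> \<le> N + 2" using u that unfolding lbox_def by blast
      then have "real_of_int \<bar>u s\<bar> \<le> real_of_int (N + 2)" by (simp only: of_int_le_iff)
      then have "\<bar>real_of_int (u s)\<bar> / real L \<le> (real L * (real R + 1) + 2) / real L"
        using pos by (intro divide_right_mono) (auto simp: N_def algebra_simps)
      also have "\<dots> = real R + 1 + 2 * (1 / real L)" using pos by (simp add: field_simps)
      finally have "\<bar>z 0 s\<bar> \<le> real R + 3" unfolding z0 using L1 by simp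
      then show ?thesis using zi[of s i] L1 by linarith
    qed
    have osc: "\<bar>\<Psi> (x i) s - \<Psi> (x k) s\<bar> \<le> \<eta>" if "s \<in> A" "i \<le> card A" "k \<le> card A" for i k s
    proof -
      have "\<bar>z i t - z k t\<bar> \<le> 1 / real L" for t using zi[of t i] zi[of t k] by linarith
      then show ?thesis using close[rule_format, of "(\<sigma>, s)" "z i" "z k"] zb supp that \<sigma> by (simp add: x_def)
    qed
    obtain i0 where i0: "i0 \<le> card A" "cfg_label A \<Psi> (x i0) = None" using full[of None] lz by auto
    \<comment> \<open>The vertex with label \<open>None\<close> has all coordinates of
      \<open>\<Psi>\<close> nonpositive, the one with label \<open>Some s\<close> has coordinate
      \<open>s\<close> positive, and the mesh bounds the change between vertices.\<close>
    have small: "\<bar>\<Psi> (x i) s\<bar> \<le> \<eta>" if s: "s \<in> A" and i: "i \<le> card A" for i s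
    proof -
      have "\<Psi> (x i0) s \<le> 0" using cfg_label_cases(1)[OF xC A_def, of \<Psi> i0] i0(2) s by simp
      moreover obtain k where k: "k \<le> card A" "cfg_label A \<Psi> (x k) = Some s" using full[of "Some s"] lz s by auto
      then have "\<Psi> (x k) s > 0" using cfg_label_cases(1)[OF xC A_def, of \<Psi> k] by (simp add: argmax_slots_def)
      ultimately show ?thesis using osc[OF s i i0(1)] osc[OF s i k(1)] by linarith
    qed
    define t where "t s = z 0 s" for s
    define b where "b = \<beta> (x 0)"
    define F where "F s = cval (f (x 0)) s" for s
    have ct: "cval (x 0) s = t s" if "s \<in> A" for s using cvs[OF that] by (simp add: x_def t_def)
    have \<Psi>0: "\<Psi> (x 0) s = b * t s + (1 - b) * F s" if "s \<in> A" for s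
      using ct[OF that] by (simp add: \<Psi>_def b_def F_def)
    have sm: "\<bar>b * t s + (1 - b) * F s\<bar> \<le> \<eta>" if "s \<in> A" for s using small[OF that, of 0] \<Psi>0[OF that] by simp
    have bt: "b = min 1 (\<Sum>s\<in>A. max 0 (\<bar>t s\<bar> - real R))"
      unfolding b_def \<beta>_def using ct by (intro arg_cong2[of _ _ _ _ min] sum.cong) auto
    have b01: "0 \<le> b" "b \<le> 1" unfolding bt by (auto intro!: sum_nonneg)
    have FSW: "f (x 0) \<in> SW (Suc D) ns" using img xC[of 0] by auto
    obtain s\<kappa> where s\<kappa>: "s\<kappa> \<in> A" "\<kappa> \<le> \<bar>F s\<kappa>\<bar>" using SW_large_coordinate[OF FSW] by (auto simp: A_def \<kappa>_def F_def)
    have \<eta>\<kappa>: "\<eta> < \<kappa>"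
    proof -
      have "\<eta> * 1 \<le> \<eta> * (real R + 3)" using \<eta>(1) by (intro mult_left_mono) auto
      then show ?thesis using \<eta>(2) by simp
    qed
    \<comment> \<open>Otherwise \<open>b = 0\<close>, and the small vector would be the value of
      \<open>f\<close>, which has a coordinate of size at least \<open>\<kappa>\<close>.\<close>
    have "\<exists>s\<in>A. \<bar>t s\<bar> > real R"
    proof (rule ccontr)
      assume "\<not> ?thesis"
      then have "(\<Sum>s\<in>A. max 0 (\<bar>t s\<bar> - real R)) = 0" by (intro sum.neutral) force
      then have "b = 0" by (simp add: bt)
      then show False using sm[OF s\<kappa>(1)] s\<kappa>(2) \<eta>\<kappa> by simp
    qed
    then obtain s1 where s1: "s1 \<in> A" "\<bar>t s1\<bar> > real R" by blast
    obtain j a c where jac': "s1 = (j, a, c)" by (cases s1)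
    note jac = s1[unfolded jac']
    \<comment> \<open>Otherwise \<open>b = 1\<close>, and the small vector would consist of the
      coordinates \<open>t\<close> themselves.\<close>
    have tb: "\<bar>t s\<bar> \<le> real R + 1" if s: "s \<in> A" for s
    proof (rule ccontr)
      assume "\<not> \<bar>t s\<bar> \<le> real R + 1"
      then have big: "\<bar>t s\<bar> > real R + 1" by simp
      then have "1 \<le> max 0 (\<bar>t s\<bar> - real R)" by simp
      also have "\<dots> \<le> (\<Sum>s\<in>A. max 0 (\<bar>t s\<bar> - real R))" by (rule member_le_sum[OF s]) (use finA in auto)
      finally have "b = 1" by (simp add: bt)
      then show False using sm[OF s] big \<eta>\<kappa> \<kappa>1 by simp
    qed
    have j: "j < length ns" and va: "valid_addr ns j a" and c: "c < D" using jac(1) by (simp_all add: A_def slots_def)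
    obtain i1 ts where a: "a = i1 # ts" "i1 < ns ! j" "valid_addr ns (Suc j) ts"
      using valid_addrE[OF j va] .
    define n where "n = ns ! j"
    define T where "T i = t (j, i # ts, c)" for i
    have inA: "(j, i # ts, c) \<in> A" if "i < n" for i using that j a c by (simp add: A_def slots_def n_def)
    have nR: "2 * real n + 3 \<le> real R"
    proof -
      have "2 * n + 3 \<le> R" using nsj(2)[OF j] by (simp add: R_def n_def)
      then show ?thesis by linarith
    qed
    have n0: "n > 0" using a by (simp add: n_def)
    \<comment> \<open>If the siblings were not spread out, all of them would be large with one sign.
      Their \<open>F\<close>-values sum to 0, so summing the nearly zero values over the siblings
      gives \<open>b \<le> \<eta>\<close>; but then the unit vector dominates at
      \<open>s\<kappa>\<close>.\<close>
    have "\<exists>lo hi. lo < n \<and> hi < n \<and> T lo + 2 * real n < T hi"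
    proof (rule ccontr)
      assume neg: "\<not> ?thesis"
      then have cl: "T k \<le> T i + 2 * real n" if "i < n" "k < n" for i k using that by force
      have Ti1: "\<bar>T i1\<bar> > real R" "i1 < n" using jac(2) a by (simp_all add: T_def n_def)
      have sumF: "(\<Sum>i<n. F (j, i # ts, c)) = 0"
        using FSW j a c by (simp add: SW_def Wspace_def F_def cval_def n_def)
      have "\<bar>\<Sum>i<n. b * T i + (1 - b) * F (j, i # ts, c)\<bar> \<le> (\<Sum>i<n. \<eta>)"
        by (rule order_trans[OF sum_abs sum_mono]) (use sm inA in \<open>auto simp: T_def\<close>)
      moreover have "(\<Sum>i<n. b * T i + (1 - b) * F (j, i # ts, c)) = b * (\<Sum>i<n. T i)"
        using sumF by (simp add: sum.distrib flip: sum_distrib_left)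
      ultimately have bS: "b * \<bar>\<Sum>i<n. T i\<bar> \<le> real n * \<eta>" using b01 by (simp add: abs_mult)
      have "real n \<le> \<bar>\<Sum>i<n. T i\<bar>"
      proof (cases "T i1 > 0")
        case True
        then have "1 \<le> T i" if "i < n" for i using cl[OF that Ti1(2)] Ti1 nR by linarith
        then have "(\<Sum>i<n. 1) \<le> (\<Sum>i<n. T i)" by (intro sum_mono) auto
        then show ?thesis by simp
      next
        case False
        then have "1 \<le> - T i" if "i < n" for i using cl[OF Ti1(2) that] Ti1 nR by linarith
        then have "(\<Sum>i<n. 1) \<le> (\<Sum>i<n. - T i)" by (intro sum_mono) auto
        then show ?thesis by (simp add: sum_negf)
      qed
      then have "b * real n \<le> real n * \<eta>" using bS mult_left_mono[OF _ b01(1)] order_trans by blast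
      then have b\<eta>: "b \<le> \<eta>" using n0 by (simp add: mult.commute)
      have "(1 - b) * \<bar>F s\<kappa>\<bar> = \<bar>(b * t s\<kappa> + (1 - b) * F s\<kappa>) - b * t s\<kappa>\<bar>" using b01 by (simp add: abs_mult)
      also have "\<dots> \<le> \<eta> + b * \<bar>t s\<kappa>\<bar>"
      proof -
        have "\<bar>b * t s\<kappa>\<bar> = b * \<bar>t s\<kappa>\<bar>" using b01 by (simp add: abs_mult)
        then show ?thesis using sm[OF s\<kappa>(1)] by linarith
      qed
      also have "b * \<bar>t s\<kappa>\<bar> \<le> \<eta> * (real R + 1)" using b\<eta> tb[OF s\<kappa>(1)] b01 \<eta> by (intro mult_mono) auto
      finally have "(1 - b) * \<bar>F s\<kappa>\<bar> \<le> \<eta> * (real R + 2)" by (simp add: algebra_simps)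
      moreover have "(1 - b) * \<kappa> \<le> (1 - b) * \<bar>F s\<kappa>\<bar>" using s\<kappa>(2) b01 by (intro mult_left_mono) auto
      moreover have "b * \<kappa> \<le> \<eta> * 1" using b\<eta> \<kappa>1 b01 \<kappa> by (intro mult_mono) auto
      ultimately have "\<kappa> \<le> \<eta> * (real R + 3)" by (simp add: algebra_simps)
      then show False using \<eta>(2) by simp
    qed
    then obtain lo hi where lohi: "lo < n" "hi < n" "T lo + 2 * real n < T hi" by blast
    obtain g where g: "T lo \<le> g" "g + 2 < T hi" "\<forall>i<n. T i \<le> g \<or> g + 2 < T i" using value_gap[of lo n hi T] lohi by blast
    let ?I = "{i. i < n \<and> T i \<le> g}"
    have far: "prox D (z i) j (x' # ts) (y # ts) = 0" if x': "x' \<in> ?I" and y: "y \<in> {..<n} - ?I" for i x' y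
    proof -
      have "T x' \<le> g" "g + 2 < T y" using x' y g(3) by auto
      \<comment> \<open>A gap of 2 at vertex 0 leaves a distance of 1 at every vertex, since the
        mesh is at most 1; at distance 1 the proximity vanishes.\<close>
      then have "1 \<le> \<bar>z i (j, x' # ts, c) - z i (j, y # ts, c)\<bar>"
        using zi[of "(j, x' # ts, c)" i] zi[of "(j, y # ts, c)" i] L1 by (simp add: T_def t_def)
      also have "\<dots> \<le> (\<Sum>c<D. \<bar>z i (j, x' # ts, c) - z i (j, y # ts, c)\<bar>)"
        using c by (intro member_le_sum[of c "{..<D}" "\<lambda>c. \<bar>z i (j, x' # ts, c) - z i (j, y # ts, c)\<bar>"]) auto
      finally show ?thesis by (simp add: prox_def)
    qed
    have zz: "(\<lambda>s. real_of_int (vtx u \<theta> i s) / real L) = z i" for i by (rule ext) (simp add: z_def)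
    have "lo \<in> ?I" using lohi(1) g(1) by simp
    moreover have "hi \<notin> ?I" "hi \<in> {..<n}" using lohi(2) g(2) by simp_all
    ultimately have I: "?I \<noteq> {}" "?I \<noteq> {..<n}" "?I \<subseteq> {..<n}" by blast+
    show ?thesis unfolding zz
    proof (rule exI[of _ j], rule exI[of _ ts], rule exI[of _ ?I], intro conjI allI impI ballI)
      show "prox D (z i) j (x' # ts) (y # ts) = 0" if "x' \<in> ?I" "y \<in> {..<ns ! j} - ?I" for i x' y
        using far that by (simp only: n_def)
    qed (use j a I in \<open>simp_all only: n_def not_False_eq_True\<close>)
  qed

  \<comment> \<open>Summation over the orbits of simplices\<close>
  have "int p dvd (\<Sum>w\<in>lbox A (N + 2) \<times> ranks A. door_sum A (l ?id) (fst w) (snd w))"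
  proof (rule sum_free_orbits_dvd[where G="?G" and e="?id"
        and act="\<lambda>g w. (\<lambda>s. fst w (slot_map ns D g s), \<lambda>q. snd w (map_option (slot_map ns D g) q))"
        and H="\<lambda>g w. door_sum A (l g) (fst w) (snd w)"])
    let ?W = "lbox A (N + 2) \<times> ranks A"
    have perm: "slot_map ns D g permutes A" if "g \<in> ?G" for g unfolding A_def by (rule slot_map_permutes[OF that])
    show "finite ?W" using finite_lbox[OF finA] finite_ranks[OF finA] by blast
    show "finite ?G" by (rule finite_Sigma_grp)
    show "?id \<in> ?G" by (rule id_in_Sigma_grp)
    have mid: "map_option (slot_map ns D ?id) q = q" for q by (cases q) simp_all
    fix w assume w: "w \<in> ?W"
    show "(\<lambda>s. fst w (slot_map ns D ?id s), \<lambda>q. snd w (map_option (slot_map ns D ?id) q)) = w"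
      unfolding slot_map_id mid by simp
    { fix g assume g: "g \<in> ?G"
      have in_iff: "slot_map ns D g s \<in> A \<longleftrightarrow> s \<in> A" for s by (rule permutes_in_image[OF perm[OF g]])
      have "fst w \<in> lbox A (N + 2)" using w by auto
      then have "\<bar>fst w (slot_map ns D g s)\<bar> \<le> N + 2" if "s \<in> A" for s
        using in_iff[of s] that unfolding lbox_def by blast
      moreover have "fst w (slot_map ns D g s) = 0" if "s \<notin> A" for s
        using in_iff[of s] that \<open>fst w \<in> lbox A (N + 2)\<close> unfolding lbox_def by blast
      ultimately have "(\<lambda>s. fst w (slot_map ns D g s)) \<in> lbox A (N + 2)" unfolding lbox_def by blast
      then show "(\<lambda>s. fst w (slot_map ns D g s), \<lambda>q. snd w (map_option (slot_map ns D g) q)) \<in> ?W"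
        using ranks_permute[OF perm[OF g]] w by auto
      have lab: "map_option (slot_map ns D g) (l g (\<lambda>s. v (slot_map ns D g s))) = l ?id v" for v
      proof -
        have e: "sheet ns D g (\<lambda>s. real_of_int (v (slot_map ns D g s)) / real L)
            = act ns g (sheet ns D ?id (\<lambda>s. real_of_int (v s) / real L))"
          unfolding act_sheet[OF g] ..
        show ?thesis unfolding l_def e
        proof (rule cfg_label_act[where d="Suc D", OF g _ _ A_def])
          show "sheet ns D ?id (\<lambda>s. real_of_int (v s) / real L) \<in> ?C" by (rule sh[OF id_in_Sigma_grp])
          then show "\<Psi> (act ns g (sheet ns D ?id (\<lambda>s. real_of_int (v s) / real L))) s
            = \<Psi> (sheet ns D ?id (\<lambda>s. real_of_int (v s) / real L)) (slot_map ns D g s)" if "s \<in> A" for s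
            using \<Psi>_act[OF g _ that] by blast
          show "act ns g (sheet ns D ?id (\<lambda>s. real_of_int (v s) / real L)) \<in> ?C"
            unfolding e[symmetric] by (rule sh[OF g])
        qed
      qed
      show "door_sum A (l g) (fst (\<lambda>s. fst w (slot_map ns D g s), \<lambda>q. snd w (map_option (slot_map ns D g) q)))
          (snd (\<lambda>s. fst w (slot_map ns D g s), \<lambda>q. snd w (map_option (slot_map ns D g) q))) = door_sum A (l ?id) (fst w) (snd w)"
        unfolding fst_conv snd_conv by (rule door_sum_permute[OF perm[OF g] finA lab])
      fix h assume h: "h \<in> ?G"
      { assume eq: "(\<lambda>s. fst w (slot_map ns D g s), \<lambda>q. snd w (map_option (slot_map ns D g) q)) =
          (\<lambda>s. fst w (slot_map ns D h s), \<lambda>q. snd w (map_option (slot_map ns D h) q))"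
        show "g = h"
        proof (rule slot_map_inject[OF g h D])
          fix s assume s: "s \<in> slots ns D"
          have "snd w (Some (slot_map ns D g s)) = snd w (Some (slot_map ns D h s))"
            using fun_cong[OF arg_cong[OF eq, of snd], of "Some s"] by simp
          then show "slot_map ns D g s = slot_map ns D h s"
            using ranks_inj[of "snd w" A "Some (slot_map ns D g s)" "Some (slot_map ns D h s)"] w s slot_map_in[OF g] slot_map_in[OF h]
            by (auto simp: A_def)
        qed }
    }
    \<comment> \<open>One contributing sheet suffices to find the node: its clusters depend only on
      the coordinates of the simplex, so they serve all sheets at once.\<close>
    show "int p dvd (\<Sum>g\<in>?G. door_sum A (l g) (fst w) (snd w))"
    proof (cases "\<exists>\<sigma>\<in>?G. door_sum A (l \<sigma>) (fst w) (snd w) \<noteq> 0")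
      case False
      then show ?thesis by simp
    next
      case True
      then obtain \<sigma>1 where "\<sigma>1 \<in> ?G" "door_sum A (l \<sigma>1) (fst w) (snd w) \<noteq> 0" by blast
      from node[OF this(1) _ _ this(2)] w obtain j ts I where nd: "j < length ns" "valid_addr ns (Suc j) ts"
          "I \<subseteq> {..<ns ! j}" "I \<noteq> {}" "I \<noteq> {..<ns ! j}"
        and far: "\<forall>i\<le>card A. \<forall>x\<in>I. \<forall>y\<in>{..<ns ! j}-I. prox D (\<lambda>s. real_of_int (vtx (fst w) (snd w) i s) / real L) j (x # ts) (y # ts) = 0"
        by (auto simp: mem_Times_iff)
      obtain e where e: "ns ! j = p ^ e" using nsj(3)[OF nd(1)] by blast
      show ?thesis
      proof (rule sum_Sigma_grp_node_dvd[OF p e nd(1-5)])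
        fix \<sigma> s s'
        assume as: "\<sigma> \<in> ?G" "s permutes {..<ns ! j}" "s' permutes {..<ns ! j}"
          "\<And>x y. x \<in> I \<Longrightarrow> y \<in> I \<Longrightarrow> inv s x < inv s y \<longleftrightarrow> inv s' x < inv s' y"
          "\<And>x y. x \<in> {..<ns ! j}-I \<Longrightarrow> y \<in> {..<ns ! j}-I \<Longrightarrow> inv s x < inv s y \<longleftrightarrow> inv s' x < inv s' y"
        show "door_sum A (l (sigma_upd \<sigma> j ts s)) (fst w) (snd w) = door_sum A (l (sigma_upd \<sigma> j ts s')) (fst w) (snd w)"
        proof (rule door_sum_cong)
          show "snd w \<in> ranks A" using w by auto
          fix i assume i: "i \<le> card A"
          show "l (sigma_upd \<sigma> j ts s) (vtx (fst w) (snd w) i) = l (sigma_upd \<sigma> j ts s') (vtx (fst w) (snd w) i)"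
            unfolding l_def using far i
            by (subst sheet_upd_eq[OF nd(1) as(2,3,4,5)]) blast+
        qed
      qed
    qed
  next
    fix g h assume g: "g \<in> ?G" and h: "h \<in> ?G"
      show "\<exists>k\<in>?G. \<forall>x\<in>lbox A (N + 2) \<times> ranks A. (\<lambda>s. fst (\<lambda>s. fst x (slot_map ns D g s), \<lambda>q. snd x (map_option (slot_map ns D g) q)) (slot_map ns D h s),
           \<lambda>q. snd (\<lambda>s. fst x (slot_map ns D g s), \<lambda>q. snd x (map_option (slot_map ns D g) q)) (map_option (slot_map ns D h) q))
          = (\<lambda>s. fst x (slot_map ns D k s), \<lambda>q. snd x (map_option (slot_map ns D k) q))"
        unfolding fst_conv snd_conv option.map_comp comp_def slot_map_comp[OF h g]
        by (rule bexI[OF _ sigma_comp_in[OF h g]]) simp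
  next
    fix g assume g: "g \<in> ?G"
    have surj: "surj (slot_map ns D g)" by (rule permutes_surj[OF slot_map_permutes[OF g]])
    have msurj: "\<exists>q'. q = map_option (slot_map ns D g) q'" for q
    proof (cases q)
      case (Some s)
      obtain s' where "s = slot_map ns D g s'" using surjD[OF surj, of s] by blast
      then show ?thesis using Some by (intro exI[of _ "Some s'"]) simp
    qed (auto intro: exI[of _ None])
    show "inj_on (\<lambda>w. (\<lambda>s. fst w (slot_map ns D g s), \<lambda>q. snd w (map_option (slot_map ns D g) q))) (lbox A (N + 2) \<times> ranks A)"
    proof (rule inj_onI)
      fix w w' :: "(slot \<Rightarrow> int) \<times> (slot option \<Rightarrow> nat)"
      assume eq: "(\<lambda>s. fst w (slot_map ns D g s), \<lambda>q. snd w (map_option (slot_map ns D g) q)) =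
          (\<lambda>s. fst w' (slot_map ns D g s), \<lambda>q. snd w' (map_option (slot_map ns D g) q))"
      have "fst w s = fst w' s" for s
      proof -
        obtain s' where "s = slot_map ns D g s'" using surjD[OF surj, of s] by blast
        then show ?thesis using fun_cong[OF arg_cong[OF eq, of fst], of s'] by simp
      qed
      moreover have "snd w q = snd w' q" for q
      proof -
        obtain q' where "q = map_option (slot_map ns D g) q'" using msurj[of q] by blast
        then show ?thesis using fun_cong[OF arg_cong[OF eq, of snd], of q'] by simp
      qed
      ultimately show "w = w'" by (intro prod_eqI ext)
    qed
  qed
  then have "int p dvd 1" using total by (simp add: case_prod_unfold)
  then show False using p by (simp add: prime_nat_iff)
qed

section \<open>Bubbles\<close>

text \<open>The loop \<open>loopfun\<close> has winding number one around 0, stays at its base point 1 outside \<open>{-1..1}\<close>, and crosses the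
  negative real axis only at time 0. A bubble is a perturbation of the identity, supported near the ray spanned by \<open>v\<close>,
  which twists the plane spanned by \<open>v\<close> and \<open>e\<close> with degree \<open>a\<close>. For points of the unit circle, \<open>cpow\<close> is the integer
  power; unlike the integer power it is continuous at 0.\<close>

definition loopfun :: "real \<Rightarrow> complex" where
  "loopfun \<tau> = Complex (2 * min 1 \<bar>\<tau>\<bar> - 1) (- \<tau> * max 0 (1 - \<bar>\<tau>\<bar>))"

definition cpow :: "complex \<Rightarrow> int \<Rightarrow> complex" where
  "cpow w a = (if a \<ge> 0 then w ^ nat a else cnj w ^ nat (- a))"

definition coord2 :: "'a::real_inner \<Rightarrow> 'a \<Rightarrow> 'a \<Rightarrow> complex" where
  "coord2 v e z = Complex (z \<bullet> v) (z \<bullet> e)"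

definition lift2 :: "'a::real_inner \<Rightarrow> 'a \<Rightarrow> complex \<Rightarrow> 'a" where
  "lift2 v e w = Re w *\<^sub>R v + Im w *\<^sub>R e"

definition perp2 :: "'a::real_inner \<Rightarrow> 'a \<Rightarrow> 'a \<Rightarrow> 'a" where
  "perp2 v e z = z - lift2 v e (coord2 v e z)"

text \<open>Switches a bubble off around the ray opposite to \<open>v\<close>. It is constantly 1
  from 1/2 on, hence at every point of norm at least 1 that is close to the ray of
  \<open>v\<close>.\<close>

definition cutoff :: "real \<Rightarrow> real" where
  "cutoff s = min 1 (max 0 (2 * s))"

definition bubble :: "real \<Rightarrow> 'a::real_inner \<Rightarrow> 'a \<Rightarrow> int \<Rightarrow> 'a \<Rightarrow> 'a" where
  "bubble \<delta> v e a z = (max 0 (1 - norm (perp2 v e z) / \<delta>) * cutoff (z \<bullet> v)) *\<^sub>R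
     lift2 v e ((cpow (loopfun ((z \<bullet> e) / \<delta>)) a - 1) * coord2 v e z)"

definition onpair :: "'a::real_inner \<Rightarrow> 'a \<Rightarrow> bool" where
  "onpair v e \<longleftrightarrow> norm v = 1 \<and> norm e = 1 \<and> v \<bullet> e = 0"

lemma loopfun_nonzero: "loopfun \<tau> \<noteq> 0"
  by (auto simp: loopfun_def complex_eq_iff min_def max_def abs_if split: if_splits)

lemma loopfun_outside: "1 \<le> \<bar>\<tau>\<bar> \<Longrightarrow> loopfun \<tau> = 1"
  by (simp add: loopfun_def complex_eq_iff)

lemma loopfun_0: "loopfun 0 = -1"
  by (simp add: loopfun_def complex_eq_iff)

lemma loopfun_minus: "loopfun (- \<tau>) = cnj (loopfun \<tau>)"
  by (simp add: loopfun_def complex_eq_iff)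

lemma Im_loopfun: "Im (loopfun \<tau>) = - \<tau> * max 0 (1 - \<bar>\<tau>\<bar>)"
  by (simp add: loopfun_def)

lemma cpow_one [simp]: "cpow 1 a = 1"
  by (simp add: cpow_def)

lemma cpow_nonzero: "w \<noteq> 0 \<Longrightarrow> cpow w a \<noteq> 0"
  by (simp add: cpow_def)

lemma cpow_cnj: "cpow (cnj w) a = cnj (cpow w a)"
  by (simp add: cpow_def)

lemma cpow_unit:
  assumes "norm w = 1"
  shows "cpow w a = w powi a"
proof -
  have "cnj w = inverse w" using assms
    by (metis complex_div_cnj complex_norm_square div_by_1 inverse_eq_divide mult.commute of_real_1 one_power2 power_one_right mult_1)
  then show ?thesis by (simp add: cpow_def power_int_def power_inverse)
qed

lemma continuous_on_cpow [continuous_intros]: "continuous_on S f \<Longrightarrow> continuous_on S (\<lambda>x. cpow (f x) a)"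
  unfolding cpow_def by (cases "a \<ge> 0") (auto intro!: continuous_intros)

lemma continuous_on_loopfun [continuous_intros]: "continuous_on S f \<Longrightarrow> continuous_on S (\<lambda>x. loopfun (f x))"
  unfolding loopfun_def by (intro continuous_intros)

lemma continuous_on_coord2 [continuous_intros]:
  "continuous_on S f \<Longrightarrow> continuous_on S g \<Longrightarrow> continuous_on S h \<Longrightarrow> continuous_on S (\<lambda>x. coord2 (f x) (g x) (h x))"
  unfolding coord2_def by (intro continuous_intros)

lemma continuous_on_lift2 [continuous_intros]:
  "continuous_on S f \<Longrightarrow> continuous_on S g \<Longrightarrow> continuous_on S h \<Longrightarrow> continuous_on S (\<lambda>x. lift2 (f x) (g x) (h x))"
  unfolding lift2_def by (intro continuous_intros)

lemma continuous_on_perp2 [continuous_intros]: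
  "continuous_on S f \<Longrightarrow> continuous_on S g \<Longrightarrow> continuous_on S h \<Longrightarrow> continuous_on S (\<lambda>x. perp2 (f x) (g x) (h x))"
  unfolding perp2_def by (intro continuous_intros)

lemma continuous_on_cutoff [continuous_intros]: "continuous_on S f \<Longrightarrow> continuous_on S (\<lambda>x. cutoff (f x))"
  unfolding cutoff_def by (intro continuous_intros)

lemma continuous_on_bubble [continuous_intros]:
  assumes "\<delta> > 0" "continuous_on S f" "continuous_on S g" "continuous_on S h"
  shows "continuous_on S (\<lambda>x. bubble \<delta> (f x) (g x) a (h x))"
  using assms unfolding bubble_def by (intro continuous_intros) auto

lemma coord2_lift2:
  assumes "onpair v e"
  shows "coord2 v e (lift2 v e w) = w"
  using assms by (simp add: onpair_def coord2_def lift2_def inner_add_left complex_eq_iff inner_commute[of e v] dot_square_norm)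

lemma coord2_perp2: "onpair v e \<Longrightarrow> coord2 v e (perp2 v e z) = 0"
  using coord2_lift2[of v e "coord2 v e z"]
  by (simp add: perp2_def coord2_def inner_diff_left complex_eq_iff)

lemma coord2_add: "coord2 v e (x + y) = coord2 v e x + coord2 v e y"
  by (simp add: coord2_def inner_add_left complex_eq_iff)

lemma lift2_add: "lift2 v e (x + y) = lift2 v e x + lift2 v e y"
  by (simp add: lift2_def scaleR_add_left)

lemma lift2_scaleR: "lift2 v e (of_real r * w) = r *\<^sub>R lift2 v e w"
  by (simp add: lift2_def scaleR_add_right)

lemma split2: "z = lift2 v e (coord2 v e z) + perp2 v e z"
  by (simp add: perp2_def)

lemma lift2_plus_perp_eq_0:
  assumes "onpair v e" "coord2 v e y = 0" "lift2 v e w + y = 0"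
  shows "w = 0" "y = 0"
proof -
  have "w = coord2 v e (lift2 v e w + y)" using assms(1,2) by (simp add: coord2_add coord2_lift2)
  also have "\<dots> = 0" unfolding assms(3) by (simp add: coord2_def complex_eq_iff)
  finally show "w = 0" .
  then show "y = 0" using assms(3) by (simp add: lift2_def)
qed

lemma norm_lift2: "onpair v e \<Longrightarrow> norm (lift2 v e w) = norm w"
proof -
  assume o: "onpair v e"
  have "(norm (lift2 v e w))\<^sup>2 = (norm w)\<^sup>2"
  proof -
    have "v \<bullet> v = 1" "e \<bullet> e = 1" "v \<bullet> e = 0" "e \<bullet> v = 0"
      using o by (simp_all add: onpair_def dot_square_norm inner_commute)
    then have "lift2 v e w \<bullet> lift2 v e w = (Re w)\<^sup>2 + (Im w)\<^sup>2"
      by (simp add: lift2_def inner_add_left inner_add_right power2_eq_square)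
    then show ?thesis by (simp only: power2_norm_eq_inner[of "lift2 v e w"] cmod_power2)
  qed
  then show ?thesis by simp
qed

lemma bubble_active:
  assumes o: "onpair v e" and \<delta>: "\<delta> > 0" and nz: "bubble \<delta> v e a z \<noteq> 0"
  shows "z \<bullet> v > 0" "norm (z - (z \<bullet> v) *\<^sub>R v) < 2 * \<delta>"
proof -
  show "z \<bullet> v > 0" using nz by (auto simp: bubble_def cutoff_def)
  have p: "norm (perp2 v e z) < \<delta>"
  proof (rule ccontr)
    assume "\<not> ?thesis"
    then have "1 - norm (perp2 v e z) / \<delta> \<le> 0" using \<delta> by (simp add: field_simps)
    then show False using nz by (simp add: bubble_def)
  qed
  have w: "\<bar>z \<bullet> e\<bar> < \<delta>"
  proof (rule ccontr)
    assume "\<not> ?thesis"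
    then have "1 \<le> \<bar>(z \<bullet> e) / \<delta>\<bar>" using \<delta> by (simp add: field_simps)
    then show False using nz loopfun_outside by (simp add: bubble_def lift2_def)
  qed
  have "z - (z \<bullet> v) *\<^sub>R v = (z \<bullet> e) *\<^sub>R e + perp2 v e z"
    by (simp add: perp2_def lift2_def coord2_def)
  then have "norm (z - (z \<bullet> v) *\<^sub>R v) \<le> \<bar>z \<bullet> e\<bar> + norm (perp2 v e z)"
    using norm_triangle_ineq[of "(z \<bullet> e) *\<^sub>R e" "perp2 v e z"] o by (simp add: onpair_def)
  then show "norm (z - (z \<bullet> v) *\<^sub>R v) < 2 * \<delta>" using p w by linarith
qed

lemma near_axis_direction:
  assumes v: "norm v = 1" and s: "s > 0" and d: "norm (z - s *\<^sub>R v) < 2 * \<delta>" and z: "norm z \<ge> 1"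
  shows "norm (sgn z - v) < 4 * \<delta>"
proof -
  have "\<bar>norm z - s\<bar> \<le> norm (z - s *\<^sub>R v)"
    using norm_triangle_ineq3[of z "s *\<^sub>R v"] v s by simp
  moreover have "norm (z - norm z *\<^sub>R v) \<le> norm (z - s *\<^sub>R v) + norm ((s - norm z) *\<^sub>R v)"
    using norm_triangle_ineq[of "z - s *\<^sub>R v" "(s - norm z) *\<^sub>R v"] by (simp add: algebra_simps)
  ultimately have lt: "norm (z - norm z *\<^sub>R v) < 4 * \<delta>" using d v by simp
  have "sgn z - v = inverse (norm z) *\<^sub>R (z - norm z *\<^sub>R v)"
  proof -
    have "norm z \<noteq> 0" using z by linarith
    then show ?thesis by (simp add: sgn_div_norm scaleR_diff_right)
  qed
  then have "norm (sgn z - v) = inverse (norm z) * norm (z - norm z *\<^sub>R v)" using z by simp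
  also have "\<dots> \<le> 1 * norm (z - norm z *\<^sub>R v)" using z by (intro mult_right_mono) (auto simp: inverse_le_1_iff)
  finally show ?thesis using lt by simp
qed

text \<open>Both axes lie within \<open>4 * \<delta>\<close> of the direction of \<open>z\<close>.
  Hence axes that are \<open>8 * \<delta>\<close> apart never have bubbles active at the same point
  outside the open unit ball.\<close>

lemma bubble_disjoint:
  assumes o: "onpair v e" "onpair v' e'" and \<delta>: "\<delta> > 0" and nz: "bubble \<delta> v e a z \<noteq> 0" "bubble \<delta> v' e' a' z \<noteq> 0"
    and z: "norm z \<ge> 1"
  shows "norm (v - v') < 8 * \<delta>"
proof -
  have "norm (sgn z - v) < 4 * \<delta>" "norm (sgn z - v') < 4 * \<delta>"
    using near_axis_direction[OF _ bubble_active[OF o(1) \<delta> nz(1)] z] near_axis_direction[OF _ bubble_active[OF o(2) \<delta> nz(2)] z] o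
    by (simp_all add: onpair_def)
  moreover have "norm (v - v') \<le> norm (sgn z - v') + norm (sgn z - v)"
    using norm_triangle_ineq4[of "sgn z - v'" "sgn z - v"] by (simp add: algebra_simps)
  ultimately show ?thesis by linarith
qed

text \<open>A bubble does not change the component orthogonal to its plane, so this component is 0
  at a zero. Then the bubble has full strength and multiplies the planar coordinate by the nonzero
  factor \<open>P\<close>.\<close>

lemma bubble_single_nonzero:
  assumes o: "onpair v e" and \<delta>: "\<delta> > 0" "\<delta> \<le> 1/8" and z: "norm z \<ge> 1"
  shows "z + bubble \<delta> v e a z \<noteq> 0"
proof
  assume 0: "z + bubble \<delta> v e a z = 0"
  then have nz: "bubble \<delta> v e a z \<noteq> 0" using z by auto
  define k where "k = max 0 (1 - norm (perp2 v e z) / \<delta>) * cutoff (z \<bullet> v)"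
  define P where "P = cpow (loopfun ((z \<bullet> e) / \<delta>)) a"
  have b: "bubble \<delta> v e a z = lift2 v e (of_real k * ((P - 1) * coord2 v e z))"
    unfolding lift2_scaleR by (simp add: bubble_def k_def P_def)
  have "lift2 v e (coord2 v e z + of_real k * ((P - 1) * coord2 v e z)) + perp2 v e z = 0"
  proof -
    have "lift2 v e (coord2 v e z + of_real k * ((P - 1) * coord2 v e z)) + perp2 v e z
        = (lift2 v e (coord2 v e z) + perp2 v e z) + bubble \<delta> v e a z"
      unfolding b lift2_add by (simp only: ac_simps)
    then show ?thesis using 0 split2[of z v e] by simp
  qed
  from lift2_plus_perp_eq_0[OF o coord2_perp2[OF o] this]
  have c: "coord2 v e z + of_real k * ((P - 1) * coord2 v e z) = 0" and p: "perp2 v e z = 0" by auto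
  have "norm z \<le> z \<bullet> v + norm (z - (z \<bullet> v) *\<^sub>R v)"
    using norm_triangle_ineq[of "(z \<bullet> v) *\<^sub>R v" "z - (z \<bullet> v) *\<^sub>R v"] bubble_active(1)[OF o \<delta>(1) nz] o
    by (simp add: onpair_def)
  then have "z \<bullet> v \<ge> 1/2" using bubble_active(2)[OF o \<delta>(1) nz] z \<delta> by linarith
  then have "k = 1" using p by (simp add: k_def cutoff_def)
  then have "P * coord2 v e z = 0" using c by (simp add: algebra_simps)
  moreover have "P \<noteq> 0" by (simp add: P_def cpow_nonzero loopfun_nonzero)
  ultimately have "coord2 v e z = 0" by simp
  then have "z = 0" using split2[of z v e] p by (simp add: lift2_def)
  then show False using z by simp
qed

lemma sum_bubbles_nonzero:
  assumes J: "finite J" and o: "\<And>i. i \<in> J \<Longrightarrow> onpair (v i) (e i)" and \<delta>: "\<delta> > 0" "\<delta> \<le> 1/8"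
    and sep: "\<And>i k. i \<in> J \<Longrightarrow> k \<in> J \<Longrightarrow> i \<noteq> k \<Longrightarrow> 8 * \<delta> \<le> norm (v i - v k)" and z: "norm z \<ge> 1"
  shows "z + (\<Sum>i\<in>J. bubble \<delta> (v i) (e i) (a i) z) \<noteq> 0"
proof (cases "\<exists>i\<in>J. bubble \<delta> (v i) (e i) (a i) z \<noteq> 0")
  case True
  then obtain i where i: "i \<in> J" "bubble \<delta> (v i) (e i) (a i) z \<noteq> 0" by blast
  have "bubble \<delta> (v k) (e k) (a k) z = 0" if "k \<in> J - {i}" for k
    using bubble_disjoint[OF o[OF i(1)] o[of k] \<delta>(1) i(2) _ z] sep[OF i(1), of k] that by force
  then have "(\<Sum>i\<in>J. bubble \<delta> (v i) (e i) (a i) z) = bubble \<delta> (v i) (e i) (a i) z"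
    using J i by (subst sum.remove[OF J i(1)]) (simp add: sum.neutral)
  then show ?thesis using bubble_single_nonzero[OF o[OF i(1)] \<delta> z] by simp
next
  case False
  then have "(\<Sum>i\<in>J. bubble \<delta> (v i) (e i) (a i) z) = 0" by (simp add: sum.neutral)
  then show ?thesis using z by auto
qed

section \<open>The degree of bubbles in a common plane\<close>

lemma homotopicI:
  assumes "continuous_on ({0..1::real} \<times> S) h" "\<And>t x. t \<in> {0..1} \<Longrightarrow> x \<in> S \<Longrightarrow> h (t, x) \<in> T"
  shows "homotopic_with_canon (\<lambda>_. True) S T (\<lambda>x. h (0, x)) (\<lambda>x. h (1, x))"
  unfolding homotopic_with_def using assms
  by (intro exI[of _ h]) auto

lemma homotopicD:
  assumes "homotopic_with_canon (\<lambda>_. True) S T f g"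
  obtains h where "continuous_on ({0..1::real} \<times> S) h" "\<And>t x. t \<in> {0..1} \<Longrightarrow> x \<in> S \<Longrightarrow> h (t, x) \<in> T"
    "\<And>x. h (0, x) = f x" "\<And>x. h (1, x) = g x"
  using assms unfolding homotopic_with_def by (force simp: Pi_iff)

text \<open>Linear homotopy of maps on the unit circle. At \<open>s = 0\<close> it is the factor by
  which a bubble of degree 1 at \<open>\<kappa>\<close> multiplies the planar coordinate; at
  \<open>s = 1\<close> it is the rotation \<open>- \<zeta> * cnj \<kappa>\<close>, of visible
  winding number 1.\<close>

definition twist :: "real \<Rightarrow> complex \<Rightarrow> real \<Rightarrow> complex \<Rightarrow> complex" where
  "twist \<delta> \<kappa> s \<zeta> = of_real (1 - s) * (1 + of_real (cutoff (Re (\<zeta> * cnj \<kappa>))) * (loopfun (Im (\<zeta> * cnj \<kappa>) / \<delta>) - 1))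
     - of_real s * (\<zeta> * cnj \<kappa>)"

lemma continuous_on_twist [continuous_intros]:
  assumes "\<delta> > 0" "continuous_on S s" "continuous_on S f"
  shows "continuous_on S (\<lambda>x. twist \<delta> \<kappa> (s x) (f x))"
  using assms unfolding twist_def by (intro continuous_intros) auto

lemma cutoff_unit_circle:
  assumes "norm w = 1" "\<delta> > 0" "\<delta> \<le> 1/8" "\<bar>Im w\<bar> < \<delta>"
  shows "cutoff (Re w) = 0 \<or> cutoff (Re w) = 1"
proof -
  have "(Re w)\<^sup>2 + (Im w)\<^sup>2 = 1" using assms(1) by (metis cmod_power2 power_one)
  moreover have "(Im w)\<^sup>2 \<le> (1/8)\<^sup>2" using assms by (intro power2_le_iff_abs_le[THEN iffD2]) auto
  ultimately have "(1/2)\<^sup>2 \<le> (Re w)\<^sup>2" by (simp add: power2_eq_square)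
  then have "1/2 \<le> \<bar>Re w\<bar>" by (metis abs_ge_zero abs_numeral abs_one abs_divide abs_le_square_iff power2_abs)
  then show ?thesis by (auto simp: cutoff_def)
qed

text \<open>Where the loop is away from its base point, the real part on the unit circle is at least
  1/2 in absolute value, so the cutoff is 0 or 1. Therefore cutting off commutes with taking
  powers.\<close>

lemma twist_0_unit:
  assumes w: "norm (\<zeta> * cnj \<kappa>) = 1" and \<delta>: "\<delta> > 0" "\<delta> \<le> 1/8"
  shows "twist \<delta> \<kappa> 0 \<zeta> = 1 \<or> twist \<delta> \<kappa> 0 \<zeta> = loopfun (Im (\<zeta> * cnj \<kappa>) / \<delta>)"
    and "cpow (twist \<delta> \<kappa> 0 \<zeta>) a - 1 = of_real (cutoff (Re (\<zeta> * cnj \<kappa>))) * (cpow (loopfun (Im (\<zeta> * cnj \<kappa>) / \<delta>)) a - 1)"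
proof -
  let ?w = "\<zeta> * cnj \<kappa>"
  have "loopfun (Im ?w / \<delta>) = 1 \<or> cutoff (Re ?w) = 0 \<or> cutoff (Re ?w) = 1"
  proof (cases "\<bar>Im ?w\<bar> < \<delta>")
    case True
    then show ?thesis using cutoff_unit_circle[OF w \<delta>] by blast
  next
    case False
    then have "1 \<le> \<bar>Im ?w / \<delta>\<bar>" using \<delta> by (simp add: field_simps)
    then show ?thesis using loopfun_outside by blast
  qed
  then show "twist \<delta> \<kappa> 0 \<zeta> = 1 \<or> twist \<delta> \<kappa> 0 \<zeta> = loopfun (Im ?w / \<delta>)"
    "cpow (twist \<delta> \<kappa> 0 \<zeta>) a - 1 = of_real (cutoff (Re ?w)) * (cpow (loopfun (Im ?w / \<delta>)) a - 1)"
    by (auto simp: twist_def)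
qed

text \<open>Let \<open>w\<close> be \<open>\<zeta> * cnj \<kappa>\<close>. The imaginary part of the
  loop never has the sign of \<open>Im w\<close>, and that of \<open>- w\<close> has the opposite
  sign; so for \<open>s > 0\<close> a zero needs \<open>Im w = 0\<close>. There the value is -1 at
  \<open>w = 1\<close> and 1 at \<open>w = -1\<close>, for all \<open>s\<close>.\<close>

lemma twist_nonzero:
  assumes w: "norm (\<zeta> * cnj \<kappa>) = 1" and \<delta>: "\<delta> > 0" "\<delta> \<le> 1/8" and s: "s \<in> {0..1}"
  shows "twist \<delta> \<kappa> s \<zeta> \<noteq> 0"
proof (cases "s = 0")
  case True
  then show ?thesis using twist_0_unit(1)[OF w \<delta>] loopfun_nonzero by (metis zero_neq_one)
next
  case False
  define w where "w = \<zeta> * cnj \<kappa>"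
  have s0: "0 < s" "s \<le> 1" using s False by auto
  define c where "c = cutoff (Re w)"
  have c: "0 \<le> c" by (simp add: c_def cutoff_def)
  have tw: "twist \<delta> \<kappa> s \<zeta> = of_real (1 - s) * (1 + of_real c * (loopfun (Im w / \<delta>) - 1)) - of_real s * w"
    by (simp add: twist_def w_def c_def)
  have im: "Im (twist \<delta> \<kappa> s \<zeta>) = - ((1 - s) * c * ((Im w / \<delta>) * max 0 (1 - \<bar>Im w / \<delta>\<bar>))) - s * Im w"
    unfolding tw by (simp add: Im_loopfun)
  show ?thesis
  proof (cases "Im w = 0")
    case True
    have nw: "\<bar>Re w\<bar> = 1" using assms(1) True by (simp add: w_def[symmetric] cmod_eq_Re)
    have "Re (twist \<delta> \<kappa> s \<zeta>) = (1 - s) * (1 - 2 * c) - s * Re w"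
      unfolding tw using True by (simp add: loopfun_0)
    moreover have "Re w = 1 \<and> c = 1 \<or> Re w = -1 \<and> c = 0" using nw by (auto simp: c_def cutoff_def abs_if split: if_splits)
    ultimately have "Re (twist \<delta> \<kappa> s \<zeta>) \<noteq> 0" by (auto simp: algebra_simps)
    then show ?thesis by auto
  next
    case False
    have "0 \<le> (1 - s) * c * max 0 (1 - \<bar>Im w / \<delta>\<bar>) / \<delta>" using s0 c \<delta> by (intro divide_nonneg_pos mult_nonneg_nonneg) auto
    moreover have "Im (twist \<delta> \<kappa> s \<zeta>) = - ((1 - s) * c * max 0 (1 - \<bar>Im w / \<delta>\<bar>) / \<delta> + s) * Im w"
      unfolding im by (simp add: field_simps)
    ultimately have "Im (twist \<delta> \<kappa> s \<zeta>) \<noteq> 0" using s0 False by auto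
    then show ?thesis by auto
  qed
qed

text \<open>The sign \<open>\<epsilon>\<close> is the orientation of the pair in the plane.
  Reversing \<open>e\<close> conjugates the coordinate and the loop together, so the bubble, and
  with it the sign of its degree, does not depend on \<open>\<epsilon>\<close>.\<close>

lemma bubble_in_plane:
  assumes \<kappa>: "norm \<kappa> = 1" and \<epsilon>: "\<epsilon> = 1 \<or> \<epsilon> = -1"
    and v: "v = lift2 E1 E2 \<kappa>" and e: "e = lift2 E1 E2 (of_real \<epsilon> * \<i> * \<kappa>)"
  shows "bubble \<delta> v e a z = (max 0 (1 - norm (perp2 E1 E2 z) / \<delta>) * cutoff (Re (coord2 E1 E2 z * cnj \<kappa>))) *\<^sub>R
     lift2 E1 E2 ((cpow (loopfun (Im (coord2 E1 E2 z * cnj \<kappa>) / \<delta>)) a - 1) * coord2 E1 E2 z)"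
proof -
  define \<zeta> where "\<zeta> = coord2 E1 E2 z"
  define w where "w = \<zeta> * cnj \<kappa>"
  have \<kappa>\<kappa>: "\<kappa> * cnj \<kappa> = 1" using \<kappa> by (simp add: complex_norm_square[symmetric])
  have ip: "z \<bullet> lift2 E1 E2 x = Re (\<zeta> * cnj x)" for x
    by (simp add: \<zeta>_def coord2_def lift2_def inner_add_right algebra_simps)
  have zv: "z \<bullet> v = Re w" by (simp add: v ip w_def)
  have ze: "z \<bullet> e = \<epsilon> * Im w" unfolding e ip w_def by (simp add: algebra_simps)
  have co: "coord2 v e z = (if \<epsilon> = 1 then w else cnj w)"
    using \<epsilon> by (auto simp: coord2_def zv ze complex_eq_iff)
  have li: "lift2 v e x = lift2 E1 E2 (\<kappa> * (if \<epsilon> = 1 then x else cnj x))" for x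
    using \<epsilon> unfolding v e lift2_def by (auto simp: algebra_simps scaleR_add_left scaleR_diff_left)
  have kw: "\<kappa> * w = \<zeta>" unfolding w_def using \<kappa>\<kappa> by (metis mult.commute mult.left_commute mult_1)
  have pe: "perp2 v e z = perp2 E1 E2 z"
    using \<epsilon> kw by (auto simp: perp2_def li co \<zeta>_def)
  have "lift2 v e ((cpow (loopfun ((z \<bullet> e) / \<delta>)) a - 1) * coord2 v e z) = lift2 E1 E2 ((cpow (loopfun (Im w / \<delta>)) a - 1) * \<zeta>)"
  proof (cases "\<epsilon> = 1")
    case True
    then show ?thesis unfolding li co ze by (simp add: mult.left_commute[of \<kappa>] kw)
  next
    case False
    then have "\<epsilon> = -1" using \<epsilon> by simp
    then show ?thesis unfolding li co ze by (simp add: loopfun_minus cpow_cnj mult.left_commute[of \<kappa>] kw)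
  qed
  then show ?thesis unfolding bubble_def pe zv w_def \<zeta>_def by simp
qed

lemma prod_one_plus_single:
  fixes q :: "'i \<Rightarrow> complex"
  assumes "finite J" "\<And>i k. i \<in> J \<Longrightarrow> k \<in> J \<Longrightarrow> i \<noteq> k \<Longrightarrow> q i = 0 \<or> q k = 0"
  shows "(\<Prod>i\<in>J. 1 + q i) = 1 + (\<Sum>i\<in>J. q i)"
proof (cases "\<exists>i\<in>J. q i \<noteq> 0")
  case True
  then obtain i where i: "i \<in> J" "q i \<noteq> 0" by blast
  then have "q k = 0" if "k \<in> J - {i}" for k using assms(2)[OF i(1), of k] that by auto
  then show ?thesis using assms(1) i(1) by (simp add: prod.remove[of J i] sum.remove[of J i])
next
  case False then show ?thesis by simp
qed

text \<open>In the plane at most one bubble is active at a unit vector, so one plus the sum of the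
  bubble factors is a product of powers of twists. Deforming the twists to rotations leaves
  \<open>\<zeta>\<close> to the power \<open>1 + (\<Sum>i\<in>J. a i) = 0\<close>, a constant.
  Points off the plane are harmless, as their orthogonal component is kept until the last
  step.\<close>

lemma planar_bubbles_nullhomotopic:
  fixes E1 E2 :: "'a::real_inner"
  assumes E: "onpair E1 E2" and J: "finite J" and \<delta>: "\<delta> > 0" "\<delta> \<le> 1/8" and W: "subspace W" "E1 \<in> W" "E2 \<in> W"
    and \<kappa>: "\<And>i. i \<in> J \<Longrightarrow> norm (\<kappa> i) = 1" and \<epsilon>: "\<And>i. i \<in> J \<Longrightarrow> \<epsilon> i = 1 \<or> \<epsilon> i = (-1::real)"
    and v: "\<And>i. i \<in> J \<Longrightarrow> v i = lift2 E1 E2 (\<kappa> i)"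
    and e: "\<And>i. i \<in> J \<Longrightarrow> e i = lift2 E1 E2 (of_real (\<epsilon> i) * \<i> * \<kappa> i)"
    and o: "\<And>i. i \<in> J \<Longrightarrow> onpair (v i) (e i)"
    and sep: "\<And>i k. i \<in> J \<Longrightarrow> k \<in> J \<Longrightarrow> i \<noteq> k \<Longrightarrow> 8 * \<delta> \<le> norm (v i - v k)"
    and deg: "(\<Sum>i\<in>J. a i) = -1"
  shows "\<exists>c. homotopic_with_canon (\<lambda>_. True) (W \<inter> sphere 0 1) (W - {0}) (\<lambda>z. z + (\<Sum>i\<in>J. bubble \<delta> (v i) (e i) (a i) z)) (\<lambda>_. c)"
proof -
  let ?S = "W \<inter> sphere 0 1" and ?L = "lift2 E1 E2" and ?y = "perp2 E1 E2"
  let ?\<zeta> = "coord2 E1 E2"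
  have LW: "?L x \<in> W" for x unfolding lift2_def using W by (intro subspace_add subspace_mul)
  have yW: "?y z \<in> W" if "z \<in> W" for z unfolding perp2_def using that W LW by (intro subspace_diff)
  have unit: "norm (?\<zeta> z) = 1" if "?y z = 0" "z \<in> ?S" for z
    using split2[of z E1 E2] that norm_lift2[OF E, of "?\<zeta> z"] by simp
  have nz: "?L F + ?y z \<in> W - {0}" if "z \<in> ?S" "?y z = 0 \<Longrightarrow> F \<noteq> 0" for F z
    using lift2_plus_perp_eq_0[OF E coord2_perp2[OF E], of F z] that LW yW W(1) by (auto intro: subspace_add)
  define Q where "Q s \<zeta> = \<zeta> * (\<Prod>i\<in>J. cpow (twist \<delta> (\<kappa> i) s \<zeta>) (a i))" for s \<zeta>
  define k where "k i z = max 0 (1 - norm (?y z) / \<delta>) * cutoff (Re (?\<zeta> z * cnj (\<kappa> i)))" for i z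
  define q where "q i z = of_real (k i z) * (cpow (loopfun (Im (?\<zeta> z * cnj (\<kappa> i)) / \<delta>)) (a i) - 1)" for i z
  define h where "h z = z + (\<Sum>i\<in>J. bubble \<delta> (v i) (e i) (a i) z)" for z
  have bq: "bubble \<delta> (v i) (e i) (a i) z = ?L (q i z * ?\<zeta> z)" if "i \<in> J" for i z
    unfolding bubble_in_plane[OF \<kappa>[OF that] \<epsilon>[OF that] v[OF that] e[OF that]] q_def k_def mult.assoc lift2_scaleR ..
  have Lsum: "?L (\<Sum>i\<in>J. g i) = (\<Sum>i\<in>J. ?L (g i))" for g
    using J by (induction J rule: finite_induct) (simp_all add: lift2_add, simp add: lift2_def)
  have h_eq: "h z = ?L (?\<zeta> z * (1 + (\<Sum>i\<in>J. q i z))) + ?y z" for z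
  proof -
    have "h z = z + ?L (\<Sum>i\<in>J. q i z * ?\<zeta> z)" unfolding h_def Lsum using bq by simp
    also have "\<dots> = (?L (?\<zeta> z) + ?y z) + ?L (\<Sum>i\<in>J. q i z * ?\<zeta> z)" using split2[of z E1 E2] by simp
    also have "\<dots> = ?L (?\<zeta> z + (\<Sum>i\<in>J. q i z * ?\<zeta> z)) + ?y z" unfolding lift2_add by (simp only: ac_simps)
    also have "?\<zeta> z + (\<Sum>i\<in>J. q i z * ?\<zeta> z) = ?\<zeta> z * (1 + (\<Sum>i\<in>J. q i z))"
      by (simp add: distrib_left sum_distrib_left mult.commute)
    finally show ?thesis .
  qed
  have Q0: "?L (Q 0 (?\<zeta> z)) + ?y z = h z" if z: "z \<in> ?S" and y0: "?y z = 0" for z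
  proof -
    have n1: "norm (?\<zeta> z * cnj (\<kappa> i)) = 1" if "i \<in> J" for i using unit[OF y0 z] \<kappa>[OF that] by (simp add: norm_mult)
    have "cpow (twist \<delta> (\<kappa> i) 0 (?\<zeta> z)) (a i) = 1 + q i z" if "i \<in> J" for i
      using twist_0_unit(2)[OF n1[OF that] \<delta>, of "a i"] y0 by (simp add: q_def k_def algebra_simps)
    then have "(\<Prod>i\<in>J. cpow (twist \<delta> (\<kappa> i) 0 (?\<zeta> z)) (a i)) = (\<Prod>i\<in>J. 1 + q i z)" by simp
    also have "\<dots> = 1 + (\<Sum>i\<in>J. q i z)"
    proof (rule prod_one_plus_single[OF J])
      fix i l assume il: "i \<in> J" "l \<in> J" "i \<noteq> l"
      show "q i z = 0 \<or> q l z = 0"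
      proof (rule ccontr)
        assume "\<not> ?thesis"
        then have "q i z * ?\<zeta> z \<noteq> 0" "q l z * ?\<zeta> z \<noteq> 0" using unit[OF y0 z] by auto
        then have "bubble \<delta> (v i) (e i) (a i) z \<noteq> 0" "bubble \<delta> (v l) (e l) (a l) z \<noteq> 0"
          unfolding bq[OF il(1)] bq[OF il(2)] by (metis norm_lift2[OF E] norm_eq_zero)+
        then have "norm (v i - v l) < 8 * \<delta>" using bubble_disjoint[OF o[OF il(1)] o[OF il(2)] \<delta>(1)] z by simp
        then show False using sep[OF il] by simp
      qed
    qed
    finally show ?thesis unfolding h_eq Q_def by simp
  qed
  have hnz: "h z \<in> W - {0}" if "z \<in> ?S" for z
  proof -
    have "h z \<noteq> 0" unfolding h_def using that by (intro sum_bubbles_nonzero[OF J o \<delta> sep]) auto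
    moreover have "h z \<in> W" unfolding h_eq using LW yW that W(1) by (auto intro: subspace_add)
    ultimately show ?thesis by simp
  qed
  have conth: "continuous_on ?S h" unfolding h_def using \<delta> by (intro continuous_intros)
  have contQ: "continuous_on T (\<lambda>x. Q (s x) (f x))" if "continuous_on T s" "continuous_on T f" for T :: "'a set" and s f
    unfolding Q_def using \<delta>(1) that by (intro continuous_intros)
  have contQ': "continuous_on T (\<lambda>x. Q (s x) (f x))" if "continuous_on T s" "continuous_on T f" for T :: "(real \<times> 'a) set" and s f
    unfolding Q_def using \<delta>(1) that by (intro continuous_intros)
  \<comment> \<open>Only the planar component is deformed, and both maps agree where the orthogonal
    component vanishes.\<close>
  have step1: "homotopic_with_canon (\<lambda>_. True) ?S (W - {0}) h (\<lambda>z. ?L (Q 0 (?\<zeta> z)) + ?y z)"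
  proof (rule homotopic_with_linear[OF conth])
    show "continuous_on ?S (\<lambda>z. ?L (Q 0 (?\<zeta> z)) + ?y z)" by (intro continuous_intros contQ)
    fix z assume z: "z \<in> ?S"
    show "closed_segment (h z) (?L (Q 0 (?\<zeta> z)) + ?y z) \<subseteq> W - {0}"
    proof (cases "?y z = 0")
      case True
      then show ?thesis using Q0[OF z True] hnz[OF z] by simp
    next
      case False
      show ?thesis
      proof
        fix x assume "x \<in> closed_segment (h z) (?L (Q 0 (?\<zeta> z)) + ?y z)"
        then obtain t where t: "x = (1 - t) *\<^sub>R h z + t *\<^sub>R (?L (Q 0 (?\<zeta> z)) + ?y z)" by (auto simp: closed_segment_def)
        have "x = ?L (of_real (1 - t) * (?\<zeta> z * (1 + (\<Sum>i\<in>J. q i z))) + of_real t * Q 0 (?\<zeta> z)) + ?y z"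
          unfolding t h_eq lift2_add lift2_scaleR by (simp add: algebra_simps)
        then show "x \<in> W - {0}" using nz[OF z] False by simp
      qed
    qed
  qed
  have step2: "homotopic_with_canon (\<lambda>_. True) ?S (W - {0}) (\<lambda>z. ?L (Q 0 (?\<zeta> z)) + ?y z) (\<lambda>z. ?L (Q 1 (?\<zeta> z)) + ?y z)"
  proof -
    have "homotopic_with_canon (\<lambda>_. True) ?S (W - {0}) (\<lambda>z. (\<lambda>(s, z). ?L (Q s (?\<zeta> z)) + ?y z) (0, z)) (\<lambda>z. (\<lambda>(s, z). ?L (Q s (?\<zeta> z)) + ?y z) (1, z))"
    proof (rule homotopicI)
      show "continuous_on ({0..1} \<times> ?S) (\<lambda>(s, z). ?L (Q s (?\<zeta> z)) + ?y z)"
        unfolding case_prod_unfold by (intro continuous_intros contQ')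
      fix s :: real and z assume s: "s \<in> {0..1}" and z: "z \<in> ?S"
      have "Q s (?\<zeta> z) \<noteq> 0" if "?y z = 0"
      proof -
        have "norm (?\<zeta> z * cnj (\<kappa> i)) = 1" if "i \<in> J" for i using unit[OF \<open>?y z = 0\<close> z] \<kappa>[OF that] by (simp add: norm_mult)
        then have "cpow (twist \<delta> (\<kappa> i) s (?\<zeta> z)) (a i) \<noteq> 0" if "i \<in> J" for i
          using twist_nonzero[OF _ \<delta> s] that by (intro cpow_nonzero) blast
        moreover have "?\<zeta> z \<noteq> 0" using unit[OF that z] by auto
        ultimately show ?thesis using J by (simp add: Q_def)
      qed
      then show "(\<lambda>(s, z). ?L (Q s (?\<zeta> z)) + ?y z) (s, z) \<in> W - {0}" using nz[OF z] by simp
    qed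
    then show ?thesis by simp
  qed
  define c where "c = (\<Prod>i\<in>J. (- cnj (\<kappa> i)) powi (a i))"
  have Q1: "Q 1 (?\<zeta> z) = c" if "?y z = 0" "z \<in> ?S" for z
  proof -
    have u: "norm (?\<zeta> z) = 1" by (rule unit[OF that])
    then have "?\<zeta> z \<noteq> 0" by auto
    have "cpow (twist \<delta> (\<kappa> i) 1 (?\<zeta> z)) (a i) = ?\<zeta> z powi (a i) * (- cnj (\<kappa> i)) powi (a i)" if "i \<in> J" for i
    proof -
      have "twist \<delta> (\<kappa> i) 1 (?\<zeta> z) = ?\<zeta> z * (- cnj (\<kappa> i))" by (simp add: twist_def)
      moreover have "norm (?\<zeta> z * (- cnj (\<kappa> i))) = 1" using u \<kappa>[OF that] by (simp add: norm_mult)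
      ultimately show ?thesis by (simp only: cpow_unit power_int_mult_distrib)
    qed
    then have "(\<Prod>i\<in>J. cpow (twist \<delta> (\<kappa> i) 1 (?\<zeta> z)) (a i)) = (\<Prod>i\<in>J. ?\<zeta> z powi (a i)) * c"
      by (simp add: c_def prod.distrib)
    also have "(\<Prod>i\<in>J. ?\<zeta> z powi (a i)) = ?\<zeta> z powi (\<Sum>i\<in>J. a i)"
      using J \<open>?\<zeta> z \<noteq> 0\<close> by (induction J rule: finite_induct) (simp_all add: power_int_add)
    finally show ?thesis using \<open>?\<zeta> z \<noteq> 0\<close> by (simp add: Q_def deg)
  qed
  have "\<kappa> i \<noteq> 0" if "i \<in> J" for i using \<kappa>[OF that] by auto
  then have c0: "c \<noteq> 0" unfolding c_def using J by (auto simp: power_int_eq_0_iff)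
  \<comment> \<open>Where the orthogonal component is 0, the planar one already equals
    \<open>c\<close>; elsewhere the orthogonal component stays nonzero until the end of the segment,
    which is \<open>?L c\<close>.\<close>
  have step3: "homotopic_with_canon (\<lambda>_. True) ?S (W - {0}) (\<lambda>z. ?L (Q 1 (?\<zeta> z)) + ?y z) (\<lambda>_. ?L c)"
  proof (rule homotopic_with_linear)
    show "continuous_on ?S (\<lambda>z. ?L (Q 1 (?\<zeta> z)) + ?y z)" by (intro continuous_intros contQ)
    fix z assume z: "z \<in> ?S"
    show "closed_segment (?L (Q 1 (?\<zeta> z)) + ?y z) (?L c) \<subseteq> W - {0}"
    proof
      fix x assume "x \<in> closed_segment (?L (Q 1 (?\<zeta> z)) + ?y z) (?L c)"
      then obtain t where t: "x = (1 - t) *\<^sub>R (?L (Q 1 (?\<zeta> z)) + ?y z) + t *\<^sub>R ?L c" by (auto simp: closed_segment_def)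
      define F where "F = of_real (1 - t) * Q 1 (?\<zeta> z) + of_real t * c"
      have x: "x = ?L F + (1 - t) *\<^sub>R ?y z"
        unfolding t F_def lift2_add lift2_scaleR by (simp add: algebra_simps)
      have "x \<noteq> 0"
      proof
        assume "x = 0"
        have "coord2 E1 E2 ((1 - t) *\<^sub>R ?y z) = 0" using coord2_perp2[OF E, of z]
          by (simp add: coord2_def complex_eq_iff)
        from lift2_plus_perp_eq_0[OF E this, of F] have "F = 0" "(1 - t) *\<^sub>R ?y z = 0" using x \<open>x = 0\<close> by simp_all
        then have "t = 1 \<or> ?y z = 0" by simp
        then have "F = c" using Q1[OF _ z] by (auto simp: F_def algebra_simps)
        then show False using \<open>F = 0\<close> c0 by simp
      qed
      moreover have "x \<in> W" unfolding x using LW yW z W(1) by (auto intro: subspace_add subspace_mul)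
      ultimately show "x \<in> W - {0}" by simp
    qed
  qed simp
  show ?thesis using homotopic_with_trans[OF homotopic_with_trans[OF step1 step2] step3] unfolding h_def by blast
qed

text \<open>The ball is filled along its radii: the homotopy runs while the norm falls from 1 to
  1/2, and the constant fills the inner ball. The margin keeps the discontinuity of
  \<open>sgn\<close> at 0 away.\<close>

lemma extend_over_cone:
  fixes S W :: "'a::real_normed_vector set"
  assumes W: "subspace W" and hom: "homotopic_with_canon (\<lambda>_. True) (W \<inter> sphere 0 1) T f (\<lambda>_. c)"
    and f: "continuous_on {z \<in> W. norm z \<ge> 1} f" "\<And>z. z \<in> W \<Longrightarrow> norm z \<ge> 1 \<Longrightarrow> f z \<in> T" and c: "c \<in> T"
  shows "\<exists>G. continuous_on W G \<and> (\<forall>z\<in>W. G z \<in> T) \<and> (\<forall>z\<in>W. norm z \<ge> 1 \<longrightarrow> G z = f z)"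
proof -
  obtain k where k: "continuous_on ({0..1::real} \<times> (W \<inter> sphere 0 1)) k"
    "\<And>t x. t \<in> {0..1} \<Longrightarrow> x \<in> W \<inter> sphere 0 1 \<Longrightarrow> k (t, x) \<in> T" "\<And>x. k (0, x) = f x" "\<And>x. k (1, x) = c"
    using homotopicD[OF hom] by blast
  have sg: "sgn z \<in> W \<inter> sphere 0 1" if "z \<in> W" "z \<noteq> 0" for z
    using that W by (simp add: sgn_div_norm subspace_mul)
  define g where "g z = (if norm z \<le> 1/2 then c else k (2 * (1 - norm z), sgn z))" for z
  define G where "G z = (if norm z \<ge> 1 then f z else g z)" for z
  have "continuous_on ((W \<inter> cball 0 (1/2)) \<union> {z \<in> W. 1/2 \<le> norm z \<and> norm z \<le> 1}) g"
    unfolding g_def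
  proof (rule continuous_on_cases_local)
    show "closedin (top_of_set (W \<inter> cball 0 (1/2) \<union> {z \<in> W. 1/2 \<le> norm z \<and> norm z \<le> 1})) (W \<inter> cball 0 (1/2))"
      by (auto simp: closedin_closed intro!: exI[of _ "cball 0 (1/2)"])
    have "closed {z :: 'a. 1/2 \<le> norm z \<and> norm z \<le> 1}"
      by (intro closed_Collect_conj closed_Collect_le continuous_intros)
    then show "closedin (top_of_set (W \<inter> cball 0 (1/2) \<union> {z \<in> W. 1/2 \<le> norm z \<and> norm z \<le> 1})) {z \<in> W. 1/2 \<le> norm z \<and> norm z \<le> 1}"
      unfolding closedin_closed by (intro exI[of _ "{z. 1/2 \<le> norm z \<and> norm z \<le> 1}"]) auto
    show "continuous_on {z \<in> W. 1/2 \<le> norm z \<and> norm z \<le> 1} (\<lambda>z. k (2 * (1 - norm z), sgn z))"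
    proof (rule continuous_on_compose2[OF k(1)])
      show "continuous_on {z \<in> W. 1/2 \<le> norm z \<and> norm z \<le> 1} (\<lambda>z. (2 * (1 - norm z), sgn z))"
        unfolding sgn_div_norm by (intro continuous_intros) auto
      show "(\<lambda>z. (2 * (1 - norm z), sgn z)) ` {z \<in> W. 1/2 \<le> norm z \<and> norm z \<le> 1} \<subseteq> {0..1} \<times> (W \<inter> sphere 0 1)"
        using sg by fastforce
    qed
    show "\<And>x. x \<in> W \<inter> cball 0 (1 / 2) \<and> \<not> norm x \<le> 1 / 2 \<or> x \<in> {z \<in> W. 1 / 2 \<le> norm z \<and> norm z \<le> 1} \<and> norm x \<le> 1 / 2 \<Longrightarrow>
         c = k (2 * (1 - norm x), sgn x)"
    proof -
      fix x assume "x \<in> W \<inter> cball 0 (1 / 2) \<and> \<not> norm x \<le> 1 / 2 \<or> x \<in> {z \<in> W. 1 / 2 \<le> norm z \<and> norm z \<le> 1} \<and> norm x \<le> 1 / 2"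
      then have "2 * (1 - norm x) = 1" by auto
      then show "c = k (2 * (1 - norm x), sgn x)" by (simp only: k(4))
    qed
  qed simp
  moreover have "(W \<inter> cball 0 (1/2)) \<union> {z \<in> W. 1/2 \<le> norm z \<and> norm z \<le> 1} = W \<inter> cball 0 1" by auto
  ultimately have contg: "continuous_on (W \<inter> cball 0 1) g" by simp
  have "continuous_on ({z \<in> W. norm z \<ge> 1} \<union> (W \<inter> cball 0 1)) G"
    unfolding G_def
  proof (rule continuous_on_cases_local[OF _ _ f(1) contg])
    have "closed {z :: 'a. norm z \<ge> 1}" by (intro closed_Collect_le continuous_intros)
    then show "closedin (top_of_set ({z \<in> W. norm z \<ge> 1} \<union> (W \<inter> cball 0 1))) {z \<in> W. norm z \<ge> 1}"
      unfolding closedin_closed by (intro exI[of _ "{z. norm z \<ge> 1}"]) auto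
    show "closedin (top_of_set ({z \<in> W. norm z \<ge> 1} \<union> (W \<inter> cball 0 1))) (W \<inter> cball 0 1)"
      unfolding closedin_closed by (intro exI[of _ "cball 0 1"]) auto
    fix x assume "x \<in> {z \<in> W. 1 \<le> norm z} \<and> \<not> 1 \<le> norm x \<or> x \<in> W \<inter> cball 0 1 \<and> 1 \<le> norm x"
    then have "norm x = 1" by auto
    then show "f x = g x" using k(3)[of "sgn x"] by (simp add: g_def sgn_div_norm)
  qed
  moreover have "{z \<in> W. norm z \<ge> 1} \<union> (W \<inter> cball 0 1) = W" by auto
  ultimately have "continuous_on W G" by simp
  moreover have "G z \<in> T" if "z \<in> W" for z
  proof -
    have "k (2 * (1 - norm z), sgn z) \<in> T" if "1/2 < norm z" "norm z < 1"
    proof (rule k(2))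
      have "z \<noteq> 0" using that by auto
      then show "sgn z \<in> W \<inter> sphere 0 1" using sg[OF \<open>z \<in> W\<close>] by blast
    qed (use that in auto)
    then show ?thesis using f(2)[OF that] c by (auto simp: G_def g_def)
  qed
  ultimately show ?thesis by (intro exI[of _ G]) (auto simp: G_def)
qed

lemma uniform_separation:
  fixes v :: "'i \<Rightarrow> real \<Rightarrow> 'a::real_normed_vector"
  assumes J: "finite J" and cont: "\<And>i. i \<in> J \<Longrightarrow> continuous_on {0..1} (v i)"
    and ne: "\<And>i k t. i \<in> J \<Longrightarrow> k \<in> J \<Longrightarrow> i \<noteq> k \<Longrightarrow> t \<in> {0..1} \<Longrightarrow> v i t \<noteq> v k t"
  shows "\<exists>m>0. \<forall>i\<in>J. \<forall>k\<in>J. i \<noteq> k \<longrightarrow> (\<forall>t\<in>{0..1}. m \<le> norm (v i t - v k t))"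
proof -
  let ?P = "{p \<in> J \<times> J. fst p \<noteq> snd p}"
  have "\<exists>m>0. \<forall>t\<in>{0..1}. m \<le> norm (v (fst p) t - v (snd p) t)" if p: "p \<in> ?P" for p
  proof -
    have "continuous_on {0..1} (\<lambda>t. norm (v (fst p) t - v (snd p) t))"
      using p cont by (intro continuous_intros) auto
    then obtain t0 where t0: "t0 \<in> {0..1}" "\<forall>t\<in>{0..1}. norm (v (fst p) t0 - v (snd p) t0) \<le> norm (v (fst p) t - v (snd p) t)"
      using continuous_attains_inf[of "{0..1::real}" "\<lambda>t. norm (v (fst p) t - v (snd p) t)"] by auto
    have "v (fst p) t0 \<noteq> v (snd p) t0" using p ne[OF _ _ _ t0(1)] by auto
    then show ?thesis using t0(2) by (intro exI[of _ "norm (v (fst p) t0 - v (snd p) t0)"]) auto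
  qed
  then have "\<forall>p\<in>?P. \<exists>m. m > 0 \<and> (\<forall>t\<in>{0..1}. m \<le> norm (v (fst p) t - v (snd p) t))" by blast
  from bchoice[OF this] obtain m where m: "\<forall>p\<in>?P. m p > 0 \<and> (\<forall>t\<in>{0..1}. m p \<le> norm (v (fst p) t - v (snd p) t))" ..
  have fin: "finite ?P" using J by auto
  define m0 where "m0 = Min (insert 1 (m ` ?P))"
  have "m0 > 0" using m fin by (auto simp: m0_def)
  moreover have "m0 \<le> norm (v i t - v k t)" if "i \<in> J" "k \<in> J" "i \<noteq> k" "t \<in> {0..1}" for i k t
  proof -
    have p: "(i, k) \<in> ?P" using that by auto
    have "m0 \<le> m (i, k)" unfolding m0_def using fin p by (intro Min_le) auto
    also have "m (i, k) \<le> norm (v i t - v k t)" using m p that(4) by force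
    finally show ?thesis .
  qed
  ultimately show ?thesis by blast
qed

text \<open>The condition \<open>indep\<close> allows all planes to be tilted, with their rays kept apart, into the plane of \<open>E1\<close> and \<open>E2\<close>.
  There the perturbed identity has degree \<open>1 + (\<Sum>i\<in>J. a i) = 0\<close>.\<close>

lemma bubble_extension:
  fixes E1 E2 :: "'a::real_inner" and V e :: "'i \<Rightarrow> 'a"
  assumes J: "finite J" and W: "subspace W" and EW: "E1 \<in> W" "E2 \<in> W" and E: "onpair E1 E2"
    and VW: "\<And>i. i \<in> J \<Longrightarrow> V i \<in> W" and eW: "\<And>i. i \<in> J \<Longrightarrow> e i \<in> W" and o: "\<And>i. i \<in> J \<Longrightarrow> onpair (V i) (e i)"
    and indep: "\<And>i. i \<in> J \<Longrightarrow> (V i \<bullet> E1) * (e i \<bullet> E2) \<noteq> (V i \<bullet> E2) * (e i \<bullet> E1)"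
    and rays: "\<And>i k r. i \<in> J \<Longrightarrow> k \<in> J \<Longrightarrow> i \<noteq> k \<Longrightarrow> r > 0 \<Longrightarrow> V i \<bullet> E1 = r * (V k \<bullet> E1) \<Longrightarrow> V i \<bullet> E2 = r * (V k \<bullet> E2) \<Longrightarrow> False"
    and deg: "(\<Sum>i\<in>J. a i) = -1"
  shows "\<exists>\<delta> G. 0 < \<delta> \<and> \<delta> \<le> 1/8 \<and> continuous_on W G \<and> (\<forall>z\<in>W. G z \<in> W - {0}) \<and>
    (\<forall>z\<in>W. norm z \<ge> 1 \<longrightarrow> G z = z + (\<Sum>i\<in>J. bubble \<delta> (V i) (e i) (a i) z))"
proof -
  \<comment> \<open>The tilt shrinks the component orthogonal to the plane and preserves inner
    products with \<open>E1\<close> and \<open>E2\<close>. As \<open>indep\<close> and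
    \<open>rays\<close> are stated through these products, they persist at all times.\<close>
  define T where "T t z = z - t *\<^sub>R perp2 E1 E2 z" for t z
  define v where "v i t = sgn (T t (V i))" for i t
  define e0 where "e0 i t = T t (e i) - (T t (e i) \<bullet> v i t) *\<^sub>R v i t" for i t
  define ee where "ee i t = sgn (e0 i t)" for i t
  have cT: "T t z \<bullet> E1 = z \<bullet> E1" "T t z \<bullet> E2 = z \<bullet> E2" for t z
    using coord2_perp2[OF E, of z] by (simp_all add: T_def inner_diff_left coord2_def complex_eq_iff)
  have T0: "T t (V i) \<noteq> 0" if "i \<in> J" for i t
  proof
    assume "T t (V i) = 0"
    then have "V i \<bullet> E1 = 0" "V i \<bullet> E2 = 0" using cT[of t "V i"] by simp_all
    then show False using indep[OF that] by simp
  qed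
  have nv: "norm (v i t) = 1" if "i \<in> J" for i t using T0[OF that] by (simp add: v_def norm_sgn)
  have e00: "e0 i t \<noteq> 0" if "i \<in> J" for i t
  proof
    assume "e0 i t = 0"
    then have eq: "T t (e i) = ((T t (e i) \<bullet> v i t) / norm (T t (V i))) *\<^sub>R T t (V i)"
      by (simp add: e0_def v_def sgn_div_norm divide_inverse)
    define r where "r = (T t (e i) \<bullet> v i t) / norm (T t (V i))"
    have "e i \<bullet> E1 = r * (V i \<bullet> E1)" "e i \<bullet> E2 = r * (V i \<bullet> E2)"
      using arg_cong[OF eq, of "\<lambda>x. x \<bullet> E1"] arg_cong[OF eq, of "\<lambda>x. x \<bullet> E2"] by (simp_all add: cT r_def)
    then show False using indep[OF that] by simp
  qed
  have ve: "v i t \<bullet> e0 i t = 0" if "i \<in> J" for i t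
    using nv[OF that, of t] by (simp add: e0_def inner_diff_right inner_commute dot_square_norm)
  have ot: "onpair (v i t) (ee i t)" if "i \<in> J" for i t
    using nv[OF that] e00[OF that, of t] ve[OF that, of t] by (simp add: onpair_def ee_def norm_sgn sgn_div_norm)
  have PW: "perp2 E1 E2 z \<in> W" if "z \<in> W" for z
    unfolding perp2_def lift2_def using that W EW by (intro subspace_diff subspace_add subspace_mul)
  have TW: "T t z \<in> W" if "z \<in> W" for t z unfolding T_def using PW that W by (intro subspace_diff subspace_mul)
  have vW: "v i t \<in> W" if "i \<in> J" for i t unfolding v_def sgn_div_norm using TW[OF VW[OF that]] W by (intro subspace_mul)
  have eeW: "ee i t \<in> W" if "i \<in> J" for i t unfolding ee_def e0_def sgn_div_norm
    using TW[OF eW[OF that]] vW[OF that] W by (intro subspace_mul subspace_diff)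
  have contT: "continuous_on S (\<lambda>t. T t z)" for S z unfolding T_def by (intro continuous_intros)
  have contv: "continuous_on S (v i)" if "i \<in> J" for S i
    unfolding v_def[abs_def] sgn_div_norm using T0[OF that] by (intro continuous_intros contT) auto
  have conte: "continuous_on S (ee i)" if "i \<in> J" for S i
  proof -
    have "continuous_on S (e0 i)" unfolding e0_def[abs_def] by (intro continuous_intros contT contv that)
    then show ?thesis unfolding ee_def[abs_def] sgn_div_norm using e00[OF that] by (intro continuous_intros) auto
  qed
  have v0: "v i 0 = V i" and ee0: "ee i 0 = e i" if "i \<in> J" for i
  proof -
    show v0: "v i 0 = V i" using o[OF that] by (simp add: v_def T_def onpair_def sgn_div_norm)
    show "ee i 0 = e i" using o[OF that] by (simp add: ee_def e0_def v0 T_def onpair_def sgn_div_norm inner_commute)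
  qed
  have distinct: "v i t \<noteq> v k t" if ik: "i \<in> J" "k \<in> J" "i \<noteq> k" for i k t
  proof
    assume "v i t = v k t"
    then have eq: "T t (V i) = (norm (T t (V i)) / norm (T t (V k))) *\<^sub>R T t (V k)"
      using T0[OF ik(1), of t] T0[OF ik(2), of t] unfolding v_def sgn_div_norm
      by (metis divide_inverse mult.commute scaleR_left_commute scaleR_one scaleR_scaleR norm_eq_zero right_inverse)
    show False
    proof (rule rays[OF ik])
      show "norm (T t (V i)) / norm (T t (V k)) > 0" using T0 ik by simp
      show "V i \<bullet> E1 = (norm (T t (V i)) / norm (T t (V k))) * (V k \<bullet> E1)"
        using arg_cong[OF eq, of "\<lambda>x. x \<bullet> E1"] by (simp add: cT)
      show "V i \<bullet> E2 = (norm (T t (V i)) / norm (T t (V k))) * (V k \<bullet> E2)"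
        using arg_cong[OF eq, of "\<lambda>x. x \<bullet> E2"] by (simp add: cT)
    qed
  qed
  obtain m where m: "m > 0" "\<forall>i\<in>J. \<forall>k\<in>J. i \<noteq> k \<longrightarrow> (\<forall>t\<in>{0..1}. m \<le> norm (v i t - v k t))"
    using uniform_separation[of J v, OF J contv distinct] by blast
  \<comment> \<open>One radius for all times: with \<open>8 * \<delta> \<le> m\<close> no two
    bubbles are active together, and 1/8 is what a single bubble admits.\<close>
  define \<delta> where "\<delta> = min (1/8) (m / 8)"
  have \<delta>: "\<delta> > 0" "\<delta> \<le> 1/8" using m(1) by (auto simp: \<delta>_def)
  have sep: "8 * \<delta> \<le> norm (v i t - v k t)" if "i \<in> J" "k \<in> J" "i \<noteq> k" "t \<in> {0..1}" for i k t
  proof -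
    have "8 * \<delta> \<le> m" by (simp add: \<delta>_def min_def)
    also have "m \<le> norm (v i t - v k t)" using m(2) that by blast
    finally show ?thesis .
  qed
  define h where "h p = snd p + (\<Sum>i\<in>J. bubble \<delta> (v i (fst p)) (ee i (fst p)) (a i) (snd p))" for p :: "real \<times> 'a"
  have hT: "h (t, z) \<in> W - {0}" if "t \<in> {0..1}" "z \<in> W" "norm z \<ge> 1" for t z
  proof -
    have "h (t, z) \<noteq> 0" unfolding h_def fst_conv snd_conv
      by (rule sum_bubbles_nonzero[OF J ot \<delta>]) (use sep that in auto)
    moreover have "h (t, z) \<in> W" unfolding h_def fst_conv snd_conv bubble_def lift2_def
      using that(2) vW eeW W by (intro subspace_add subspace_sum subspace_mul)
    ultimately show ?thesis by simp
  qed
  have conth: "continuous_on S h" for S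
    unfolding h_def using \<delta>(1)
    by (intro continuous_intros continuous_on_compose2[OF contv[of _ UNIV]] continuous_on_compose2[OF conte[of _ UNIV]]) auto
  have hom1: "homotopic_with_canon (\<lambda>_. True) (W \<inter> sphere 0 1) (W - {0}) (\<lambda>z. h (0, z)) (\<lambda>z. h (1, z))"
    by (rule homotopicI[OF conth]) (use hT in auto)
  have T1: "T 1 z = lift2 E1 E2 (coord2 E1 E2 z)" for z by (simp add: T_def perp2_def)
  define \<kappa> where "\<kappa> i = of_real (inverse (norm (T 1 (V i)))) * coord2 E1 E2 (V i)" for i
  have v1: "v i 1 = lift2 E1 E2 (\<kappa> i)" for i
    by (simp only: v_def sgn_div_norm \<kappa>_def lift2_scaleR T1)
  define \<mu> where "\<mu> i = of_real (inverse (norm (e0 i 1))) * (coord2 E1 E2 (e i) - of_real (T 1 (e i) \<bullet> v i 1) * \<kappa> i)" for i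
  have e01: "e0 i 1 = lift2 E1 E2 (coord2 E1 E2 (e i) - of_real (T 1 (e i) \<bullet> v i 1) * \<kappa> i)" for i
  proof -
    have "lift2 E1 E2 (x - y) = lift2 E1 E2 x - lift2 E1 E2 y" for x y by (simp add: lift2_def scaleR_diff_left)
    then show ?thesis by (simp only: e0_def T1 lift2_scaleR v1)
  qed
  have e1: "ee i 1 = lift2 E1 E2 (\<mu> i)" for i
    by (simp only: ee_def sgn_div_norm \<mu>_def lift2_scaleR e01)
  have n\<kappa>: "norm (\<kappa> i) = 1" and n\<mu>: "norm (\<mu> i) = 1" if "i \<in> J" for i
    using ot[OF that, of 1] norm_lift2[OF E] v1[of i] e1[of i] by (simp_all add: onpair_def)
  \<comment> \<open>In a plane, a unit vector orthogonal to \<open>\<kappa> i\<close> is a quarter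
    turn of it in one of the two directions.\<close>
  have "\<exists>\<epsilon>. (\<epsilon> = 1 \<or> \<epsilon> = (-1::real)) \<and> \<mu> i = of_real \<epsilon> * \<i> * \<kappa> i" if i: "i \<in> J" for i
  proof -
    have "Re (\<kappa> i * cnj (\<mu> i)) = 0"
    proof -
      have "lift2 E1 E2 x \<bullet> lift2 E1 E2 y = Re (x * cnj y)" for x y
        using E by (simp add: onpair_def lift2_def inner_add_left inner_add_right dot_square_norm inner_commute)
      then show ?thesis using ot[OF i, of 1] v1 e1 by (simp add: onpair_def)
    qed
    then have re: "Re (\<mu> i * cnj (\<kappa> i)) = 0" by (simp add: mult.commute)
    have "norm (\<mu> i * cnj (\<kappa> i)) = 1" using n\<kappa>[OF i] n\<mu>[OF i] by (simp add: norm_mult)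
    then have "\<bar>Im (\<mu> i * cnj (\<kappa> i))\<bar> = 1" using re by (simp add: cmod_eq_Im)
    then have "\<mu> i * cnj (\<kappa> i) = of_real (Im (\<mu> i * cnj (\<kappa> i))) * \<i>" "Im (\<mu> i * cnj (\<kappa> i)) = 1 \<or> Im (\<mu> i * cnj (\<kappa> i)) = -1"
      using re by (auto simp: complex_eq_iff)
    moreover have "\<mu> i = (\<mu> i * cnj (\<kappa> i)) * \<kappa> i"
      using n\<kappa>[OF i] by (metis complex_norm_square mult.assoc mult.commute mult.right_neutral of_real_1 one_power2)
    ultimately show ?thesis by metis
  qed
  then have "\<forall>i\<in>J. \<exists>\<epsilon>. (\<epsilon> = 1 \<or> \<epsilon> = (-1::real)) \<and> \<mu> i = of_real \<epsilon> * \<i> * \<kappa> i" by blast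
  from bchoice[OF this] obtain \<epsilon> where \<epsilon>: "\<forall>i\<in>J. (\<epsilon> i = 1 \<or> \<epsilon> i = (-1::real)) \<and> \<mu> i = of_real (\<epsilon> i) * \<i> * \<kappa> i" ..
  have "\<exists>c. homotopic_with_canon (\<lambda>_. True) (W \<inter> sphere 0 1) (W - {0}) (\<lambda>z. z + (\<Sum>i\<in>J. bubble \<delta> (v i 1) (ee i 1) (a i) z)) (\<lambda>_. c)"
  proof (rule planar_bubbles_nullhomotopic[where \<kappa>=\<kappa> and \<epsilon>=\<epsilon>, OF E J \<delta> W EW])
    fix i assume i: "i \<in> J"
    show "norm (\<kappa> i) = 1" by (rule n\<kappa>[OF i])
    show "\<epsilon> i = 1 \<or> \<epsilon> i = -1" "ee i 1 = lift2 E1 E2 (of_real (\<epsilon> i) * \<i> * \<kappa> i)" using \<epsilon> i e1 by auto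
    show "v i 1 = lift2 E1 E2 (\<kappa> i)" by (rule v1)
    show "onpair (v i 1) (ee i 1)" by (rule ot[OF i])
    fix k assume "k \<in> J" "i \<noteq> k"
    then show "8 * \<delta> \<le> norm (v i 1 - v k 1)" using sep[OF i, of k 1] by simp
  qed (rule deg)
  then obtain c where "homotopic_with_canon (\<lambda>_. True) (W \<inter> sphere 0 1) (W - {0}) (\<lambda>z. h (1, z)) (\<lambda>_. c)"
    unfolding h_def by auto
  from homotopic_with_trans[OF hom1 this]
  have hom: "homotopic_with_canon (\<lambda>_. True) (W \<inter> sphere 0 1) (W - {0}) (\<lambda>z. h (0, z)) (\<lambda>_. c)" .
  have "E1 \<in> W \<inter> sphere 0 1" using E EW by (simp add: onpair_def)
  then have c: "c \<in> W - {0}" using homotopic_with_imp_subset2[OF hom] by blast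
  have cont0: "continuous_on {z \<in> W. norm z \<ge> 1} (\<lambda>z. h (0, z))"
    by (rule continuous_on_compose2[OF conth[of UNIV]]) (auto intro!: continuous_intros)
  obtain G where G: "continuous_on W G" "\<forall>z\<in>W. G z \<in> W - {0}" "\<forall>z\<in>W. norm z \<ge> 1 \<longrightarrow> G z = h (0, z)"
    using extend_over_cone[OF W hom cont0 _ c] hT by auto
  have "h (0, z) = z + (\<Sum>i\<in>J. bubble \<delta> (V i) (e i) (a i) z)" for z
    unfolding h_def fst_conv snd_conv by (intro arg_cong2[of _ _ _ _ "(+)"] sum.cong) (auto simp: v0 ee0)
  then show ?thesis using G \<delta> by (intro exI[of _ \<delta>] exI[of _ G]) auto
qed

section \<open>Finitely supported sequences\<close>

text \<open>One type of class \<open>real_inner\<close> that contains all Euclidean spaces, as the dimension of the bubbles' ambient space depends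
  on the list \<open>ns\<close>.\<close>

typedef fseq = "{f :: nat \<Rightarrow> real. finite {i. f i \<noteq> 0}}" morphisms fnth Abs_fseq
  by (rule exI[of _ "\<lambda>_. 0"]) simp

setup_lifting type_definition_fseq

lemma finite_fnth: "finite {i. fnth x i \<noteq> 0}"
  using fnth[of x] by simp

lemma fseq_eqI: "(\<And>i. fnth x i = fnth y i) \<Longrightarrow> x = y"
  by (simp add: fnth_inject[symmetric] fun_eq_iff)

instantiation fseq :: real_vector
begin
lift_definition zero_fseq :: fseq is "\<lambda>_. 0" by simp
lift_definition plus_fseq :: "fseq \<Rightarrow> fseq \<Rightarrow> fseq" is "\<lambda>f g i. f i + g i"
  subgoal for f g by (rule finite_subset[of _ "{i. f i \<noteq> 0} \<union> {i. g i \<noteq> 0}"]) auto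
  done
lift_definition minus_fseq :: "fseq \<Rightarrow> fseq \<Rightarrow> fseq" is "\<lambda>f g i. f i - g i"
  subgoal for f g by (rule finite_subset[of _ "{i. f i \<noteq> 0} \<union> {i. g i \<noteq> 0}"]) auto
  done
lift_definition uminus_fseq :: "fseq \<Rightarrow> fseq" is "\<lambda>f i. - f i" by simp
lift_definition scaleR_fseq :: "real \<Rightarrow> fseq \<Rightarrow> fseq" is "\<lambda>r f i. r * f i"
  by (rule finite_subset[rotated]) auto
instance
  by standard (transfer; simp add: algebra_simps)+
end

lemma fnth_simps [simp]:
  "fnth 0 i = 0" "fnth (x + y) i = fnth x i + fnth y i" "fnth (x - y) i = fnth x i - fnth y i"
  "fnth (- x) i = - fnth x i" "fnth (r *\<^sub>R x) i = r * fnth x i"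
  by (transfer; simp)+

instantiation fseq :: real_inner
begin
definition inner_fseq :: "fseq \<Rightarrow> fseq \<Rightarrow> real" where
  "inner_fseq x y = (\<Sum>i | fnth x i \<noteq> 0. fnth x i * fnth y i)"
definition norm_fseq :: "fseq \<Rightarrow> real" where "norm_fseq x = sqrt (inner x x)"
definition dist_fseq :: "fseq \<Rightarrow> fseq \<Rightarrow> real" where "dist_fseq x y = norm (x - y)"
definition sgn_fseq :: "fseq \<Rightarrow> fseq" where "sgn_fseq x = x /\<^sub>R norm x"
definition uniformity_fseq :: "(fseq \<times> fseq) filter" where
  "uniformity_fseq = (INF e\<in>{0 <..}. principal {(x, y). dist x y < e})"
definition open_fseq :: "fseq set \<Rightarrow> bool" where
  "open_fseq U = (\<forall>x\<in>U. eventually (\<lambda>(x', y). x' = x \<longrightarrow> y \<in> U) uniformity)"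

text \<open>The definition sums over the support of the left argument; passing to a common finite
  set makes symmetry and additivity visible.\<close>

lemma inner_fseq_superset:
  assumes "finite F" "{i. fnth x i \<noteq> 0} \<subseteq> F \<or> {i. fnth y i \<noteq> 0} \<subseteq> F"
  shows "inner x y = (\<Sum>i\<in>F. fnth x i * fnth y i)"
proof -
  let ?G = "F \<union> {i. fnth x i \<noteq> 0}"
  have "inner x y = (\<Sum>i\<in>?G. fnth x i * fnth y i)"
    unfolding inner_fseq_def using assms(1) finite_fnth by (intro sum.mono_neutral_left) auto
  also have "\<dots> = (\<Sum>i\<in>F. fnth x i * fnth y i)"
    using assms finite_fnth by (intro sum.mono_neutral_right) auto
  finally show ?thesis .
qed

instance
proof
  fix x y z :: fseq and r :: real and U :: "fseq set"
  show "dist x y = norm (x - y)" by (rule dist_fseq_def)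
  show "sgn x = x /\<^sub>R norm x" by (rule sgn_fseq_def)
  show "uniformity = (INF e\<in>{0 <..}. principal {(x :: fseq, y). dist x y < e})" by (rule uniformity_fseq_def)
  show "open U = (\<forall>x\<in>U. eventually (\<lambda>(x', y). x' = x \<longrightarrow> y \<in> U) uniformity)" by (rule open_fseq_def)
  let ?F = "{i. fnth x i \<noteq> 0} \<union> {i. fnth y i \<noteq> 0}"
  have F: "finite ?F" using finite_fnth by blast
  show "inner x y = inner y x"
    using inner_fseq_superset[OF F, of x y] inner_fseq_superset[OF F, of y x] by (simp add: mult.commute)
  have "inner (x + y) z = (\<Sum>i\<in>?F. fnth (x + y) i * fnth z i)" by (rule inner_fseq_superset[OF F]) auto
  then show "inner (x + y) z = inner x z + inner y z"
    using inner_fseq_superset[OF F, of x z] inner_fseq_superset[OF F, of y z] by (simp add: distrib_right sum.distrib)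
  have "inner (r *\<^sub>R x) y = (\<Sum>i\<in>?F. fnth (r *\<^sub>R x) i * fnth y i)" by (rule inner_fseq_superset[OF F]) auto
  then show "inner (r *\<^sub>R x) y = r * inner x y"
    using inner_fseq_superset[OF F, of x y] by (simp add: sum_distrib_left mult.assoc)
  show "0 \<le> inner x x" by (simp add: inner_fseq_def sum_nonneg)
  have "inner x x = 0 \<longleftrightarrow> (\<forall>i. fnth x i = 0)"
    unfolding inner_fseq_def using finite_fnth[of x] by (subst sum_nonneg_eq_0_iff) auto
  then show "inner x x = 0 \<longleftrightarrow> x = 0" by (auto intro: fseq_eqI)
  show "norm x = sqrt (inner x x)" by (rule norm_fseq_def)
qed
end

definition fvec :: "nat \<Rightarrow> (nat \<Rightarrow> real) \<Rightarrow> fseq" where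
  "fvec n g = Abs_fseq (\<lambda>i. if i < n then g i else 0)"

lemma fnth_fvec [simp]: "fnth (fvec n g) i = (if i < n then g i else 0)"
proof -
  have "finite {i. (if i < n then g i else 0) \<noteq> 0}" by (rule finite_subset[of _ "{..<n}"]) auto
  then show ?thesis unfolding fvec_def by (subst Abs_fseq_inverse) auto
qed

lemma inner_fvec_left: "inner (fvec n g) x = (\<Sum>i<n. g i * fnth x i)"
proof -
  have "inner (fvec n g) x = (\<Sum>i\<in>{..<n}. fnth (fvec n g) i * fnth x i)" by (rule inner_fseq_superset) (auto split: if_splits)
  then show ?thesis by simp
qed

lemma inner_fvec_right: "inner x (fvec n g) = (\<Sum>i<n. fnth x i * g i)"
  by (subst inner_commute) (simp add: inner_fvec_left mult.commute)

lemma fnth_eq_inner: "fnth x i = inner x (fvec (Suc i) (\<lambda>k. of_bool (k = i)))"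
  by (simp add: inner_fvec_right sum.delta of_bool_def if_distrib cong: if_cong)

lemma abs_fnth_le_norm: "\<bar>fnth x i\<bar> \<le> norm x"
proof -
  let ?b = "fvec (Suc i) (\<lambda>k. of_bool (k = i))"
  have "norm ?b = 1"
    unfolding norm_eq_sqrt_inner fnth_eq_inner[symmetric, of ?b] by simp
  then show ?thesis using Cauchy_Schwarz_ineq2[of x ?b] unfolding fnth_eq_inner[of x i] by simp
qed

lemma continuous_on_fnth [continuous_intros]: "continuous_on S f \<Longrightarrow> continuous_on S (\<lambda>x. fnth (f x) i)"
  unfolding fnth_eq_inner by (intro continuous_intros)

lemma fnth_sum: "fnth (\<Sum>k\<in>K. f k) i = (\<Sum>k\<in>K. fnth (f k) i)"
  by (induction K rule: infinite_finite_induct) auto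

lemma continuous_on_fvec [continuous_intros]:
  assumes "\<And>i. i < n \<Longrightarrow> continuous_on S (\<lambda>x. f x i)"
  shows "continuous_on S (\<lambda>x. fvec n (f x))"
proof -
  have rep: "fvec n g = (\<Sum>i<n. g i *\<^sub>R fvec n (\<lambda>k. of_bool (k = i)))" for g
  proof (rule fseq_eqI)
    fix k
    have "(\<Sum>i<n. g i * of_bool (k = i)) = (if k < n then g k else 0)"
      by (simp add: of_bool_def if_distrib sum.delta cong: if_cong)
    then show "fnth (fvec n g) k = fnth (\<Sum>i<n. g i *\<^sub>R fvec n (\<lambda>k. of_bool (k = i))) k"
      by (simp add: fnth_sum)
  qed
  have "continuous_on S (\<lambda>x. \<Sum>i<n. f x i *\<^sub>R fvec n (\<lambda>k. of_bool (k = i)))"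
    using assms by (intro continuous_intros) auto
  then show ?thesis by (rule continuous_on_eq) (rule rep[symmetric])
qed

definition sumzero :: "nat \<Rightarrow> fseq set" where
  "sumzero n = {x. (\<forall>i\<ge>n. fnth x i = 0) \<and> (\<Sum>i<n. fnth x i) = 0}"

lemma subspace_sumzero: "subspace (sumzero n)"
  by (auto simp: subspace_def sumzero_def sum.distrib simp flip: sum_distrib_left)

definition fperm :: "(nat \<Rightarrow> nat) \<Rightarrow> fseq \<Rightarrow> fseq" where
  "fperm \<pi> x = Abs_fseq (\<lambda>i. fnth x (\<pi> i))"

lemma fnth_fperm: "bij \<pi> \<Longrightarrow> fnth (fperm \<pi> x) i = fnth x (\<pi> i)"
proof -
  assume \<pi>: "bij \<pi>"
  have "{i. fnth x (\<pi> i) \<noteq> 0} = \<pi> -` {i. fnth x i \<noteq> 0}" by auto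
  then have "finite {i. fnth x (\<pi> i) \<noteq> 0}" using finite_vimageI[OF finite_fnth bij_is_inj[OF \<pi>]] by simp
  then show ?thesis unfolding fperm_def by (subst Abs_fseq_inverse) auto
qed

lemma linear_fperm: "bij \<pi> \<Longrightarrow> linear (fperm \<pi>)"
  by (intro linearI fseq_eqI) (simp_all add: fnth_fperm)

lemma inner_fperm:
  assumes "bij \<pi>"
  shows "inner (fperm \<pi> x) (fperm \<pi> y) = inner x y"
proof -
  have "{i. fnth x (\<pi> i) \<noteq> 0} = inv \<pi> ` {i. fnth x i \<noteq> 0}"
    using assms by (auto simp: bij_inv_eq_iff bij_is_inj image_iff) (metis bij_inv_eq_iff)
  moreover have "inj_on (inv \<pi>) {i. fnth x i \<noteq> 0}" using bij_is_inj[OF bij_imp_bij_inv[OF assms]] inj_on_subset by blast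
  ultimately show ?thesis
    using assms by (simp add: inner_fseq_def fnth_fperm sum.reindex bij_is_surj surj_f_inv_f)
qed

lemma fperm_sumzero:
  assumes "\<pi> permutes {..<n}" "x \<in> sumzero n"
  shows "fperm \<pi> x \<in> sumzero n"
proof -
  have b: "bij \<pi>" using assms(1) by (rule permutes_bij)
  have "(\<Sum>i<n. fnth x (\<pi> i)) = (\<Sum>i<n. fnth x i)"
    using sum.permute[OF assms(1), of "fnth x"] by (simp add: comp_def)
  moreover have "fnth x (\<pi> i) = 0" if "i \<ge> n" for i
    using assms that permutes_not_in[OF assms(1), of i] by (simp add: sumzero_def)
  ultimately show ?thesis using assms(2) by (simp add: sumzero_def fnth_fperm[OF b])
qed

lemma bubble_isometry:
  assumes "linear P" "\<And>x y. inner (P x) (P y) = inner x y"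
  shows "bubble \<delta> (P v) (P e) a (P z) = P (bubble \<delta> v e a z)"
proof -
  have c: "coord2 (P v) (P e) (P z) = coord2 v e z" by (simp add: coord2_def assms)
  have l: "lift2 (P v) (P e) w = P (lift2 v e w)" for w
    by (simp add: lift2_def linear_add[OF assms(1)] linear_scale[OF assms(1)])
  have p: "perp2 (P v) (P e) (P z) = P (perp2 v e z)" by (simp add: perp2_def c l linear_diff[OF assms(1)])
  have n: "norm (P x) = norm x" for x by (simp add: norm_eq_sqrt_inner assms)
  show ?thesis by (simp add: bubble_def c l p n assms linear_scale[OF assms(1)])
qed

text \<open>By Pascal's rule and \<open>prime_dvd_choose_of_power_dvd\<close>, \<open>q\<close>
  divides no \<open>n - 1 choose i\<close> with \<open>i < q ^ e\<close>, and
  \<open>n choose (q ^ e)\<close> is \<open>m\<close> times the one for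
  \<open>i = q ^ e - 1\<close>.\<close>

lemma binomial_not_dvd:
  fixes q n m :: nat
  assumes q: "prime q" and n: "n = q ^ e * m" and m: "\<not> q dvd m" and e: "e > 0"
  shows "\<not> q dvd (n choose (q ^ e))"
proof -
  have q1: "q ^ e > 0" using q by (simp add: prime_gt_0_nat)
  have m0: "m > 0" using m by (cases m) auto
  have n0: "n > 0" using n q1 m0 by simp
  have step: "\<not> q dvd (n - 1 choose i)" if "i < q ^ e" for i
    using that
  proof (induction i)
    case 0 then show ?case using prime_gt_1_nat[OF q] by simp
  next
    case (Suc i)
    have "q dvd (n choose Suc i)" by (rule prime_dvd_choose_of_power_dvd[OF q]) (use n Suc in auto)
    moreover have "n choose Suc i = (n - 1 choose i) + (n - 1 choose Suc i)" using n0 by (cases n) auto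
    ultimately show ?case using Suc by (metis Suc_lessD dvd_add_left_iff)
  qed
  have "q ^ e * (n choose (q ^ e)) = n * (n - 1 choose (q ^ e - 1))" using times_binomial_minus1_eq[OF q1] .
  then have "n choose (q ^ e) = m * (n - 1 choose (q ^ e - 1))" using n q1 prime_gt_0_nat[OF q] by simp
  moreover have "\<not> q dvd (n - 1 choose (q ^ e - 1))" using step q1 by simp
  ultimately show ?thesis using m prime_dvd_mult_iff[OF q] by simp
qed

lemma bezout_family:
  fixes f :: "'j \<Rightarrow> int"
  assumes "finite J"
  shows "\<exists>a. (\<Sum>j\<in>J. a j * f j) = Gcd (f ` J)"
  using assms
proof (induction J rule: finite_induct)
  case (insert x F)
  then obtain a where a: "(\<Sum>j\<in>F. a j * f j) = Gcd (f ` F)" by blast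
  obtain u v where uv: "u * f x + v * Gcd (f ` F) = gcd (f x) (Gcd (f ` F))" using bezout_int by blast
  have "(\<Sum>j\<in>insert x F. (if j = x then u else v * a j) * f j) = u * f x + (\<Sum>j\<in>F. v * a j * f j)"
    using insert(1,2) by (simp, intro sum.cong) auto
  also have "(\<Sum>j\<in>F. v * a j * f j) = v * Gcd (f ` F)" by (simp add: a[symmetric] sum_distrib_left mult.assoc)
  finally show ?case using uv by auto
qed simp

text \<open>Ram's theorem: the inner binomial coefficients of \<open>n\<close> have gcd 1 if
  \<open>n\<close> is not a prime power. The value -1 is what cancels the degree 1 of the
  identity.\<close>

lemma binomial_combination:
  fixes n :: nat
  assumes n: "n \<ge> 2" and np: "\<And>p e. prime p \<Longrightarrow> n \<noteq> p ^ e"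
  shows "\<exists>a. (\<Sum>j\<in>{1..<n}. a j * int (n choose j)) = -1"
proof -
  let ?f = "\<lambda>j. int (n choose j)"
  have "Gcd (?f ` {1..<n}) = 1"
  proof (rule ccontr)
    assume g: "Gcd (?f ` {1..<n}) \<noteq> 1"
    have "?f 1 = int n" "1 \<in> {1..<n}" using n by auto
    then have dn: "Gcd (?f ` {1..<n}) dvd int n" by (metis Gcd_dvd imageI)
    have "\<not> is_unit (Gcd (?f ` {1..<n}))" using g by (simp add: zdvd1_eq)
    moreover have "Gcd (?f ` {1..<n}) \<noteq> 0"
    proof
      assume "Gcd (?f ` {1..<n}) = 0"
      then have "int n = 0" using dn by (simp only: dvd_0_left_iff)
      then show False using n by simp
    qed
    ultimately obtain q0 where q0: "prime q0" "q0 dvd Gcd (?f ` {1..<n})" using prime_divisor_exists by blast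
    define q where "q = nat q0"
    have iq: "int q = q0" using prime_ge_0_int[OF q0(1)] by (simp add: q_def)
    then have "prime (int q)" using q0(1) by (simp only:)
    then have "prime q" by simp
    note q = this iq
    have all: "q dvd (n choose j)" if "j \<in> {1..<n}" for j
      using q0(2) q(2) that by (metis Gcd_dvd dvd_trans imageI int_dvd_int_iff)
    have qn: "q dvd n" using all[of 1] n by simp
    define e where "e = multiplicity q n"
    obtain m where m: "n = q ^ e * m" "\<not> q dvd m"
    proof -
      have "n \<noteq> 0" using n by simp
      moreover have "\<not> is_unit q" using q(1) not_prime_unit by blast
      ultimately obtain m' where m': "n = q ^ multiplicity q n * m'" "\<not> q dvd m'" by (rule multiplicity_decompose')
      show ?thesis by (rule that[unfolded e_def, OF m'])
    qed
    have "e > 0" using qn m by (cases e) auto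
    have "m \<noteq> 1" using np[OF q(1), of e] m(1) by auto
    moreover have "m > 0" using m(2) by (cases m) auto
    ultimately have "q ^ e < n" using m(1) q(1) by (simp add: prime_gt_0_nat)
    moreover have "1 \<le> q ^ e" using q(1) by (simp add: prime_gt_0_nat Suc_le_eq)
    ultimately show False using all[of "q ^ e"] binomial_not_dvd[OF q(1) m \<open>e > 0\<close>] by simp
  qed
  then obtain a where "(\<Sum>j\<in>{1..<n}. a j * ?f j) = 1" using bezout_family[of "{1..<n}" ?f] by auto
  then have "(\<Sum>j\<in>{1..<n}. (- a j) * ?f j) = -1" by (simp add: sum_negf)
  then show ?thesis by (rule exI[of _ "\<lambda>j. - a j"])
qed

lemma digits_unique:
  fixes c d :: "nat \<Rightarrow> nat"
  assumes "(\<Sum>i<k. c i * q ^ i) = (\<Sum>i<k. d i * q ^ i)" "\<And>i. i < k \<Longrightarrow> c i < q" "\<And>i. i < k \<Longrightarrow> d i < q" "i < k"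
  shows "c i = d i"
  using assms
proof (induction k arbitrary: c d i)
  case (Suc k)
  have s: "(\<Sum>i<Suc k. f i * q ^ i) = f 0 + q * (\<Sum>i<k. f (Suc i) * q ^ i)" for f :: "nat \<Rightarrow> nat"
    by (subst sum.lessThan_Suc_shift) (simp add: sum_distrib_left mult.left_commute)
  have eq: "c 0 + q * (\<Sum>i<k. c (Suc i) * q ^ i) = d 0 + q * (\<Sum>i<k. d (Suc i) * q ^ i)"
    using Suc.prems(1) unfolding s .
  have lt: "c 0 < q" "d 0 < q" using Suc.prems by auto
  have c0: "c 0 = d 0" using arg_cong[OF eq, of "\<lambda>x. x mod q"] lt by simp
  have "(\<Sum>i<k. c (Suc i) * q ^ i) = (\<Sum>i<k. d (Suc i) * q ^ i)" using eq c0 lt by simp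
  then have "c (Suc i') = d (Suc i')" if "i' < k" for i'
    using Suc.IH[of "\<lambda>i. c (Suc i)" "\<lambda>i. d (Suc i)" i'] Suc.prems(2,3) that by simp
  then show ?case using c0 Suc.prems(4) by (cases i) auto
qed simp

text \<open>In base \<open>q\<close> the two sides have the digits \<open>card K'\<close> on
  \<open>K\<close> and \<open>card K\<close> on \<open>K'\<close>. As \<open>k < q\<close> these are
  genuine digits, so the supports agree.\<close>

lemma subset_sums_distinct:
  fixes K K' :: "nat set"
  assumes "K \<subseteq> {..<k}" "K' \<subseteq> {..<k}" "K \<noteq> {}" "K' \<noteq> {}" "k < q"
    and "card K' * (\<Sum>i\<in>K. q ^ i) = card K * (\<Sum>i\<in>K'. q ^ i)"
  shows "K = K'"
proof -
  have fin: "finite K" "finite K'" using assms finite_subset by blast+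
  have s: "(\<Sum>i<k. (c * of_bool (i \<in> L)) * q ^ i) = c * (\<Sum>i\<in>L. q ^ i)" if "L \<subseteq> {..<k}" for c and L :: "nat set"
  proof -
    have "(\<Sum>i<k. (c * of_bool (i \<in> L)) * q ^ i) = (\<Sum>i\<in>L. (c * of_bool (i \<in> L)) * q ^ i)"
      using that by (intro sum.mono_neutral_right) auto
    then show ?thesis by (simp add: sum_distrib_left)
  qed
  have "card K \<le> k" "card K' \<le> k" using assms card_mono[of "{..<k}"] by fastforce+
  then have "card K' * of_bool (i \<in> K) = card K * of_bool (i \<in> K')" if "i < k" for i
    using digits_unique[of "\<lambda>i. card K' * of_bool (i \<in> K)" q k "\<lambda>i. card K * of_bool (i \<in> K')" i] assms s that by auto
  moreover have "card K > 0" "card K' > 0" using fin assms by (simp_all add: card_gt_0_iff)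
  ultimately have "i \<in> K \<longleftrightarrow> i \<in> K'" if "i < k" for i using that by (force simp: of_bool_def split: if_splits)
  then show ?thesis using assms(1,2) by blast
qed

section \<open>One bubble for every proper subset\<close>

text \<open>The second vector of the plane attached to \<open>I\<close> is defined by the order on whichever of \<open>I\<close> and its complement has at least
  three elements, hence is preserved by permutations that are monotone on both blocks; three elements ensure that its
  two indices differ from \<open>n - 1\<close>.\<close>

definition blk :: "nat \<Rightarrow> nat set \<Rightarrow> nat set" where
  "blk n I = (if card I \<ge> 3 then I else {..<n} - I)"

definition axisv :: "nat \<Rightarrow> nat set \<Rightarrow> fseq" where
  "axisv n I = fvec n (\<lambda>i. of_bool (i \<in> I) - real (card I) / real n)"

definition edgev :: "nat \<Rightarrow> nat set \<Rightarrow> fseq" where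
  "edgev n I = fvec n (\<lambda>i. of_bool (i = Min (blk n I)) - of_bool (i = Min (blk n I - {Min (blk n I)})))"

definition parts2 :: "nat \<Rightarrow> nat set set" where
  "parts2 n = {I. I \<subseteq> {..<n} \<and> I \<noteq> {} \<and> I \<noteq> {..<n}}"

text \<open>The vectors \<open>plane1\<close> and \<open>plane2\<close> span a common plane in which, by uniqueness of digits, the axes of distinct subsets
  have distinct directions.\<close>

definition plane1 :: "nat \<Rightarrow> nat \<Rightarrow> real" where
  "plane1 n i = (if i < n - 1 then 1 else - (real n - 1))"

definition plane2 :: "nat \<Rightarrow> nat \<Rightarrow> real" where
  "plane2 n i = (if i < n - 1 then real (n + 1) ^ i else - (\<Sum>i<n - 1. real (n + 1) ^ i))"

lemma sum_split_last: "(n::nat) > 0 \<Longrightarrow> (\<Sum>i<n. f i) = (\<Sum>i<n - 1. f i) + (f (n - 1) :: real)"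
  by (cases n) auto

lemma sum_plane1: "n > 0 \<Longrightarrow> (\<Sum>i<n. plane1 n i) = 0"
  by (subst sum_split_last) (auto simp: plane1_def of_nat_diff)

lemma sum_plane2: "n > 0 \<Longrightarrow> (\<Sum>i<n. plane2 n i) = 0"
  by (subst sum_split_last) (auto simp: plane2_def)

lemma axisv_sumzero: "I \<subseteq> {..<n} \<Longrightarrow> n > 0 \<Longrightarrow> axisv n I \<in> sumzero n"
proof -
  assume I: "I \<subseteq> {..<n}" and n: "n > 0"
  have "(\<Sum>i<n. of_bool (i \<in> I)) = real (card I)"
    using I by (simp add: of_bool_def sum.If_cases Int_absorb1)
  then show ?thesis using n by (simp add: sumzero_def axisv_def sum_subtractf)
qed

lemma inner_axisv:
  assumes I: "I \<subseteq> {..<n}" and c: "(\<Sum>i<n. c i) = 0"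
  shows "inner (axisv n I) (fvec n c) = (\<Sum>i\<in>I. c i)"
proof -
  have "inner (axisv n I) (fvec n c) = (\<Sum>i<n. of_bool (i \<in> I) * c i) - real (card I) / real n * (\<Sum>i<n. c i)"
    by (simp add: axisv_def inner_fvec_left left_diff_distrib sum_subtractf sum_distrib_left)
  also have "(\<Sum>i<n. of_bool (i \<in> I) * c i) = (\<Sum>i\<in>I. of_bool (i \<in> I) * c i)"
    using I by (intro sum.mono_neutral_right) auto
  also have "\<dots> = (\<Sum>i\<in>I. c i)" by simp
  finally show ?thesis using c by simp
qed

text \<open>Both plane vectors sum to 0, so a subset containing the exceptional index
  \<open>n - 1\<close> is read through its complement, with the opposite sign.\<close>

lemma sum_plane_in:
  assumes I: "I \<subseteq> {..<n}" and n: "n > 0"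
  shows "n - 1 \<notin> I \<Longrightarrow> (\<Sum>i\<in>I. plane1 n i) = real (card I) \<and> (\<Sum>i\<in>I. plane2 n i) = real (\<Sum>i\<in>I. (n + 1) ^ i)"
    and "n - 1 \<in> I \<Longrightarrow> (\<Sum>i\<in>I. plane1 n i) = - real (card ({..<n} - I)) \<and> (\<Sum>i\<in>I. plane2 n i) = - real (\<Sum>i\<in>{..<n} - I. (n + 1) ^ i)"
proof -
  have low: "(\<Sum>i\<in>K. plane1 n i) = real (card K) \<and> (\<Sum>i\<in>K. plane2 n i) = real (\<Sum>i\<in>K. (n + 1) ^ i)"
    if "K \<subseteq> {..<n}" "n - 1 \<notin> K" for K
  proof -
    have "i < n - 1" if "i \<in> K" for i using that \<open>K \<subseteq> {..<n}\<close> \<open>n - 1 \<notin> K\<close> by (metis One_nat_def Suc_pred lessThan_iff less_SucE n subsetD)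
    then show ?thesis by (simp add: plane1_def plane2_def)
  qed
  show "n - 1 \<notin> I \<Longrightarrow> (\<Sum>i\<in>I. plane1 n i) = real (card I) \<and> (\<Sum>i\<in>I. plane2 n i) = real (\<Sum>i\<in>I. (n + 1) ^ i)"
    by (rule low[OF I])
  assume "n - 1 \<in> I"
  then have "(\<Sum>i\<in>{..<n} - I. plane1 n i) = real (card ({..<n} - I)) \<and> (\<Sum>i\<in>{..<n} - I. plane2 n i) = real (\<Sum>i\<in>{..<n} - I. (n + 1) ^ i)"
    by (intro low) auto
  moreover have "(\<Sum>i\<in>I. c i) = - (\<Sum>i\<in>{..<n} - I. c i)" if "(\<Sum>i<n. c i) = 0" for c :: "nat \<Rightarrow> real"
    using sum.subset_diff[OF I, of c] that by simp
  ultimately show "(\<Sum>i\<in>I. plane1 n i) = - real (card ({..<n} - I)) \<and> (\<Sum>i\<in>I. plane2 n i) = - real (\<Sum>i\<in>{..<n} - I. (n + 1) ^ i)"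
    using sum_plane1[OF n] sum_plane2[OF n] by simp
qed

text \<open>A third element of the block keeps both minima below \<open>n - 1\<close>. It exists
  because a subset with fewer than three elements has a complement with more, given
  \<open>n \<ge> 6\<close>.\<close>

lemma blk_mins:
  assumes n: "n \<ge> 6" and I: "I \<in> parts2 n"
  shows "Min (blk n I) \<in> blk n I" "Min (blk n I - {Min (blk n I)}) \<in> blk n I - {Min (blk n I)}"
    and "Min (blk n I) < n - 1" "Min (blk n I - {Min (blk n I)}) < n - 1"
    and "finite (blk n I)" "blk n I \<subseteq> {..<n}"
proof -
  let ?B = "blk n I" and ?C = "blk n I - {Min (blk n I)}"
  have fI: "finite I" using I finite_subset unfolding parts2_def by blast
  show sub: "?B \<subseteq> {..<n}" using I by (auto simp: blk_def parts2_def)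
  then show fin: "finite ?B" using finite_subset by blast
  have "card ({..<n} - I) = n - card I" using I fI by (simp add: card_Diff_subset parts2_def)
  then have c3: "card ?B \<ge> 3" using n by (auto simp: blk_def)
  then have "?B \<noteq> {}" by auto
  then show m1: "Min ?B \<in> ?B" using fin by simp
  have cC: "card ?C \<ge> 2" using c3 m1 fin by simp
  then have "?C \<noteq> {}" by (metis card.empty not_numeral_le_zero)
  then show m2: "Min ?C \<in> ?C" using fin by (intro Min_in) auto
  have "card (?C - {Min ?C}) \<ge> 1" using cC m2 fin by simp
  then obtain x where x: "x \<in> ?C" "x \<noteq> Min ?C" by (metis DiffE card.empty ex_in_conv insertCI not_one_le_zero)
  have "Min ?C \<le> x" using x fin by simp
  then have l2: "Min ?C < x" using x by simp
  have "x < n" using x sub by auto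
  then show "Min ?C < n - 1" using l2 by simp
  have "Min ?B \<le> x" "Min ?B \<noteq> x" using x fin by auto
  then show "Min ?B < n - 1" using \<open>x < n\<close> by simp
qed

lemma edgev_sumzero:
  assumes n: "n \<ge> 6" and I: "I \<in> parts2 n"
  shows "edgev n I \<in> sumzero n"
proof -
  have "(\<Sum>i<n. of_bool (i = m)) = (1 :: real)" if "m < n" for m
    using that by (simp add: of_bool_def sum.delta)
  then show ?thesis using blk_mins(3,4)[OF n I] by (simp add: edgev_def sumzero_def sum_subtractf)
qed

lemma inner_edgev:
  assumes n: "n \<ge> 6" and I: "I \<in> parts2 n"
  shows "inner (edgev n I) (fvec n c) = c (Min (blk n I)) - c (Min (blk n I - {Min (blk n I)}))"
proof -
  have "(\<Sum>i<n. of_bool (i = m) * c i) = c m" if "m < n" for m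
  proof -
    have "(\<Sum>i<n. of_bool (i = m) * c i) = (\<Sum>i\<in>{m}. of_bool (i = m) * c i)"
      using that by (intro sum.mono_neutral_right) auto
    then show ?thesis by simp
  qed
  then show ?thesis using blk_mins(3,4)[OF n I]
    by (simp add: edgev_def inner_fvec_left left_diff_distrib sum_subtractf)
qed

text \<open>The edge joins two indices of one block, and the axis is constant on blocks; hence they
  are orthogonal.\<close>

lemma parts2_onpair:
  assumes n: "n \<ge> 6" and I: "I \<in> parts2 n"
  shows "onpair (sgn (axisv n I)) (sgn (edgev n I))"
proof -
  have I': "I \<subseteq> {..<n}" "n > 0" using I n by (auto simp: parts2_def)
  have "inner (axisv n I) (fvec n (plane1 n)) \<noteq> 0"
  proof -
    have "finite I" using I'(1) finite_subset by blast
    moreover have "{..<n} - I \<noteq> {}" "I \<noteq> {}" using I by (auto simp: parts2_def)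
    ultimately show ?thesis
      using inner_axisv[OF I'(1) sum_plane1[OF I'(2)]] sum_plane_in[OF I'] by (cases "n - 1 \<in> I") auto
  qed
  then have a0: "axisv n I \<noteq> 0" by auto
  let ?m1 = "Min (blk n I)" and ?m2 = "Min (blk n I - {Min (blk n I)})"
  have m: "?m1 \<noteq> ?m2" "?m1 < n" "?m1 \<in> blk n I" "?m2 \<in> blk n I" using blk_mins[OF n I] by auto
  have "fnth (edgev n I) ?m1 = 1" using m by (simp add: edgev_def)
  then have e0: "edgev n I \<noteq> 0" by auto
  have "inner (edgev n I) (axisv n I) = 0"
    unfolding axisv_def inner_edgev[OF n I] using m(3,4) by (auto simp: blk_def split: if_splits)
  then show ?thesis using a0 e0 by (simp add: onpair_def norm_sgn sgn_div_norm inner_commute)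
qed

text \<open>Gram-Schmidt. The last clause allows the conditions of \<open>bubble_extension\<close>
  to be checked against the explicit vectors \<open>plane1\<close> and
  \<open>plane2\<close>.\<close>

lemma plane_orthonormal:
  assumes n: "n \<ge> 6"
  shows "\<exists>E1 E2. E1 \<in> sumzero n \<and> E2 \<in> sumzero n \<and> onpair E1 E2 \<and>
    (\<forall>x. inner x E1 = 0 \<longrightarrow> inner x E2 = 0 \<longrightarrow> inner x (fvec n (plane1 n)) = 0 \<and> inner x (fvec n (plane2 n)) = 0)"
proof -
  let ?c1 = "fvec n (plane1 n)" and ?c2 = "fvec n (plane2 n)"
  have n0: "n > 0" using n by simp
  have W: "?c1 \<in> sumzero n" "?c2 \<in> sumzero n" using sum_plane1[OF n0] sum_plane2[OF n0] by (simp_all add: sumzero_def)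
  define E1 where "E1 = sgn ?c1"
  define d where "d = ?c2 - inner ?c2 E1 *\<^sub>R E1"
  define E2 where "E2 = sgn d"
  have "fnth ?c1 0 = 1" "fnth ?c1 1 = 1" "fnth ?c2 0 = 1" "fnth ?c2 1 = real (n + 1)" using n by (simp_all add: plane1_def plane2_def)
  then have c10: "?c1 \<noteq> 0" by (metis fnth_simps(1) zero_neq_one)
  have d0: "d \<noteq> 0"
  proof
    assume "d = 0"
    then have "?c2 = (inner ?c2 E1 / norm ?c1) *\<^sub>R ?c1" by (simp add: d_def E1_def sgn_div_norm divide_inverse)
    then obtain r where r: "?c2 = r *\<^sub>R ?c1" by blast
    have "fnth ?c2 k = r * fnth ?c1 k" for k by (subst r) (rule fnth_simps(5))
    from this[of 0] this[of 1] have "1 = r" "real (n + 1) = r"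
      by (simp_all only: \<open>fnth ?c1 0 = 1\<close> \<open>fnth ?c1 1 = 1\<close> \<open>fnth ?c2 0 = 1\<close> \<open>fnth ?c2 1 = real (n + 1)\<close> mult_1_right)
    then show False using n by linarith
  qed
  have nE1: "norm E1 = 1" using c10 by (simp add: E1_def norm_sgn)
  have E1d: "inner E1 d = 0" using nE1 by (simp add: d_def inner_diff_right dot_square_norm inner_commute)
  have "onpair E1 E2" using nE1 d0 E1d by (simp add: onpair_def E2_def norm_sgn sgn_div_norm)
  moreover have E1W: "E1 \<in> sumzero n" unfolding E1_def sgn_div_norm using W subspace_sumzero by (intro subspace_mul)
  moreover have "E2 \<in> sumzero n" unfolding E2_def d_def sgn_div_norm using W E1W subspace_sumzero by (intro subspace_mul subspace_diff)
  moreover have "inner x ?c1 = 0 \<and> inner x ?c2 = 0" if "inner x E1 = 0" "inner x E2 = 0" for x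
  proof -
    have "?c1 = norm ?c1 *\<^sub>R E1" using c10 by (simp add: E1_def sgn_div_norm)
    then have "inner x ?c1 = 0" using that by (metis inner_scaleR_right mult_zero_right)
    moreover have "?c2 = norm d *\<^sub>R E2 + inner ?c2 E1 *\<^sub>R E1" using d0 by (simp add: E2_def sgn_div_norm) (simp add: d_def)
    then have "inner x ?c2 = 0" using that by (metis inner_add_right inner_scaleR_right mult_zero_right add_0)
    ultimately show ?thesis ..
  qed
  ultimately show ?thesis by blast
qed

lemma permutes_increasing_id:
  assumes \<pi>: "\<pi> permutes {..<n::nat}" and mono: "\<And>i k. i < k \<Longrightarrow> k < n \<Longrightarrow> \<pi> i < \<pi> k"
  shows "\<pi> = id"
proof
  fix i show "\<pi> i = id i"
  proof (induction i rule: less_induct)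
    case (less i)
    show ?case
    proof (cases "i < n")
      case True
      have ge: "i \<le> \<pi> i"
      proof (rule ccontr)
        assume "\<not> i \<le> \<pi> i"
        then have "\<pi> (\<pi> i) = \<pi> i" "\<pi> i \<noteq> i" using less by auto
        then show False using permutes_inj[OF \<pi>] by (auto dest: injD)
      qed
      obtain k where k: "\<pi> k = i" using permutes_surj[OF \<pi>] by (metis surjD)
      have "\<not> i < \<pi> i"
      proof
        assume lt: "i < \<pi> i"
        have "k < n" using k True permutes_in_image[OF \<pi>, of k] by simp
        have "\<not> k < i" using less.IH[of k] k by auto
        moreover have "k \<noteq> i" using lt k by auto
        ultimately have "\<pi> i < \<pi> k" using mono[OF _ \<open>k < n\<close>, of i] by simp
        then show False using lt k by simp
      qed
      then show ?thesis using ge by simp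
    next
      case False then show ?thesis using permutes_not_in[OF \<pi>] by simp
    qed
  qed
qed

lemma finite_parts2: "finite (parts2 n)"
  by (rule finite_subset[of _ "Pow {..<n}"]) (auto simp: parts2_def)

text \<open>Degrees depend only on the size of the subset, for the sake of symmetry, and this is
  where the binomial coefficients enter.\<close>

lemma sum_parts2:
  fixes a :: "nat \<Rightarrow> int"
  shows "(\<Sum>I\<in>parts2 n. a (card I)) = (\<Sum>j\<in>{1..<n}. a j * int (n choose j))"
proof -
  have "card I \<in> {1..<n}" if "I \<in> parts2 n" for I
  proof -
    have "finite I" "I \<subset> {..<n}" "I \<noteq> {}" using that finite_subset by (auto simp: parts2_def)
    then show ?thesis using psubset_card_mono[of "{..<n}" I] by (simp add: card_gt_0_iff Suc_le_eq)
  qed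
  then have "(\<Sum>I\<in>parts2 n. a (card I)) = (\<Sum>j\<in>{1..<n}. \<Sum>I\<in>{I \<in> parts2 n. card I = j}. a (card I))"
    by (intro sum.group[symmetric] finite_parts2) auto
  also have "\<dots> = (\<Sum>j\<in>{1..<n}. a j * int (n choose j))"
  proof (rule sum.cong[OF refl])
    fix j assume j: "j \<in> {1..<n}"
    then have "{I \<in> parts2 n. card I = j} = {I. I \<subseteq> {..<n} \<and> card I = j}" by (auto simp: parts2_def)
    then have "card {I \<in> parts2 n. card I = j} = n choose j" using n_subsets[of "{..<n}" j] by simp
    then show "(\<Sum>I\<in>{I \<in> parts2 n. card I = j}. a (card I)) = a j * int (n choose j)" by simp
  qed
  finally show ?thesis .
qed

text \<open>The sign of the \<open>plane1\<close> component tells whether \<open>n - 1\<close> lies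
  in the subset. For equal signs, cross-multiplication eliminates the factors, and the digits in the
  \<open>plane2\<close> component determine the subset or its complement.\<close>

lemma parts2_rays:
  assumes n: "n \<ge> 6" and I: "I \<in> parts2 n" "I' \<in> parts2 n" and ab: "\<alpha> > 0" "\<beta> > 0"
    and eq: "\<alpha> * inner (axisv n I) (fvec n (plane1 n)) = \<beta> * inner (axisv n I') (fvec n (plane1 n))"
      "\<alpha> * inner (axisv n I) (fvec n (plane2 n)) = \<beta> * inner (axisv n I') (fvec n (plane2 n))"
  shows "I = I'"
proof -
  have n0: "n > 0" using n by simp
  have S: "I \<subseteq> {..<n}" "I' \<subseteq> {..<n}" using I by (auto simp: parts2_def)
  have cross: "K = K'" if K: "K \<subseteq> {..<n}" "K' \<subseteq> {..<n}" "K \<noteq> {}" "K' \<noteq> {}"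
    and e: "\<alpha> * real (card K) = \<beta> * real (card K')" "\<alpha> * real (\<Sum>i\<in>K. (n + 1) ^ i) = \<beta> * real (\<Sum>i\<in>K'. (n + 1) ^ i)" for K K'
  proof (rule subset_sums_distinct[OF K, of "n + 1"])
    have "(\<alpha> * \<beta>) * (real (card K') * real (\<Sum>i\<in>K. (n + 1) ^ i)) = (\<beta> * real (card K')) * (\<alpha> * real (\<Sum>i\<in>K. (n + 1) ^ i))" by (simp only: ac_simps)
    also have "\<dots> = (\<alpha> * real (card K)) * (\<beta> * real (\<Sum>i\<in>K'. (n + 1) ^ i))" by (simp only: e)
    also have "\<dots> = (\<alpha> * \<beta>) * (real (card K) * real (\<Sum>i\<in>K'. (n + 1) ^ i))" by (simp only: ac_simps)
    finally have "real (card K') * real (\<Sum>i\<in>K. (n + 1) ^ i) = real (card K) * real (\<Sum>i\<in>K'. (n + 1) ^ i)" using ab by simp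
    then show "card K' * (\<Sum>i\<in>K. (n + 1) ^ i) = card K * (\<Sum>i\<in>K'. (n + 1) ^ i)" by (simp only: of_nat_mult[symmetric] of_nat_eq_iff)
  qed simp
  have pos: "real (card K) > 0" if "K \<subseteq> {..<n}" "K \<noteq> {}" for K using that finite_subset by (fastforce simp: card_gt_0_iff)
  have ne: "I \<noteq> {}" "I' \<noteq> {}" "{..<n} - I \<noteq> {}" "{..<n} - I' \<noteq> {}" using I by (auto simp: parts2_def)
  have i1: "inner (axisv n I) (fvec n (plane1 n)) = (\<Sum>i\<in>I. plane1 n i)" "inner (axisv n I) (fvec n (plane2 n)) = (\<Sum>i\<in>I. plane2 n i)"
    "inner (axisv n I') (fvec n (plane1 n)) = (\<Sum>i\<in>I'. plane1 n i)" "inner (axisv n I') (fvec n (plane2 n)) = (\<Sum>i\<in>I'. plane2 n i)"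
    using inner_axisv[OF S(1)] inner_axisv[OF S(2)] sum_plane1[OF n0] sum_plane2[OF n0] by blast+
  note e = eq[unfolded i1]
  consider "n - 1 \<notin> I" "n - 1 \<notin> I'" | "n - 1 \<in> I" "n - 1 \<in> I'" | "n - 1 \<notin> I" "n - 1 \<in> I'" | "n - 1 \<in> I" "n - 1 \<notin> I'" by blast
  then show ?thesis
  proof cases
    case 1
    then show ?thesis using e sum_plane_in(1)[OF S(1) n0] sum_plane_in(1)[OF S(2) n0] by (intro cross[OF S ne(1,2)]) simp_all
  next
    case 2
    have "{..<n} - I = {..<n} - I'"
    proof (rule cross)
      have a: "\<alpha> * - real (card ({..<n} - I)) = \<beta> * - real (card ({..<n} - I'))"
        "\<alpha> * - real (\<Sum>i\<in>{..<n} - I. (n + 1) ^ i) = \<beta> * - real (\<Sum>i\<in>{..<n} - I'. (n + 1) ^ i)"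
        using e unfolding conjunct1[OF sum_plane_in(2)[OF S(1) n0 2(1)]] conjunct1[OF sum_plane_in(2)[OF S(2) n0 2(2)]]
          conjunct2[OF sum_plane_in(2)[OF S(1) n0 2(1)]] conjunct2[OF sum_plane_in(2)[OF S(2) n0 2(2)]] by blast+
      show "\<alpha> * real (card ({..<n} - I)) = \<beta> * real (card ({..<n} - I'))" using a(1) by linarith
      show "\<alpha> * real (\<Sum>i\<in>{..<n} - I. (n + 1) ^ i) = \<beta> * real (\<Sum>i\<in>{..<n} - I'. (n + 1) ^ i)" using a(2) by linarith
    qed (use ne in auto)
    then show ?thesis using S by blast
  next
    case 3
    have "\<alpha> * real (card I) = \<beta> * - real (card ({..<n} - I'))"
      using e(1) sum_plane_in(1)[OF S(1) n0 3(1)] sum_plane_in(2)[OF S(2) n0 3(2)] by simp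
    moreover have "\<alpha> * real (card I) > 0" "\<beta> * real (card ({..<n} - I')) > 0" using ab pos S ne by (simp_all add: card_gt_0_iff)
    ultimately show ?thesis by simp
  next
    case 4
    have "\<alpha> * - real (card ({..<n} - I)) = \<beta> * real (card I')"
      using e(1) sum_plane_in(2)[OF S(1) n0 4(1)] sum_plane_in(1)[OF S(2) n0 4(2)] by simp
    moreover have "\<beta> * real (card I') > 0" "\<alpha> * real (card ({..<n} - I)) > 0" using ab pos[OF S(2) ne(2)] pos[of "{..<n} - I"] ne by simp_all
    ultimately show ?thesis by simp
  qed
qed

text \<open>Against \<open>plane1\<close> the edge gives 0 and the axis does not; against
  \<open>plane2\<close> the edge does not give 0. A vanishing determinant with respect to
  \<open>E1\<close> and \<open>E2\<close> would yield combinations \<open>x\<close> and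
  \<open>y\<close> orthogonal to the plane, contradicting this.\<close>

lemma parts2_indep:
  assumes n: "n \<ge> 6" and I: "I \<in> parts2 n"
    and E: "\<And>x. inner x E1 = 0 \<Longrightarrow> inner x E2 = 0 \<Longrightarrow> inner x (fvec n (plane1 n)) = 0 \<and> inner x (fvec n (plane2 n)) = 0"
  shows "inner (sgn (axisv n I)) E1 * inner (sgn (edgev n I)) E2 \<noteq> inner (sgn (axisv n I)) E2 * inner (sgn (edgev n I)) E1"
proof
  let ?V = "sgn (axisv n I)" and ?e = "sgn (edgev n I)"
  assume eq: "inner ?V E1 * inner ?e E2 = inner ?V E2 * inner ?e E1"
  have n0: "n > 0" using n by simp
  have S: "I \<subseteq> {..<n}" using I by (auto simp: parts2_def)
  have o: "norm ?V = 1" "norm ?e = 1" using parts2_onpair[OF n I] by (auto simp: onpair_def)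
  then have nz: "axisv n I \<noteq> 0" "edgev n I \<noteq> 0" by auto
  let ?m1 = "Min (blk n I)" and ?m2 = "Min (blk n I - {Min (blk n I)})"
  have m: "?m1 < n - 1" "?m2 < n - 1" "?m1 \<noteq> ?m2" using blk_mins[OF n I] by auto
  have ec1: "inner (edgev n I) (fvec n (plane1 n)) = 0" unfolding inner_edgev[OF n I] using m by (simp add: plane1_def)
  have ec2: "inner (edgev n I) (fvec n (plane2 n)) \<noteq> 0" unfolding inner_edgev[OF n I] using m n
    by (simp add: plane2_def power_inject_exp)
  have fin: "finite I" using S finite_subset by blast
  have ne: "I \<noteq> {}" "{..<n} - I \<noteq> {}" using I by (auto simp: parts2_def)
  have ac1: "inner (axisv n I) (fvec n (plane1 n)) \<noteq> 0"
    unfolding inner_axisv[OF S sum_plane1[OF n0]] using sum_plane_in[OF S n0] fin ne by (cases "n - 1 \<in> I") auto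
  define x where "x = inner ?e E1 *\<^sub>R ?V - inner ?V E1 *\<^sub>R ?e"
  have "inner x E1 = 0" "inner x E2 = 0" using eq by (simp_all add: x_def inner_diff_left mult.commute)
  from E[OF this] have x: "inner x (fvec n (plane1 n)) = 0" "inner x (fvec n (plane2 n)) = 0" by auto
  have "inner ?e E1 = 0" using x(1) ec1 ac1 nz by (simp add: x_def inner_diff_left sgn_div_norm)
  moreover from this have V0: "inner ?V E1 = 0" using x(2) ec2 nz by (simp add: x_def inner_diff_left sgn_div_norm)
  ultimately have "inner ?V E2 * inner ?e E1 = 0" by simp
  have "inner ?e E2 \<noteq> 0" using E[of ?e] \<open>inner ?e E1 = 0\<close> ec2 nz by (auto simp: sgn_div_norm)
  define y where "y = ?V - (inner ?V E2 / inner ?e E2) *\<^sub>R ?e"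
  have "inner y E1 = 0" "inner y E2 = 0" using V0 \<open>inner ?e E1 = 0\<close> \<open>inner ?e E2 \<noteq> 0\<close> by (simp_all add: y_def inner_diff_left)
  then have "inner y (fvec n (plane1 n)) = 0" using E by blast
  then show False using ec1 ac1 nz by (simp add: y_def inner_diff_left sgn_div_norm)
qed

lemma fperm_axisv:
  assumes \<pi>: "\<pi> permutes {..<n}"
  shows "fperm \<pi> (axisv n I) = axisv n (inv \<pi> ` I)"
proof (rule fseq_eqI)
  fix i
  have b: "bij \<pi>" by (rule permutes_bij[OF \<pi>])
  have "card (inv \<pi> ` I) = card I" using b by (intro card_image) (meson bij_imp_bij_inv bij_is_inj inj_on_subset subset_UNIV)
  moreover have "i \<in> inv \<pi> ` I \<longleftrightarrow> \<pi> i \<in> I" using b by (auto simp: image_iff bij_inv_eq_iff)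
  moreover have "\<pi> i < n \<longleftrightarrow> i < n" using permutes_in_image[OF \<pi>, of i] by simp
  ultimately show "fnth (fperm \<pi> (axisv n I)) i = fnth (axisv n (inv \<pi> ` I)) i"
    by (simp add: fnth_fperm[OF b] axisv_def)
qed

lemma Min_inv_image:
  assumes b: "bij \<pi>" and B: "finite B" "B \<noteq> {}" and mono: "\<And>i k. i < k \<Longrightarrow> \<pi> i \<in> B \<Longrightarrow> \<pi> k \<in> B \<Longrightarrow> \<pi> i < \<pi> (k::nat)"
  shows "Min (inv \<pi> ` B) = inv \<pi> (Min B)"
proof (rule Min_eqI)
  show "finite (inv \<pi> ` B)" "inv \<pi> (Min B) \<in> inv \<pi> ` B" using B by auto
  fix y assume "y \<in> inv \<pi> ` B"
  then obtain x where x: "x \<in> B" "y = inv \<pi> x" by blast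
  have p: "\<pi> (inv \<pi> z) = z" for z using b by (simp add: bij_is_surj surj_f_inv_f)
  show "inv \<pi> (Min B) \<le> y"
  proof (rule ccontr)
    assume "\<not> ?thesis"
    then have "\<pi> y < \<pi> (inv \<pi> (Min B))" using x B p by (intro mono) auto
    then have "x < Min B" unfolding x(2) p .
    then show False using Min_le[OF B(1) x(1)] by simp
  qed
qed

lemma fperm_edgev:
  assumes n: "n \<ge> 6" and I: "I \<in> parts2 n" and \<pi>: "\<pi> permutes {..<n}"
    and mono: "\<And>i k. i < k \<Longrightarrow> k < n \<Longrightarrow> (\<pi> i \<in> I \<longleftrightarrow> \<pi> k \<in> I) \<Longrightarrow> \<pi> i < \<pi> k"
  shows "fperm \<pi> (edgev n I) = edgev n (inv \<pi> ` I)"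
proof -
  have b: "bij \<pi>" by (rule permutes_bij[OF \<pi>])
  have ib: "bij (inv \<pi>)" by (rule bij_imp_bij_inv[OF b])
  have ci: "card (inv \<pi> ` I) = card I" using bij_is_inj[OF ib] by (intro card_image) (rule inj_on_subset, auto)
  have "inv \<pi> ` {..<n} = {..<n}" by (rule permutes_image[OF permutes_inv[OF \<pi>]])
  then have blk: "blk n (inv \<pi> ` I) = inv \<pi> ` blk n I"
    unfolding blk_def ci using image_set_diff[OF bij_is_inj[OF ib], of "{..<n}" I] by simp
  let ?B = "blk n I"
  let ?m1 = "Min ?B" and ?m2 = "Min (?B - {Min ?B})"
  note B = blk_mins[OF n I]
  have mB: "\<pi> i < \<pi> k" if "i < k" "\<pi> i \<in> ?B" "\<pi> k \<in> ?B" for i k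
  proof (rule mono[OF that(1)])
    have "\<pi> k < n" using B(6) that by auto
    then show "k < n" using permutes_in_image[OF \<pi>, of k] by simp
    show "\<pi> i \<in> I \<longleftrightarrow> \<pi> k \<in> I" using that by (auto simp: blk_def split: if_splits)
  qed
  have m1: "Min (blk n (inv \<pi> ` I)) = inv \<pi> ?m1"
    unfolding blk by (rule Min_inv_image[OF b B(5)]) (use B mB in auto)
  have "blk n (inv \<pi> ` I) - {inv \<pi> ?m1} = inv \<pi> ` (?B - {?m1})"
    unfolding blk using image_set_diff[OF bij_is_inj[OF ib], of ?B "{?m1}"] by simp
  then have m2: "Min (blk n (inv \<pi> ` I) - {Min (blk n (inv \<pi> ` I))}) = inv \<pi> ?m2"
    unfolding m1 by (simp only:) (rule Min_inv_image[OF b], use B mB in auto)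
  have iff: "\<pi> i = m \<longleftrightarrow> i = inv \<pi> m" for i m using b by (metis bij_inv_eq_iff)
  show ?thesis
  proof (rule fseq_eqI)
    fix i
    have "\<pi> i < n \<longleftrightarrow> i < n" using permutes_in_image[OF \<pi>, of i] by simp
    then show "fnth (fperm \<pi> (edgev n I)) i = fnth (edgev n (inv \<pi> ` I)) i"
      unfolding fnth_fperm[OF b] edgev_def fnth_fvec m2 unfolding m1 iff by simp
  qed
qed

theorem partially_equivariant_map:
  fixes n :: nat
  assumes n2: "n \<ge> 2" and np: "\<And>p e. prime p \<Longrightarrow> n \<noteq> p ^ e"
  shows "\<exists>g. continuous_on (sumzero n) g \<and> (\<forall>z\<in>sumzero n. g z \<in> sumzero n - {0}) \<and>
    (\<forall>z\<in>sumzero n. \<forall>\<pi>. \<pi> permutes {..<n} \<longrightarrow> (\<forall>i k. i < k \<longrightarrow> k < n \<longrightarrow> \<bar>fnth z (\<pi> i) - fnth z (\<pi> k)\<bar> < 2 \<longrightarrow> \<pi> i < \<pi> k)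
      \<longrightarrow> g (fperm \<pi> z) = fperm \<pi> (g z))"
proof -
  \<comment> \<open>The numbers from 2 to 5 are prime powers.\<close>
  have n: "n \<ge> 6"
  proof (rule ccontr)
    assume "\<not> n \<ge> 6"
    then have "n = 2 \<or> n = 3 \<or> n = 4 \<or> n = 5" using n2 by auto
    moreover have "prime (2::nat)" "prime (3::nat)" "prime (5::nat)" by simp_all
    ultimately show False using np[of 2 1] np[of 3 1] np[of 2 2] np[of 5 1] by auto
  qed
  then have n0: "n > 0" by simp
  obtain a where a: "(\<Sum>j\<in>{1..<n}. a j * int (n choose j)) = -1" using binomial_combination[OF n2 np] by blast
  obtain E1 E2 where E: "E1 \<in> sumzero n" "E2 \<in> sumzero n" "onpair E1 E2"
    and Ec: "\<And>x. inner x E1 = 0 \<Longrightarrow> inner x E2 = 0 \<Longrightarrow> inner x (fvec n (plane1 n)) = 0 \<and> inner x (fvec n (plane2 n)) = 0"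
    using plane_orthonormal[OF n] by blast
  define V where "V I = sgn (axisv n I)" for I
  define e where "e I = sgn (edgev n I)" for I
  have o: "onpair (V I) (e I)" if "I \<in> parts2 n" for I unfolding V_def e_def by (rule parts2_onpair[OF n that])
  have "\<exists>\<delta> G. 0 < \<delta> \<and> \<delta> \<le> 1/8 \<and> continuous_on (sumzero n) G \<and> (\<forall>z\<in>sumzero n. G z \<in> sumzero n - {0}) \<and>
    (\<forall>z\<in>sumzero n. norm z \<ge> 1 \<longrightarrow> G z = z + (\<Sum>I\<in>parts2 n. bubble \<delta> (V I) (e I) (a (card I)) z))"
  proof (rule bubble_extension[OF finite_parts2 subspace_sumzero E])
    fix I assume I: "I \<in> parts2 n"
    then have S: "I \<subseteq> {..<n}" by (simp add: parts2_def)
    show "V I \<in> sumzero n" unfolding V_def sgn_div_norm by (intro subspace_mul subspace_sumzero axisv_sumzero S n0)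
    show "e I \<in> sumzero n" unfolding e_def sgn_div_norm by (intro subspace_mul subspace_sumzero edgev_sumzero n I)
    show "onpair (V I) (e I)" by (rule o[OF I])
    show "inner (V I) E1 * inner (e I) E2 \<noteq> inner (V I) E2 * inner (e I) E1"
      unfolding V_def e_def by (rule parts2_indep[OF n I Ec])
    fix I' and r :: real assume I': "I' \<in> parts2 n" "I \<noteq> I'" and r: "r > 0"
      and eq: "inner (V I) E1 = r * inner (V I') E1" "inner (V I) E2 = r * inner (V I') E2"
    have nz: "norm (axisv n I) > 0" "norm (axisv n I') > 0" using o[OF I] o[OF I'(1)] by (auto simp: onpair_def V_def norm_sgn split: if_splits)
    have "inner (V I - r *\<^sub>R V I') E1 = 0" "inner (V I - r *\<^sub>R V I') E2 = 0" using eq by (simp_all add: inner_diff_left)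
    from Ec[OF this] have "inverse (norm (axisv n I)) * inner (axisv n I) (fvec n (plane1 n)) = r * inverse (norm (axisv n I')) * inner (axisv n I') (fvec n (plane1 n))"
      "inverse (norm (axisv n I)) * inner (axisv n I) (fvec n (plane2 n)) = r * inverse (norm (axisv n I')) * inner (axisv n I') (fvec n (plane2 n))"
      by (simp_all add: inner_diff_left V_def sgn_div_norm)
    then have "I = I'" by (intro parts2_rays[OF n I I'(1)]) (use nz r in auto)
    then show False using I'(2) by simp
  next
    show "(\<Sum>I\<in>parts2 n. a (card I)) = -1" unfolding sum_parts2 by (rule a)
  qed
  then obtain \<delta> G where \<delta>: "0 < \<delta>" "\<delta> \<le> 1/8" and G: "continuous_on (sumzero n) G" "\<forall>z\<in>sumzero n. G z \<in> sumzero n - {0}"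
    and Gout: "\<And>z. z \<in> sumzero n \<Longrightarrow> norm z \<ge> 1 \<Longrightarrow> G z = z + (\<Sum>I\<in>parts2 n. bubble \<delta> (V I) (e I) (a (card I)) z)"
    by blast
  have "G (fperm \<pi> z) = fperm \<pi> (G z)"
    if z: "z \<in> sumzero n" and \<pi>: "\<pi> permutes {..<n}"
      and mono: "\<And>i k. i < k \<Longrightarrow> k < n \<Longrightarrow> \<bar>fnth z (\<pi> i) - fnth z (\<pi> k)\<bar> < 2 \<Longrightarrow> \<pi> i < \<pi> k" for z \<pi>
  proof -
    have b: "bij \<pi>" by (rule permutes_bij[OF \<pi>])
    have iso: "inner (fperm \<pi> x) (fperm \<pi> y) = inner x y" for x y by (rule inner_fperm[OF b])
    have lin: "linear (fperm \<pi>)" by (rule linear_fperm[OF b])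
    have nrm: "norm (fperm \<pi> x) = norm x" for x by (simp add: norm_eq_sqrt_inner iso)
    have sgnp: "fperm \<pi> (sgn x) = sgn (fperm \<pi> x)" for x by (simp add: sgn_div_norm nrm linear_scale[OF lin])
    show ?thesis
    proof (cases "norm z \<ge> 1")
      case False
      have "\<bar>fnth z i - fnth z k\<bar> < 2" for i k using abs_fnth_le_norm[of z i] abs_fnth_le_norm[of z k] False by linarith
      then have "\<pi> = id" using permutes_increasing_id[OF \<pi>] mono by blast
      moreover have "fperm id x = x" for x by (intro fseq_eqI) (simp add: fnth_fperm)
      ultimately show ?thesis by simp
    next
      case True
      have inP: "inv \<pi> ` I \<in> parts2 n" if "I \<in> parts2 n" for I
      proof -
        have ii: "inv \<pi> ` {..<n} = {..<n}" by (rule permutes_image[OF permutes_inv[OF \<pi>]])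
        have inj: "inj (inv \<pi>)" by (rule permutes_inj[OF permutes_inv[OF \<pi>]])
        have "inv \<pi> ` I \<noteq> inv \<pi> ` {..<n}" using that inj_image_eq_iff[OF inj] by (auto simp: parts2_def)
        then show ?thesis using that image_mono[of I "{..<n}" "inv \<pi>"] unfolding ii parts2_def by auto
      qed
      have cardI: "card (inv \<pi> ` I) = card I" for I
        using bij_is_inj[OF bij_imp_bij_inv[OF b]] by (intro card_image) (rule inj_on_subset, auto)
      have Vp: "fperm \<pi> (V I) = V (inv \<pi> ` I)" for I by (simp add: V_def sgnp fperm_axisv[OF \<pi>])
      have key: "fperm \<pi> (bubble \<delta> (V I) (e I) (a (card I)) z) = bubble \<delta> (V (inv \<pi> ` I)) (e (inv \<pi> ` I)) (a (card I)) (fperm \<pi> z)"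
        if I: "I \<in> parts2 n" for I
      proof -
        have iso_b: "fperm \<pi> (bubble \<delta> (V I) (e I) (a (card I)) z) = bubble \<delta> (V (inv \<pi> ` I)) (fperm \<pi> (e I)) (a (card I)) (fperm \<pi> z)"
          unfolding Vp[symmetric] by (rule bubble_isometry[OF lin iso, symmetric])
        show ?thesis
        \<comment> \<open>Nearness to the whole line is tested, a condition that
          \<open>fperm \<pi>\<close> transports; so in the second case both bubbles vanish.\<close>
        proof (cases "\<exists>s. norm (z - s *\<^sub>R V I) < 2 * \<delta>")
          case near: True
          then obtain s where s: "norm (z - s *\<^sub>R V I) < 2 * \<delta>" by blast
          have Vc: "fnth (V I) i = fnth (V I) k" if "i < n" "k < n" "i \<in> I \<longleftrightarrow> k \<in> I" for i k
            using that by (simp add: V_def sgn_div_norm axisv_def)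
          have "\<pi> i < \<pi> k" if ik: "i < k" "k < n" "\<pi> i \<in> I \<longleftrightarrow> \<pi> k \<in> I" for i k
          proof (rule mono[OF ik(1,2)])
            have lt: "\<pi> i < n" "\<pi> k < n" using permutes_in_image[OF \<pi>, of i] permutes_in_image[OF \<pi>, of k] ik by auto
            have "fnth z (\<pi> i) - fnth z (\<pi> k) = fnth (z - s *\<^sub>R V I) (\<pi> i) - fnth (z - s *\<^sub>R V I) (\<pi> k)"
              using Vc[OF lt ik(3)] by simp
            then show "\<bar>fnth z (\<pi> i) - fnth z (\<pi> k)\<bar> < 2"
              using abs_fnth_le_norm[of "z - s *\<^sub>R V I" "\<pi> i"] abs_fnth_le_norm[of "z - s *\<^sub>R V I" "\<pi> k"] s \<delta>(2) by linarith
          qed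
          then have "fperm \<pi> (e I) = e (inv \<pi> ` I)" unfolding e_def sgnp by (subst fperm_edgev[OF n I \<pi>]) auto
          then show ?thesis using iso_b by simp
        next
          case far: False
          have "bubble \<delta> (V I) (e I) (a (card I)) z = 0"
            using bubble_active(2)[OF o[OF I] \<delta>(1)] far by blast
          moreover have "bubble \<delta> (V (inv \<pi> ` I)) (e (inv \<pi> ` I)) (a (card I)) (fperm \<pi> z) = 0"
          proof (rule ccontr)
            let ?s = "inner (fperm \<pi> z) (V (inv \<pi> ` I))"
            assume "\<not> ?thesis"
            from bubble_active(2)[OF o[OF inP[OF I]] \<delta>(1) this] have "norm (fperm \<pi> z - ?s *\<^sub>R V (inv \<pi> ` I)) < 2 * \<delta>" .
            moreover have "fperm \<pi> z - ?s *\<^sub>R V (inv \<pi> ` I) = fperm \<pi> (z - ?s *\<^sub>R V I)"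
              by (simp add: Vp[symmetric] linear_diff[OF lin] linear_scale[OF lin])
            ultimately show False using far by (metis nrm)
          qed
          ultimately show ?thesis by (simp add: linear_0[OF lin])
        qed
      qed
      have "fperm \<pi> (G z) = fperm \<pi> z + (\<Sum>I\<in>parts2 n. bubble \<delta> (V (inv \<pi> ` I)) (e (inv \<pi> ` I)) (a (card I)) (fperm \<pi> z))"
        unfolding Gout[OF z True] linear_add[OF lin] linear_sum[OF lin] using key by simp
      also have "(\<Sum>I\<in>parts2 n. bubble \<delta> (V (inv \<pi> ` I)) (e (inv \<pi> ` I)) (a (card I)) (fperm \<pi> z))
          = (\<Sum>I\<in>parts2 n. bubble \<delta> (V I) (e I) (a (card I)) (fperm \<pi> z))"
      proof -
        have "inj_on (image (inv \<pi>)) (parts2 n)"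
          using permutes_inj[OF permutes_inv[OF \<pi>]] by (intro inj_onI) (simp add: inj_image_eq_iff)
        then have bij: "bij_betw (image (inv \<pi>)) (parts2 n) (parts2 n)"
          unfolding bij_betw_def using inP finite_parts2 by (metis endo_inj_surj image_subsetI)
        show ?thesis using sum.reindex_bij_betw[OF bij, of "\<lambda>I. bubble \<delta> (V I) (e I) (a (card I)) (fperm \<pi> z)"] by (simp add: cardI)
      qed
      also have "fperm \<pi> z + \<dots> = G (fperm \<pi> z)"
        using Gout[OF fperm_sumzero[OF \<pi> z]] True by (simp add: nrm)
      finally show ?thesis by simp
    qed
  qed
  then show ?thesis using G by (intro exI[of _ G]) blast
qed

section \<open>Planar configurations\<close>

lemma sorting_permutation:
  fixes h :: "nat \<Rightarrow> real"
  shows "\<exists>s. s permutes {..<n} \<and> (\<forall>i k. i < k \<longrightarrow> k < n \<longrightarrow> h (s i) \<le> h (s k))"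
proof -
  define xs where "xs = sort_key h [0..<n]"
  have len: "length xs = n" and dis: "distinct xs" by (simp_all add: xs_def)
  have "set xs = {..<n}" by (simp add: xs_def lessThan_atLeast0)
  have so: "sorted (map h xs)" by (simp add: xs_def)
  define s where "s i = (if i < n then xs ! i else i)" for i
  have "bij_betw (\<lambda>i. xs ! i) {..<n} {..<n}" by (rule bij_betw_nth[OF dis]) (simp_all add: len \<open>set xs = {..<n}\<close>)
  then have "bij_betw s {..<n} {..<n}" by (rule bij_betw_cong[THEN iffD1, rotated]) (simp add: s_def)
  then have "s permutes {..<n}" by (rule bij_imp_permutes) (simp add: s_def)
  moreover have "h (s i) \<le> h (s k)" if "i < k" "k < n" for i k
    using sorted_nth_mono[OF so, of i k] that len by (simp add: s_def)
  ultimately show ?thesis by blast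
qed

lemma continuous_on_UN_closed:
  assumes "finite K" "\<And>s. s \<in> K \<Longrightarrow> closed (C s)" "\<And>s. s \<in> K \<Longrightarrow> continuous_on (D \<inter> C s) f"
  shows "continuous_on (D \<inter> (\<Union>s\<in>K. C s)) f"
  using assms
proof (induction K rule: finite_induct)
  case (insert x K)
  have c: "closed (\<Union>s\<in>K. C s)" using insert by (intro closed_UN) auto
  have "continuous_on ((D \<inter> C x) \<union> (D \<inter> (\<Union>s\<in>K. C s))) f"
  proof (rule continuous_on_Un_local)
    show "closedin (top_of_set (D \<inter> C x \<union> D \<inter> (\<Union>s\<in>K. C s))) (D \<inter> C x)"
      unfolding closedin_closed using insert by (intro exI[of _ "C x"]) auto
    show "closedin (top_of_set (D \<inter> C x \<union> D \<inter> (\<Union>s\<in>K. C s))) (D \<inter> (\<Union>s\<in>K. C s))"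
      unfolding closedin_closed using c by (intro exI[of _ "\<Union>s\<in>K. C s"]) auto
  qed (use insert in auto)
  then show ?case by (simp add: Int_Un_distrib)
qed simp

text \<open>After scaling, two points whose real parts differ by less than 2 have distinct imaginary parts; so the order of the
  imaginary parts is unambiguous on close real parts, where the map of \<open>partially_equivariant_map\<close> depends on it.\<close>

definition spread_scale :: "nat \<Rightarrow> (nat \<Rightarrow> complex) \<Rightarrow> real" where
  "spread_scale n p = 2 * (1 + (\<Sum>i<n. \<Sum>k<n. if i = k then 0 else 1 / norm (p i - p k)))"

definition real_parts :: "nat \<Rightarrow> (nat \<Rightarrow> complex) \<Rightarrow> fseq" where
  "real_parts n p = fvec n (\<lambda>i. spread_scale n p * (Re (p i) - (\<Sum>k<n. Re (p k)) / real n))"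

lemma spread_scale_ge:
  assumes "inj_on p {..<n}" "i < n" "k < n" "i \<noteq> k"
  shows "2 \<le> spread_scale n p * norm (p i - p k)"
proof -
  have nz: "norm (p i - p k) > 0" using assms by (auto dest: inj_onD)
  have "1 / norm (p i - p k) \<le> (\<Sum>k'<n. if i = k' then 0 else 1 / norm (p i - p k'))"
    using member_le_sum[of k "{..<n}" "\<lambda>k'. if i = k' then 0 else 1 / norm (p i - p k')"] assms by simp
  also have "\<dots> \<le> (\<Sum>i<n. \<Sum>k<n. if i = k then 0 else 1 / norm (p i - p k))"
    by (rule member_le_sum[of i "{..<n}" "\<lambda>i. \<Sum>k<n. if i = k then 0 else 1 / norm (p i - p k)"]) (use assms in \<open>auto intro!: sum_nonneg\<close>)
  finally have "2 * (1 / norm (p i - p k)) \<le> spread_scale n p" by (simp add: spread_scale_def)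
  then have "2 * (1 / norm (p i - p k)) * norm (p i - p k) \<le> spread_scale n p * norm (p i - p k)"
    using nz by (intro mult_right_mono) auto
  then show ?thesis using nz by simp
qed

lemma real_parts_sumzero: "n > 0 \<Longrightarrow> real_parts n p \<in> sumzero n"
  by (simp add: sumzero_def real_parts_def sum_subtractf flip: sum_distrib_left)

lemma continuous_on_real_parts: "continuous_on {p. inj_on p {..<n}} (real_parts n)"
proof -
  have coord: "continuous_on {p :: nat \<Rightarrow> complex. inj_on p {..<n}} (\<lambda>p. p i)" for i
    by (rule continuous_on_subset[OF continuous_on_product_coordinates]) simp
  have "continuous_on {p :: nat \<Rightarrow> complex. inj_on p {..<n}} (\<lambda>p. if i = k then 0 else 1 / norm (p i - p k))" if "i < n" "k < n" for i k
  proof (cases "i = k")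
    case False
    then have "\<forall>p\<in>{p :: nat \<Rightarrow> complex. inj_on p {..<n}}. norm (p i - p k) \<noteq> 0"
      using \<open>i < n\<close> \<open>k < n\<close> by (auto dest: inj_onD)
    then have "continuous_on {p :: nat \<Rightarrow> complex. inj_on p {..<n}} (\<lambda>p. 1 / norm (p i - p k))"
      by (intro continuous_on_divide continuous_on_const continuous_on_norm continuous_on_diff coord)
    then show ?thesis using False by simp
  qed simp
  then have "continuous_on {p. inj_on p {..<n}} (spread_scale n)"
    unfolding spread_scale_def[abs_def] by (intro continuous_intros) auto
  then show ?thesis unfolding real_parts_def[abs_def] by (intro continuous_intros coord) auto
qed

lemma spread_scale_perm:
  assumes "\<pi> permutes {..<n}"
  shows "spread_scale n (p \<circ> \<pi>) = spread_scale n p"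
proof -
  have inj: "\<pi> i = \<pi> k \<longleftrightarrow> i = k" for i k using permutes_inj[OF assms] by (auto dest: injD)
  have "(\<Sum>i<n. \<Sum>k<n. if i = k then 0 else 1 / norm (p (\<pi> i) - p (\<pi> k)))
      = (\<Sum>i<n. \<Sum>k<n. if \<pi> i = \<pi> k then 0 else 1 / norm (p (\<pi> i) - p (\<pi> k)))" by (simp only: inj)
  also have "\<dots> = (\<Sum>i<n. \<Sum>k<n. if \<pi> i = k then 0 else 1 / norm (p (\<pi> i) - p k))"
    using sum.permute[OF assms, of "\<lambda>k. if \<pi> i = k then 0 else 1 / norm (p (\<pi> i) - p k)" for i] by (simp add: comp_def)
  also have "\<dots> = (\<Sum>i<n. \<Sum>k<n. if i = k then 0 else 1 / norm (p i - p k))"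
    using sum.permute[OF assms, of "\<lambda>i. \<Sum>k<n. if i = k then 0 else 1 / norm (p i - p k)"] by (simp add: comp_def)
  finally show ?thesis by (simp only: spread_scale_def comp_def)
qed

lemma real_parts_perm:
  assumes "\<pi> permutes {..<n}"
  shows "real_parts n (p \<circ> \<pi>) = fperm \<pi> (real_parts n p)"
proof (rule fseq_eqI)
  fix i
  have "(\<Sum>k<n. Re (p (\<pi> k))) = (\<Sum>k<n. Re (p k))" using sum.permute[OF assms, of "\<lambda>k. Re (p k)"] by (simp add: comp_def)
  moreover have "\<pi> i < n \<longleftrightarrow> i < n" using permutes_in_image[OF assms, of i] by simp
  ultimately show "fnth (real_parts n (p \<circ> \<pi>)) i = fnth (fperm \<pi> (real_parts n p)) i"
    by (simp add: real_parts_def fnth_fperm[OF permutes_bij[OF assms]] spread_scale_perm[OF assms])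
qed

text \<open>The real parts are sorted by the imaginary parts, mapped by \<open>g\<close> and sorted
  back. Two sortings differ only among equal imaginary parts, where the scaled real parts are at
  least 2 apart, so \<open>g\<close> commutes with the difference. Hence the choice of the sorting
  does not matter, which gives equivariance, and continuity by pasting over finitely many closed
  cells.\<close>

theorem planar_configuration_map:
  fixes n :: nat
  assumes n2: "n \<ge> 2" and np: "\<And>p e. prime p \<Longrightarrow> n \<noteq> p ^ e"
  shows "\<exists>F :: (nat \<Rightarrow> complex) \<Rightarrow> nat \<Rightarrow> real.
    (\<forall>i. continuous_on {p. inj_on p {..<n}} (\<lambda>p. F p i)) \<and>
    (\<forall>p i. inj_on p {..<n} \<longrightarrow> \<bar>F p i\<bar> \<le> 1) \<and>
    (\<forall>p. inj_on p {..<n} \<longrightarrow> (\<exists>i<n. \<exists>k<n. F p i \<noteq> F p k)) \<and>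
    (\<forall>p \<pi> i. inj_on p {..<n} \<longrightarrow> \<pi> permutes {..<n} \<longrightarrow> F (p \<circ> \<pi>) i = F p (\<pi> i))"
proof -
  obtain g where g: "continuous_on (sumzero n) g" "\<And>z. z \<in> sumzero n \<Longrightarrow> g z \<in> sumzero n - {0}"
    and eq: "\<And>z \<pi>. z \<in> sumzero n \<Longrightarrow> \<pi> permutes {..<n} \<Longrightarrow> (\<And>i k. i < k \<Longrightarrow> k < n \<Longrightarrow> \<bar>fnth z (\<pi> i) - fnth z (\<pi> k)\<bar> < 2 \<Longrightarrow> \<pi> i < \<pi> k)
        \<Longrightarrow> g (fperm \<pi> z) = fperm \<pi> (g z)"
    using partially_equivariant_map[OF n2 np] by blast
  let ?D = "{p :: nat \<Rightarrow> complex. inj_on p {..<n}}"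
  have n0: "n > 0" using n2 by simp
  define Sorted where "Sorted s p \<longleftrightarrow> s permutes {..<n} \<and> (\<forall>i k. i < k \<longrightarrow> k < n \<longrightarrow> Im (p (s i)) \<le> Im (p (s k)))"
    for s and p :: "nat \<Rightarrow> complex"
  \<comment> \<open>Normalizing by \<open>sgn\<close> bounds the values, as the later damping
    requires.\<close>
  define H where "H s p i = fnth (sgn (g (fperm s (real_parts n p)))) (inv s i)" for s p i
  define F where "F p i = H (SOME s. Sorted s p) p i" for p i
  have ex: "\<exists>s. Sorted s p" for p unfolding Sorted_def using sorting_permutation[of n "\<lambda>i. Im (p i)"] .
  have zW: "fperm s (real_parts n p) \<in> sumzero n" if "s permutes {..<n}" for s p
    by (rule fperm_sumzero[OF that real_parts_sumzero[OF n0]])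
  have H_eq: "H s p i = H s' p i" if p: "inj_on p {..<n}" and s: "Sorted s p" "Sorted s' p" for s s' p i
  proof -
    have perm: "s permutes {..<n}" "s' permutes {..<n}" using s by (auto simp: Sorted_def)
    define \<pi> where "\<pi> = inv s' \<circ> s"
    have \<pi>: "\<pi> permutes {..<n}" unfolding \<pi>_def by (rule permutes_compose[OF perm(1) permutes_inv[OF perm(2)]])
    have s'\<pi>: "s' (\<pi> i) = s i" for i using permutes_inverses[OF perm(2)] by (simp add: \<pi>_def)
    let ?z = "fperm s' (real_parts n p)"
    have "fperm s (real_parts n p) = fperm \<pi> ?z"
      by (rule fseq_eqI) (simp add: fnth_fperm[OF permutes_bij[OF perm(1)]] fnth_fperm[OF permutes_bij[OF perm(2)]] fnth_fperm[OF permutes_bij[OF \<pi>]] s'\<pi>)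
    moreover have "g (fperm \<pi> ?z) = fperm \<pi> (g ?z)"
    proof (rule eq[OF zW[OF perm(2)] \<pi>])
      fix i k assume ik: "i < k" "k < n" and close: "\<bar>fnth ?z (\<pi> i) - fnth ?z (\<pi> k)\<bar> < 2"
      have lt: "s i < n" "s k < n" using permutes_in_image[OF perm(1), of i] permutes_in_image[OF perm(1), of k] ik by auto
      have ne: "s i \<noteq> s k" using permutes_inj[OF perm(1)] ik by (auto dest: injD)
      have "\<bar>spread_scale n p * (Re (p (s i)) - Re (p (s k)))\<bar> < 2"
        using close lt by (simp add: fnth_fperm[OF permutes_bij[OF perm(2)]] s'\<pi> real_parts_def algebra_simps)
      moreover have "spread_scale n p \<ge> 0" unfolding spread_scale_def by (auto intro!: sum_nonneg add_nonneg_nonneg)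
      ultimately have "spread_scale n p * \<bar>Re (p (s i) - p (s k))\<bar> < 2" by (simp add: abs_mult)
      then have "Im (p (s i)) \<noteq> Im (p (s k))"
        using spread_scale_ge[OF p lt ne] by (auto simp: cmod_eq_Re)
      then have l: "Im (p (s i)) < Im (p (s k))" using s(1) ik unfolding Sorted_def by (metis order_less_le)
      show "\<pi> i < \<pi> k"
      proof (rule ccontr)
        assume "\<not> ?thesis"
        moreover have "\<pi> i \<noteq> \<pi> k" using permutes_inj[OF \<pi>] ik by (auto dest: injD)
        ultimately have "\<pi> k < \<pi> i" by simp
        moreover have "\<pi> i < n" using permutes_in_image[OF \<pi>, of i] ik by simp
        ultimately have "Im (p (s' (\<pi> k))) \<le> Im (p (s' (\<pi> i)))" using s(2) unfolding Sorted_def by blast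
        then show False using l by (simp add: s'\<pi>)
      qed
    qed
    moreover have "norm (fperm \<pi> x) = norm x" for x by (simp add: norm_eq_sqrt_inner inner_fperm[OF permutes_bij[OF \<pi>]])
    moreover have "\<pi> (inv s i) = inv s' i" using permutes_inverses[OF perm(1)] by (simp add: \<pi>_def)
    ultimately show ?thesis by (simp add: H_def sgn_div_norm fnth_fperm[OF permutes_bij[OF \<pi>]])
  qed
  have F_eq: "F p i = H s p i" if "inj_on p {..<n}" "Sorted s p" for p s i
    unfolding F_def by (rule H_eq[OF that(1) someI_ex[OF ex] that(2)])
  have gn: "norm (sgn (g z)) = 1" if "z \<in> sumzero n" for z using g(2)[OF that] by (simp add: norm_sgn)
  have cont: "continuous_on ?D (\<lambda>p. F p i)" for i
  proof -
    let ?C = "\<lambda>s. {p :: nat \<Rightarrow> complex. \<forall>i k. i < k \<longrightarrow> k < n \<longrightarrow> Im (p (s i)) \<le> Im (p (s k))}"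
    have c: "continuous_on UNIV (\<lambda>p :: nat \<Rightarrow> complex. p i)" for i by simp
    have "continuous_on (?D \<inter> (\<Union>s\<in>{s. s permutes {..<n}}. ?C s)) (\<lambda>p. F p i)"
    proof (rule continuous_on_UN_closed)
      show "finite {s. s permutes {..<n}}" by (simp add: finite_permutations)
      fix s assume s: "s \<in> {s. s permutes {..<n}}"
      show "closed (?C s)" by (intro closed_Collect_all closed_Collect_imp closed_Collect_le continuous_intros c open_Collect_const)
      have "continuous_on ?D (\<lambda>p. fperm s (real_parts n p))"
        unfolding real_parts_perm[symmetric, OF s[simplified]]
      proof (rule continuous_on_compose2[OF continuous_on_real_parts])
        show "continuous_on ?D (\<lambda>p. p \<circ> s)"
          by (intro continuous_on_coordinatewise_then_product) (simp, rule continuous_on_subset[OF c], simp)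
        show "(\<lambda>p. p \<circ> s) ` ?D \<subseteq> ?D"
          using s by (auto intro!: comp_inj_on simp: permutes_inj_on permutes_image)
      qed
      then have "continuous_on ?D (\<lambda>p. g (fperm s (real_parts n p)))"
        by (rule continuous_on_compose2[OF g(1)]) (use zW s in auto)
      then have "continuous_on ?D (\<lambda>p. H s p i)"
        unfolding H_def sgn_div_norm using g(2) zW s by (intro continuous_intros) auto
      then have "continuous_on (?D \<inter> ?C s) (\<lambda>p. H s p i)" by (rule continuous_on_subset) simp
      then show "continuous_on (?D \<inter> ?C s) (\<lambda>p. F p i)"
        by (rule continuous_on_eq) (use F_eq[of _ s] s in \<open>auto simp: Sorted_def\<close>)
    qed
    moreover have "?D \<inter> (\<Union>s\<in>{s. s permutes {..<n}}. ?C s) = ?D"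
      using ex unfolding Sorted_def by blast
    ultimately show ?thesis by simp
  qed
  have bound: "\<bar>F p i\<bar> \<le> 1" if p: "inj_on p {..<n}" for p i
  proof -
    obtain s where s: "Sorted s p" using ex by blast
    then have "s permutes {..<n}" by (simp add: Sorted_def)
    then show ?thesis unfolding F_eq[OF p s] H_def using abs_fnth_le_norm gn[OF zW] by metis
  qed
  have nonconst: "\<exists>i<n. \<exists>k<n. F p i \<noteq> F p k" if p: "inj_on p {..<n}" for p
  proof (rule ccontr)
    assume const: "\<not> ?thesis"
    obtain s where s: "Sorted s p" using ex by blast
    then have perm: "s permutes {..<n}" by (simp add: Sorted_def)
    let ?h = "sgn (g (fperm s (real_parts n p)))"
    have hW: "?h \<in> sumzero n" unfolding sgn_div_norm using g(2)[OF zW[OF perm]] subspace_sumzero by (intro subspace_mul) auto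
    have Fh: "F p (s i) = fnth ?h i" for i unfolding F_eq[OF p s] H_def using permutes_inverses[OF perm] by simp
    have h0: "fnth ?h i = fnth ?h 0" if "i < n" for i
    proof -
      have "s i < n" "s 0 < n" using permutes_in_image[OF perm, of i] permutes_in_image[OF perm, of 0] that n0 by simp_all
      then have "F p (s i) = F p (s 0)" using const by blast
      then show ?thesis unfolding Fh .
    qed
    have "(\<Sum>i<n. fnth ?h i) = (\<Sum>i<n. fnth ?h 0)" by (rule sum.cong[OF refl h0]) simp
    then have z0: "fnth ?h 0 = 0" using hW n0 by (simp add: sumzero_def)
    then have "fnth ?h i = 0" for i
      using h0[of i] z0 hW by (cases "i < n") (auto simp: sumzero_def)
    then have "?h = 0" by (intro fseq_eqI) simp
    then show False using gn[OF zW[OF perm], of p] by simp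
  qed
  have equi: "F (p \<circ> \<pi>) i = F p (\<pi> i)" if p: "inj_on p {..<n}" and \<pi>: "\<pi> permutes {..<n}" for p \<pi> i
  proof -
    obtain s where s: "Sorted s p" using ex by blast
    then have perm: "s permutes {..<n}" by (simp add: Sorted_def)
    let ?s = "inv \<pi> \<circ> s"
    have ps: "?s permutes {..<n}" by (rule permutes_compose[OF perm permutes_inv[OF \<pi>]])
    have \<pi>s: "\<pi> (?s i) = s i" for i using permutes_inverses[OF \<pi>] by simp
    have "Sorted ?s (p \<circ> \<pi>)" using s ps \<pi>s by (simp add: Sorted_def)
    moreover have "inj_on (p \<circ> \<pi>) {..<n}" using p \<pi> by (auto intro!: comp_inj_on simp: permutes_inj_on permutes_image)
    ultimately have "F (p \<circ> \<pi>) i = H ?s (p \<circ> \<pi>) i" by (rule F_eq[rotated])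
    also have "\<dots> = H s p (\<pi> i)"
    proof -
      have "fperm ?s (real_parts n (p \<circ> \<pi>)) = fperm s (real_parts n p)"
        by (rule fseq_eqI) (simp add: real_parts_perm[OF \<pi>] fnth_fperm permutes_bij[OF ps] permutes_bij[OF \<pi>] permutes_bij[OF perm] \<pi>s[simplified])
      moreover have "inv ?s i = inv s (\<pi> i)"
        using permutes_bij[OF perm] permutes_bij[OF \<pi>] by (simp add: o_inv_distrib bij_imp_bij_inv inv_inv_eq)
      ultimately show ?thesis by (simp add: H_def)
    qed
    also have "\<dots> = F p (\<pi> i)" by (rule F_eq[OF p s, symmetric])
    finally show ?thesis .
  qed
  show ?thesis using cont bound nonconst equi by (intro exI[of _ F]) blast
qed

text \<open>The damping factor extends the map by 0 to points that are not pairwise distinct.\<close>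

definition point_product :: "nat \<Rightarrow> (nat \<Rightarrow> complex) \<Rightarrow> real" where
  "point_product n p = (\<Prod>i<n. \<Prod>k<n. if i = k then 1 else norm (p i - p k))"

text \<open>Distinct leaves may coincide in their first two coordinates, so the map must be
  continuous on all planar tuples; it has to be non-constant only on distinct points.\<close>

theorem damped_configuration_map:
  fixes n :: nat
  assumes n2: "n \<ge> 2" and np: "\<And>p e. prime p \<Longrightarrow> n \<noteq> p ^ e"
  shows "\<exists>G :: (nat \<Rightarrow> complex) \<Rightarrow> nat \<Rightarrow> real.
    (\<forall>i. continuous_on UNIV (\<lambda>p. G p i)) \<and>
    (\<forall>p. inj_on p {..<n} \<longrightarrow> (\<exists>i<n. \<exists>k<n. G p i \<noteq> G p k)) \<and>
    (\<forall>p \<pi> i. \<pi> permutes {..<n} \<longrightarrow> G (p \<circ> \<pi>) i = G p (\<pi> i))"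
proof -
  obtain F :: "(nat \<Rightarrow> complex) \<Rightarrow> nat \<Rightarrow> real" where F: "\<And>i. continuous_on {p. inj_on p {..<n}} (\<lambda>p. F p i)"
    "\<And>p i. inj_on p {..<n} \<Longrightarrow> \<bar>F p i\<bar> \<le> 1"
    "\<And>p. inj_on p {..<n} \<Longrightarrow> \<exists>i<n. \<exists>k<n. F p i \<noteq> F p k"
    "\<And>p \<pi> i. inj_on p {..<n} \<Longrightarrow> \<pi> permutes {..<n} \<Longrightarrow> F (p \<circ> \<pi>) i = F p (\<pi> i)"
    using planar_configuration_map[OF n2 np] by blast
  let ?D = "{p :: nat \<Rightarrow> complex. inj_on p {..<n}}" and ?m = "point_product n"
  define G where "G p i = (if inj_on p {..<n} then ?m p * F p i else 0)" for p i
  have c: "continuous_on UNIV (\<lambda>p :: nat \<Rightarrow> complex. p i)" for i by simp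
  have contm: "continuous_on UNIV ?m"
  proof -
    have "continuous_on UNIV (\<lambda>p :: nat \<Rightarrow> complex. if i = k then 1 else norm (p i - p k))" for i k
      by (cases "i = k") (auto intro!: continuous_intros c)
    then show ?thesis unfolding point_product_def[abs_def] by (intro continuous_intros)
  qed
  have m0: "?m p = 0 \<longleftrightarrow> \<not> inj_on p {..<n}" for p
    by (auto simp: point_product_def inj_on_def)
  have mpos: "0 \<le> ?m p" for p unfolding point_product_def by (intro prod_nonneg) auto
  have op: "open ?D"
  proof -
    have "?D = {p. ?m p \<noteq> 0}" using m0 by auto
    then show ?thesis using open_Collect_neq[OF contm, of "\<lambda>_. 0"] by simp
  qed
  have "continuous_on UNIV (\<lambda>p. G p i)" for i
    unfolding continuous_on_eq_continuous_at[OF open_UNIV]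
  proof
    fix p0 :: "nat \<Rightarrow> complex"
    show "isCont (\<lambda>p. G p i) p0"
    proof (cases "inj_on p0 {..<n}")
      case True
      have "continuous_on ?D (\<lambda>p. ?m p * F p i)"
        by (intro continuous_intros F(1) continuous_on_subset[OF contm]) simp
      then have "continuous_on ?D (\<lambda>p. G p i)" by (rule continuous_on_eq) (simp add: G_def)
      then show ?thesis using True op by (simp add: continuous_on_eq_continuous_at)
    next
      case False
      have "isCont ?m p0" using contm by (simp add: continuous_on_eq_continuous_at)
      then have "(?m \<longlongrightarrow> 0) (at p0)" using m0[of p0] False by (simp add: isCont_def)
      then have "((\<lambda>p. G p i) \<longlongrightarrow> 0) (at p0)"
      proof (rule Lim_null_comparison[rotated], intro always_eventually allI)
        fix p show "norm (G p i) \<le> ?m p"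
          using mpos[of p] F(2)[of p i] by (auto simp: G_def abs_mult intro!: mult_left_le)
      qed
      then show ?thesis using False by (simp add: isCont_def G_def)
    qed
  qed
  moreover have "\<exists>i<n. \<exists>k<n. G p i \<noteq> G p k" if "inj_on p {..<n}" for p
    using F(3)[OF that] m0[of p] that by (auto simp: G_def)
  moreover have "G (p \<circ> \<pi>) i = G p (\<pi> i)" if \<pi>: "\<pi> permutes {..<n}" for p \<pi> i
  proof -
    have inj: "\<pi> i = \<pi> k \<longleftrightarrow> i = k" for i k using permutes_inj[OF \<pi>] by (auto dest: injD)
    have "(\<Prod>i<n. \<Prod>k<n. if i = k then 1 else norm (p (\<pi> i) - p (\<pi> k)))
        = (\<Prod>i<n. \<Prod>k<n. if \<pi> i = \<pi> k then 1 else norm (p (\<pi> i) - p (\<pi> k)))" by (simp only: inj)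
    also have "\<dots> = (\<Prod>i<n. \<Prod>k<n. if \<pi> i = k then 1 else norm (p (\<pi> i) - p k))"
      using prod.permute[OF \<pi>, of "\<lambda>k. if \<pi> i = k then 1 else norm (p (\<pi> i) - p k)" for i] by (simp add: comp_def)
    also have "\<dots> = (\<Prod>i<n. \<Prod>k<n. if i = k then 1 else norm (p i - p k))"
      using prod.permute[OF \<pi>, of "\<lambda>i. \<Prod>k<n. if i = k then 1 else norm (p i - p k)"] by (simp add: comp_def)
    finally have mp: "?m (p \<circ> \<pi>) = ?m p" by (simp only: point_product_def comp_def)
    then have "inj_on (p \<circ> \<pi>) {..<n} \<longleftrightarrow> inj_on p {..<n}" using m0 by metis
    then show ?thesis using F(4)[OF _ \<pi>] mp by (simp add: G_def)
  qed
  ultimately show ?thesis by (intro exI[of _ G]) blast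
qed

lemma continuous_on_entry: "continuous_on S (\<lambda>x :: cfg. x j a c)"
proof -
  have "continuous_on S (\<lambda>x :: cfg. x j)" by (rule continuous_on_subset[OF continuous_on_product_coordinates]) simp
  then have "continuous_on S (\<lambda>x :: cfg. x j a)" by (rule continuous_on_product_then_coordinatewise)
  then show ?thesis by (rule continuous_on_product_then_coordinatewise)
qed

lemma sum_reindex_addr:
  "\<sigma> \<in> Sigma_grp ns \<Longrightarrow> (\<Sum>a | valid_addr ns j a. g (reindex \<sigma> j a)) = (\<Sum>a | valid_addr ns j a. g a)"
  by (rule sum.reindex_bij_betw[OF bij_betw_reindex])

lemma valid_addr_tl: "j < length ns \<Longrightarrow> valid_addr ns j a \<Longrightarrow> valid_addr ns (Suc j) (tl a)"
  using valid_addr_drop[of ns j a 1] by (simp add: drop_Suc)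

section \<open>The leaves of an iterated configuration\<close>

definition entry_bound :: "nat \<Rightarrow> nat list \<Rightarrow> cfg \<Rightarrow> real" where
  "entry_bound d ns x = (\<Sum>j<length ns. \<Sum>a | valid_addr ns j a. \<Sum>c<d. \<bar>x j a c\<bar>)"

definition sibling_dist :: "nat \<Rightarrow> cfg \<Rightarrow> nat \<Rightarrow> nat list \<Rightarrow> nat list \<Rightarrow> real" where
  "sibling_dist d x j a b = (\<Sum>c<d. \<bar>x j a c - x j b c\<bar>)"

definition inverse_gap :: "nat \<Rightarrow> nat list \<Rightarrow> cfg \<Rightarrow> real" where
  "inverse_gap d ns x = (\<Sum>j<length ns. \<Sum>a | valid_addr ns j a. \<Sum>b | valid_addr ns j b.
     if a \<noteq> b \<and> tl a = tl b then 1 / sibling_dist d x j a b else 0)"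

definition leaf_scale :: "nat \<Rightarrow> nat list \<Rightarrow> cfg \<Rightarrow> real" where
  "leaf_scale d ns x = 1 / (1 + 2 * real d * real (length ns) * entry_bound d ns x * inverse_gap d ns x)"

text \<open>Each level is shrunk by \<open>leaf_scale\<close> relative to the level above it. The scale is so small that the lower levels cannot
  compensate a difference of siblings, whose distance is at least \<open>1 / inverse_gap\<close>.\<close>

definition leaf_point :: "nat \<Rightarrow> nat list \<Rightarrow> cfg \<Rightarrow> nat list \<Rightarrow> nat \<Rightarrow> real" where
  "leaf_point d ns x a c = (\<Sum>j<length ns. leaf_scale d ns x ^ (length ns - 1 - j) * x j (drop j a) c)"

lemma entry_bound_nonneg: "entry_bound d ns x \<ge> 0"
  by (simp add: entry_bound_def sum_nonneg)

lemma inverse_gap_nonneg: "inverse_gap d ns x \<ge> 0"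
  by (auto simp: inverse_gap_def sibling_dist_def intro!: sum_nonneg)

lemma abs_entry_le:
  assumes "j < length ns" "valid_addr ns j a" "c < d"
  shows "\<bar>x j a c\<bar> \<le> entry_bound d ns x"
proof -
  have "\<bar>x j a c\<bar> \<le> (\<Sum>c<d. \<bar>x j a c\<bar>)"
    by (rule member_le_sum) (use assms in auto)
  also have "\<dots> \<le> (\<Sum>a | valid_addr ns j a. \<Sum>c<d. \<bar>x j a c\<bar>)"
    by (rule member_le_sum) (use assms finite_valid_addr in \<open>auto intro: sum_nonneg\<close>)
  also have "\<dots> \<le> entry_bound d ns x" unfolding entry_bound_def
    by (rule member_le_sum) (use assms in \<open>auto intro!: sum_nonneg\<close>)
  finally show ?thesis .
qed

lemma sibling_dist_pos:
  assumes x: "x \<in> Cspace d ns" and j: "j < length ns" and v: "valid_addr ns j a" "valid_addr ns j b"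
    and ab: "a \<noteq> b" "tl a = tl b"
  shows "sibling_dist d x j a b > 0"
proof -
  obtain i ts where a: "a = i # ts" using v j by (cases a) auto
  obtain i' where b: "b = i' # ts" using v j ab a by (cases b) auto
  have "(\<lambda>c. x j a c) \<noteq> (\<lambda>c. x j b c)"
    using x j v ab unfolding a b Cspace_def by auto
  then obtain c where c: "x j a c \<noteq> x j b c" by auto
  then have "x j a c \<noteq> 0 \<or> x j b c \<noteq> 0" by auto
  then have "c < d" using x unfolding Cspace_def by blast
  then have "\<bar>x j a c - x j b c\<bar> \<le> sibling_dist d x j a b"
    unfolding sibling_dist_def by (intro member_le_sum) auto
  then show ?thesis using c by linarith
qed

lemma inverse_gap_ge:
  assumes j: "j < length ns" and v: "valid_addr ns j a" "valid_addr ns j b" and ab: "a \<noteq> b" "tl a = tl b"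
  shows "1 / sibling_dist d x j a b \<le> inverse_gap d ns x"
proof -
  let ?g = "\<lambda>j a b. if a \<noteq> b \<and> tl a = tl b then 1 / sibling_dist d x j a b else 0"
  have nn: "?g j a b \<ge> 0" for j a b by (auto simp: sibling_dist_def intro!: sum_nonneg)
  have "1 / sibling_dist d x j a b = ?g j a b" using ab by simp
  also have "\<dots> \<le> (\<Sum>b | valid_addr ns j b. ?g j a b)"
    by (rule member_le_sum) (use v nn finite_valid_addr in auto)
  also have "\<dots> \<le> (\<Sum>a | valid_addr ns j a. \<Sum>b | valid_addr ns j b. ?g j a b)"
    by (rule member_le_sum[of a _ "\<lambda>a. \<Sum>b | valid_addr ns j b. ?g j a b"])
      (use v finite_valid_addr in \<open>auto intro!: sum_nonneg nn\<close>)
  also have "\<dots> \<le> inverse_gap d ns x" unfolding inverse_gap_def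
    by (rule member_le_sum[of j _ "\<lambda>j. \<Sum>a | valid_addr ns j a. \<Sum>b | valid_addr ns j b. ?g j a b"])
      (use j in \<open>auto intro!: sum_nonneg nn\<close>)
  finally show ?thesis .
qed

lemma leaf_scale_denom_pos: "0 < 1 + 2 * real d * real (length ns) * entry_bound d ns x * inverse_gap d ns x"
  using entry_bound_nonneg inverse_gap_nonneg by (intro add_pos_nonneg) (auto intro!: mult_nonneg_nonneg)

lemma leaf_scale_bounds: "0 < leaf_scale d ns x" "leaf_scale d ns x \<le> 1"
  using leaf_scale_denom_pos[of d ns x] entry_bound_nonneg[of d ns x] inverse_gap_nonneg[of d ns x]
  by (auto simp: leaf_scale_def)

lemma continuous_on_leaf_scale: "continuous_on (Cspace d ns) (leaf_scale d ns)"
proof -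
  have B: "continuous_on (Cspace d ns) (entry_bound d ns)"
    unfolding entry_bound_def[abs_def] by (intro continuous_intros continuous_on_entry)
  have "continuous_on (Cspace d ns) (\<lambda>x. if a \<noteq> b \<and> tl a = tl b then 1 / sibling_dist d x j a b else 0)"
    if "j < length ns" "valid_addr ns j a" "valid_addr ns j b" for j a b
  proof (cases "a \<noteq> b \<and> tl a = tl b")
    case True
    then have "\<forall>x\<in>Cspace d ns. sibling_dist d x j a b \<noteq> 0" using sibling_dist_pos[OF _ that] by fastforce
    moreover have "continuous_on (Cspace d ns) (\<lambda>x. sibling_dist d x j a b)"
      unfolding sibling_dist_def by (intro continuous_intros continuous_on_entry)
    ultimately have "continuous_on (Cspace d ns) (\<lambda>x. 1 / sibling_dist d x j a b)"
      by (intro continuous_on_divide continuous_on_const)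
    then show ?thesis using True by simp
  qed (simp only: if_False continuous_on_const)
  then have Q: "continuous_on (Cspace d ns) (inverse_gap d ns)"
    unfolding inverse_gap_def[abs_def] by (intro continuous_on_sum) auto
  have "\<forall>x\<in>Cspace d ns. 1 + 2 * real d * real (length ns) * entry_bound d ns x * inverse_gap d ns x \<noteq> 0"
    using leaf_scale_denom_pos by (metis less_irrefl)
  then show ?thesis unfolding leaf_scale_def[abs_def]
    by (intro continuous_on_divide continuous_on_const continuous_on_add continuous_on_mult B Q)
qed

lemma leaf_scale_act:
  assumes s: "\<sigma> \<in> Sigma_grp ns"
  shows "leaf_scale d ns (act ns \<sigma> x) = leaf_scale d ns x"
proof -
  have "entry_bound d ns (act ns \<sigma> x) = (\<Sum>j<length ns. \<Sum>a | valid_addr ns j a. \<Sum>c<d. \<bar>x j (reindex \<sigma> j a) c\<bar>)"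
    unfolding entry_bound_def by (intro sum.cong refl) (auto simp: act_def)
  also have "\<dots> = entry_bound d ns x"
    unfolding entry_bound_def by (rule sum.cong[OF refl]) (rule sum_reindex_addr[OF s])
  finally have B: "entry_bound d ns (act ns \<sigma> x) = entry_bound d ns x" .
  let ?g = "\<lambda>j a b. if a \<noteq> b \<and> tl a = tl b then 1 / sibling_dist d x j a b else 0"
  have "(if a \<noteq> b \<and> tl a = tl b then 1 / sibling_dist d (act ns \<sigma> x) j a b else 0) = ?g j (reindex \<sigma> j a) (reindex \<sigma> j b)"
    if j: "j < length ns" and v: "valid_addr ns j a" "valid_addr ns j b" for j a b
  proof -
    have t: "tl (reindex \<sigma> j a) = reindex \<sigma> (Suc j) (tl a)" for a
      using drop_reindex[of 1 \<sigma> j a] by (simp add: drop_Suc)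
    have "reindex \<sigma> j a = reindex \<sigma> j b \<longleftrightarrow> a = b" using reindex_inject[OF s v] by blast
    moreover have "tl (reindex \<sigma> j a) = tl (reindex \<sigma> j b) \<longleftrightarrow> tl a = tl b"
      unfolding t using reindex_inject[OF s valid_addr_tl[OF j v(1)] valid_addr_tl[OF j v(2)]] by auto
    moreover have "sibling_dist d (act ns \<sigma> x) j a b = sibling_dist d x j (reindex \<sigma> j a) (reindex \<sigma> j b)"
      using j v by (simp add: sibling_dist_def act_def)
    ultimately show ?thesis by simp
  qed
  then have "inverse_gap d ns (act ns \<sigma> x)
      = (\<Sum>j<length ns. \<Sum>a | valid_addr ns j a. \<Sum>b | valid_addr ns j b. ?g j (reindex \<sigma> j a) (reindex \<sigma> j b))"
    unfolding inverse_gap_def by (intro sum.cong refl) auto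
  also have "\<dots> = (\<Sum>j<length ns. \<Sum>a | valid_addr ns j a. \<Sum>b | valid_addr ns j b. ?g j (reindex \<sigma> j a) b)"
    by (rule sum.cong[OF refl], rule sum.cong[OF refl], rule sum_reindex_addr[OF s])
  also have "\<dots> = inverse_gap d ns x"
    unfolding inverse_gap_def by (rule sum.cong[OF refl])
      (rule sum_reindex_addr[OF s, of "\<lambda>a. \<Sum>b | valid_addr ns _ b. ?g _ a b"])
  finally show ?thesis using B by (simp add: leaf_scale_def)
qed

lemma continuous_on_leaf_point: "continuous_on (Cspace d ns) (\<lambda>x. leaf_point d ns x a c)"
  unfolding leaf_point_def by (intro continuous_intros continuous_on_entry continuous_on_leaf_scale)

lemma leaf_point_act:
  assumes "\<sigma> \<in> Sigma_grp ns" "valid_addr ns 0 a"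
  shows "leaf_point d ns (act ns \<sigma> x) a c = leaf_point d ns x (reindex \<sigma> 0 a) c"
  unfolding leaf_point_def leaf_scale_act[OF assms(1)]
  using valid_addr_drop[OF assms(2)] drop_reindex[of _ \<sigma> 0 a] by (intro sum.cong refl) (simp add: act_def)

text \<open>At the highest level \<open>j\<close> where the addresses differ they are siblings, at
  distance \<open>?L\<close>. If the leaves coincided, the lower levels would have to compensate for
  \<open>?L\<close>, but they carry at least one further factor \<open>leaf_scale\<close>, which
  bounds \<open>?L * ?Q\<close> below 1, whereas \<open>inverse_gap_ge\<close> makes it at least
  1.\<close>

lemma leaf_point_distinct:
  assumes x: "x \<in> Cspace d ns" and v: "valid_addr ns 0 a" "valid_addr ns 0 b" and ab: "a \<noteq> b"
  shows "\<exists>c<d. leaf_point d ns x a c \<noteq> leaf_point d ns x b c"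
proof (rule ccontr)
  assume "\<not> ?thesis"
  then have eq: "leaf_point d ns x a c = leaf_point d ns x b c" if "c < d" for c using that by blast
  let ?k = "length ns" and ?e = "leaf_scale d ns x" and ?B = "entry_bound d ns x" and ?Q = "inverse_gap d ns x"
  let ?J = "{j. drop j a \<noteq> drop j b}"
  have len: "length a = ?k" "length b = ?k" using v valid_addr_length by fastforce+
  have J: "?J \<subseteq> {..<?k}"
  proof
    fix l assume "l \<in> ?J"
    then show "l \<in> {..<?k}" using len by (cases "l < ?k") auto
  qed
  then have fin: "finite ?J" by (rule finite_subset) simp
  have "0 \<in> ?J" using ab by simp
  define j where "j = Max ?J"
  have jJ: "j \<in> ?J" unfolding j_def using Max_in[OF fin] \<open>0 \<in> ?J\<close> by blast
  then have j: "j < ?k" using J by auto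
  have above: "drop l a = drop l b" if "l > j" for l
    using Max_ge[OF fin, of l] that unfolding j_def by fastforce
  have vj: "valid_addr ns l (drop l a)" "valid_addr ns l (drop l b)" for l
    using valid_addr_drop[OF v(1), of l] valid_addr_drop[OF v(2), of l] by simp_all
  have tl: "tl (drop j a) = tl (drop j b)" using above[of "Suc j"] by (simp add: drop_Suc tl_drop)
  let ?\<Delta> = "\<lambda>l c. x l (drop l a) c - x l (drop l b) c"
  have key: "\<bar>?\<Delta> j c\<bar> \<le> 2 * real ?k * ?B * ?e" if c: "c < d" for c
  proof -
    have "0 = (\<Sum>l<?k. ?e ^ (?k - 1 - l) * ?\<Delta> l c)"
      using eq[OF c] by (simp add: leaf_point_def sum_subtractf algebra_simps)
    also have "\<dots> = (\<Sum>l<Suc j. ?e ^ (?k - 1 - l) * ?\<Delta> l c)"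
      by (rule sum.mono_neutral_right) (use j above in \<open>auto simp: not_less\<close>)
    also have "\<dots> = (\<Sum>l<Suc j. ?e ^ (?k - 1 - j) * (?e ^ (j - l) * ?\<Delta> l c))"
      by (rule sum.cong[OF refl]) (use j in \<open>simp add: mult.assoc[symmetric] power_add[symmetric]\<close>)
    also have "\<dots> = ?e ^ (?k - 1 - j) * (?\<Delta> j c + (\<Sum>l<j. ?e ^ (j - l) * ?\<Delta> l c))"
      by (simp add: sum_distrib_left distrib_left)
    finally have "?\<Delta> j c = - (\<Sum>l<j. ?e ^ (j - l) * ?\<Delta> l c)" using leaf_scale_bounds(1)[of d ns x] by simp
    then have "\<bar>?\<Delta> j c\<bar> = \<bar>\<Sum>l<j. ?e ^ (j - l) * ?\<Delta> l c\<bar>" by simp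
    also have "\<dots> \<le> (\<Sum>l<j. \<bar>?e ^ (j - l) * ?\<Delta> l c\<bar>)" by (rule sum_abs)
    also have "\<dots> \<le> (\<Sum>l<j. ?e * (2 * ?B))"
    proof (rule sum_mono)
      fix l assume l: "l \<in> {..<j}"
      have "?e ^ (j - l) \<le> ?e ^ 1" using leaf_scale_bounds[of d ns x] l by (intro power_decreasing) auto
      moreover have "\<bar>?\<Delta> l c\<bar> \<le> 2 * ?B"
        using abs_entry_le[OF _ vj(1)[of l] c, of x] abs_entry_le[OF _ vj(2)[of l] c, of x] l j by simp
      ultimately show "\<bar>?e ^ (j - l) * ?\<Delta> l c\<bar> \<le> ?e * (2 * ?B)"
        using leaf_scale_bounds(1)[of d ns x] by (simp add: abs_mult mult_mono)
    qed
    also have "\<dots> = real j * (?e * (2 * ?B))" by simp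
    also have "\<dots> \<le> real ?k * (?e * (2 * ?B))"
      using j leaf_scale_bounds(1)[of d ns x] entry_bound_nonneg[of d ns x] by (intro mult_right_mono) auto
    finally show ?thesis by (simp add: mult_ac)
  qed
  let ?L = "sibling_dist d x j (drop j a) (drop j b)"
  have L: "?L > 0" and LQ: "1 / ?L \<le> ?Q"
    using sibling_dist_pos[OF x j vj] inverse_gap_ge[OF j vj] jJ tl by auto
  have "?L \<le> (\<Sum>c<d. 2 * real ?k * ?B * ?e)"
    unfolding sibling_dist_def by (rule sum_mono) (use key in simp)
  then have "?L * ?Q \<le> (2 * real d * real ?k * ?B * ?Q) * ?e"
    using inverse_gap_nonneg[of d ns x] mult_right_mono[of ?L "2 * real d * real ?k * ?B * ?e" ?Q] by (simp add: mult_ac)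
  also have "\<dots> < 1" unfolding leaf_scale_def using leaf_scale_denom_pos[of d ns x] by (simp add: divide_simps)
  finally show False using L LQ by (simp add: field_simps)
qed

text \<open>Value 0 is the planar map on the first two coordinates and value \<open>c > 0\<close> is
  coordinate \<open>c + 1\<close>, which makes \<open>d - 1\<close> values. If the latter are all
  constant on the leaves, distinct leaves differ in the first two coordinates, and the planar map is
  not constant.\<close>

lemma leaf_values:
  fixes ns :: "nat list" and d :: nat
  defines "L \<equiv> {a. valid_addr ns 0 a}"
  assumes d: "d \<ge> 2" and n2: "card L \<ge> 2" and np: "\<And>p e. prime p \<Longrightarrow> card L \<noteq> p ^ e"
  shows "\<exists>q :: cfg \<Rightarrow> nat list \<Rightarrow> nat \<Rightarrow> real.
    (\<forall>a c. continuous_on (Cspace d ns) (\<lambda>x. q x a c)) \<and>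
    (\<forall>x\<in>Cspace d ns. \<exists>c<d - 1. \<exists>a\<in>L. \<exists>b\<in>L. q x a c \<noteq> q x b c) \<and>
    (\<forall>\<sigma>\<in>Sigma_grp ns. \<forall>x. \<forall>a\<in>L. \<forall>c. q (act ns \<sigma> x) a c = q x (reindex \<sigma> 0 a) c)"
proof -
  let ?N = "card L" and ?P = "leaf_point d ns"
  obtain G :: "(nat \<Rightarrow> complex) \<Rightarrow> nat \<Rightarrow> real" where G: "\<And>i. continuous_on UNIV (\<lambda>p. G p i)"
    "\<And>p. inj_on p {..<?N} \<Longrightarrow> \<exists>i<?N. \<exists>k<?N. G p i \<noteq> G p k"
    "\<And>p \<pi> i. \<pi> permutes {..<?N} \<Longrightarrow> G (p \<circ> \<pi>) i = G p (\<pi> i)"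
    using damped_configuration_map[OF n2 np] by blast
  have fin: "finite L" unfolding L_def by (rule finite_valid_addr)
  obtain en where en: "bij_betw en {..<?N} L"
    using ex_bij_betw_nat_finite[OF fin] by (auto simp: atLeast0LessThan)
  define rk where "rk = inv_into {..<?N} en"
  have rk: "rk a < ?N" "en (rk a) = a" if "a \<in> L" for a
    using that bij_betw_inv_into_right[OF en] inv_into_into[of a en "{..<?N}"] en
    by (auto simp: rk_def bij_betw_def)
  have enL: "en i \<in> L" and rk_en: "rk (en i) = i" if "i < ?N" for i
    using that en bij_betw_inv_into_left[OF en, of i] by (auto simp: rk_def bij_betw_def)
  define pt where "pt x i = (if i < ?N then Complex (?P x (en i) 0) (?P x (en i) 1) else 0)" for x i
  define q where "q x a c = (if c = 0 then G (pt x) (rk a) else ?P x a (Suc c))" for x a c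
  have "continuous_on (Cspace d ns) (\<lambda>x. q x a c)" for a c
  proof (cases "c = 0")
    case True
    have "continuous_on (Cspace d ns) (\<lambda>x. pt x i)" for i
      unfolding pt_def Complex_eq
      by (cases "i < ?N") (simp_all add: continuous_intros continuous_on_leaf_point)
    then have "continuous_on (Cspace d ns) pt" by (rule continuous_on_coordinatewise_then_product)
    then have "continuous_on (Cspace d ns) (\<lambda>x. G (pt x) (rk a))"
      by (rule continuous_on_compose2[OF G(1)]) simp
    then show ?thesis using True by (simp add: q_def)
  next
    case False
    then show ?thesis by (simp add: q_def continuous_on_leaf_point)
  qed
  moreover have "\<exists>c<d - 1. \<exists>a\<in>L. \<exists>b\<in>L. q x a c \<noteq> q x b c" if x: "x \<in> Cspace d ns" for x
  proof (rule ccontr)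
    assume "\<not> ?thesis"
    then have const: "q x a c = q x b c" if "a \<in> L" "b \<in> L" "c < d - 1" for a b c using that by blast
    have "inj_on (pt x) {..<?N}"
    proof (rule inj_onI)
      fix i k assume ik: "i \<in> {..<?N}" "k \<in> {..<?N}" and eq: "pt x i = pt x k"
      have "?P x (en i) c = ?P x (en k) c" if "c < d" for c
      proof (cases "c < 2")
        case True
        then show ?thesis using eq ik by (auto simp: pt_def less_2_cases_iff)
      next
        case False
        then show ?thesis using const[OF enL enL, of i k "c - 1"] ik that by (simp add: q_def)
      qed
      moreover have "valid_addr ns 0 (en i)" "valid_addr ns 0 (en k)"
        using enL[of i] enL[of k] ik unfolding L_def by simp_all
      ultimately have "en i = en k" using leaf_point_distinct[OF x] by blast
      then show "i = k" using ik rk_en by (metis lessThan_iff)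
    qed
    then obtain i k where ik: "i < ?N" "k < ?N" "G (pt x) i \<noteq> G (pt x) k" using G(2) by blast
    then have "q x (en i) 0 \<noteq> q x (en k) 0" by (simp add: q_def rk_en)
    then show False using const[OF enL enL, of i k 0] ik d by simp
  qed
  moreover have "q (act ns \<sigma> x) a c = q x (reindex \<sigma> 0 a) c" if s: "\<sigma> \<in> Sigma_grp ns" and a: "a \<in> L" for \<sigma> x a c
  proof (cases "c = 0")
    case True
    define \<pi> where "\<pi> i = (if i < ?N then rk (reindex \<sigma> 0 (en i)) else i)" for i
    have re: "reindex \<sigma> 0 b \<in> L" if "b \<in> L" for b using that valid_addr_reindex[OF s] unfolding L_def by simp
    have "bij_betw \<pi> {..<?N} {..<?N}"
    proof (rule bij_betw_finite_inj)
      show "inj_on \<pi> {..<?N}"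
      proof (rule inj_onI)
        fix i k assume ik: "i \<in> {..<?N}" "k \<in> {..<?N}" and "\<pi> i = \<pi> k"
        then have "rk (reindex \<sigma> 0 (en i)) = rk (reindex \<sigma> 0 (en k))" by (simp add: \<pi>_def)
        moreover have v: "en i \<in> L" "en k \<in> L" using enL ik by simp_all
        ultimately have "reindex \<sigma> 0 (en i) = reindex \<sigma> 0 (en k)" using rk(2) re by metis
        then have "en i = en k" using reindex_inject[OF s] v unfolding L_def by blast
        then show "i = k" using ik rk_en by (metis lessThan_iff)
      qed
    qed (use rk(1)[OF re[OF enL]] in \<open>auto simp: \<pi>_def\<close>)
    then have \<pi>: "\<pi> permutes {..<?N}" by (rule bij_imp_permutes) (simp add: \<pi>_def)
    have "pt (act ns \<sigma> x) i = pt x (\<pi> i)" for i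
    proof (cases "i < ?N")
      case i: True
      have "valid_addr ns 0 (en i)" using enL[OF i] unfolding L_def by simp
      from leaf_point_act[OF s this] show ?thesis using rk[OF re[OF enL[OF i]]] i by (simp add: pt_def \<pi>_def)
    qed (simp add: pt_def \<pi>_def)
    then have "pt (act ns \<sigma> x) = pt x \<circ> \<pi>" by auto
    moreover have "\<pi> (rk a) = rk (reindex \<sigma> 0 a)" using rk[OF a] by (simp add: \<pi>_def)
    ultimately show ?thesis using G(3)[OF \<pi>] True by (simp add: q_def)
  next
    case False
    then show ?thesis using leaf_point_act[OF s, of a d x] a by (simp add: q_def L_def)
  qed
  ultimately show ?thesis by (intro exI[of _ q]) blast
qed

section \<open>From leaf values to the representation\<close>

definition subtree_sum :: "nat list \<Rightarrow> (nat list \<Rightarrow> real) \<Rightarrow> nat \<Rightarrow> nat list \<Rightarrow> real" where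
  "subtree_sum ns h j a = (\<Sum>b | valid_addr ns 0 b. if drop j b = a then h b else 0)"

lemma subtree_sum_split:
  assumes j: "j < length ns"
  shows "(\<Sum>i<ns ! j. subtree_sum ns h j (i # ts)) = subtree_sum ns h (Suc j) ts"
proof -
  have "(\<Sum>i<ns ! j. if drop j b = i # ts then h b else 0) = (if drop (Suc j) b = ts then h b else 0)"
    if b: "valid_addr ns 0 b" for b
  proof -
    have "length b = length ns" using valid_addr_length[OF b] by simp
    then have db: "drop j b = b ! j # drop (Suc j) b" using j Cons_nth_drop_Suc[of j b] by simp
    have "b ! j < ns ! j" using valid_addr_drop[OF b, of j] j by (simp add: db)
    then show ?thesis by (cases "drop (Suc j) b = ts") (simp_all add: db)
  qed
  then show ?thesis unfolding subtree_sum_def by (subst sum.swap) (rule sum.cong, auto)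
qed

lemma subtree_sum_leaf:
  assumes "valid_addr ns 0 a"
  shows "subtree_sum ns h 0 a = h a"
  using assms sum.delta'[OF finite_valid_addr[of ns 0], of a h] by (simp add: subtree_sum_def eq_commute)

lemma subtree_sum_reindex:
  assumes s: "\<sigma> \<in> Sigma_grp ns" and v: "valid_addr ns j a"
    and h: "\<And>b. valid_addr ns 0 b \<Longrightarrow> h' b = h (reindex \<sigma> 0 b)"
  shows "subtree_sum ns h' j a = subtree_sum ns h j (reindex \<sigma> j a)"
proof -
  have "drop j (reindex \<sigma> 0 b) = reindex \<sigma> j a \<longleftrightarrow> drop j b = a" if b: "valid_addr ns 0 b" for b
    using reindex_inject[OF s _ v] valid_addr_drop[OF b, of j] by (auto simp: drop_reindex)
  then have "subtree_sum ns h' j a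
      = (\<Sum>b | valid_addr ns 0 b. if drop j (reindex \<sigma> 0 b) = reindex \<sigma> j a then h (reindex \<sigma> 0 b) else 0)"
    unfolding subtree_sum_def using h by (intro sum.cong) auto
  then show ?thesis unfolding subtree_sum_def using sum_reindex_addr[OF s] by simp
qed

lemma card_valid_addr: "j \<le> length ns \<Longrightarrow> card {a. valid_addr ns j a} = prod_list (drop j ns)"
proof (induction j rule: inc_induct)
  case base
  have "{a. valid_addr ns (length ns) a} = {[]}" by (auto simp: valid_addr_ge)
  then show ?case by simp
next
  case (step j)
  have "{a. valid_addr ns j a} = (\<lambda>(i, ts). i # ts) ` ({..<ns ! j} \<times> {ts. valid_addr ns (Suc j) ts})"
  proof (intro set_eqI iffI)
    fix a assume "a \<in> {a. valid_addr ns j a}"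
    then show "a \<in> (\<lambda>(i, ts). i # ts) ` ({..<ns ! j} \<times> {ts. valid_addr ns (Suc j) ts})"
      using step by (cases a) auto
  qed (use step in auto)
  then have "card {a. valid_addr ns j a} = ns ! j * card {ts. valid_addr ns (Suc j) ts}"
    by (simp add: card_image inj_on_def card_cartesian_product)
  then show ?case using step Cons_nth_drop_Suc[of j ns] by (metis prod_list.Cons)
qed

theorem equivariant_map_exists:
  fixes ns :: "nat list" and d :: nat
  assumes ne: "ns \<noteq> []" and d: "d \<ge> 2" and n2: "\<forall>n\<in>set ns. n \<ge> 2"
    and np: "\<And>p. prime p \<Longrightarrow> \<exists>n\<in>set ns. \<forall>e. n \<noteq> p ^ e"
  shows "\<exists>f. continuous_on (Cspace d ns) f \<and> f ` Cspace d ns \<subseteq> SW d ns \<and>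
    (\<forall>\<sigma>\<in>Sigma_grp ns. \<forall>x\<in>Cspace d ns. f (act ns \<sigma> x) = act ns \<sigma> (f x))"
proof -
  let ?L = "{a. valid_addr ns 0 a}" and ?k = "length ns"
  have card: "card ?L = prod_list ns" using card_valid_addr[of 0 ns] by simp
  \<comment> \<open>A product is a power of \<open>p\<close> only if each of its factors is
    one.\<close>
  have npL: "card ?L \<noteq> p ^ e" if p: "prime p" for p e
  proof
    assume N: "card ?L = p ^ e"
    obtain n where n: "n \<in> set ns" "\<And>e. n \<noteq> p ^ e" using np[OF p] by blast
    then have "n dvd prod_list ns" by (auto simp: in_set_conv_decomp)
    then have "n dvd p ^ e" using N card by simp
    then show False using n(2) divides_primepow_nat[OF p] by blast
  qed
  have nz: "prod_list ns \<noteq> 0" using n2 by (auto simp: prod_list_zero_iff)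
  have "prod_list ns \<noteq> 1" using npL[of 2 0] card two_is_prime_nat by auto
  then have cL: "card ?L \<ge> 2" using nz card by linarith
  obtain q :: "cfg \<Rightarrow> nat list \<Rightarrow> nat \<Rightarrow> real" where
    cont: "\<And>a c. continuous_on (Cspace d ns) (\<lambda>x. q x a c)"
    and nonconst: "\<And>x. x \<in> Cspace d ns \<Longrightarrow> \<exists>c<d - 1. \<exists>a\<in>?L. \<exists>b\<in>?L. q x a c \<noteq> q x b c"
    and equi: "\<And>\<sigma> x a c. \<sigma> \<in> Sigma_grp ns \<Longrightarrow> a \<in> ?L \<Longrightarrow> q (act ns \<sigma> x) a c = q x (reindex \<sigma> 0 a) c"
    using leaf_values[OF d cL npL] by blast
  define S where "S x j a c = subtree_sum ns (\<lambda>b. q x b c) j a" for x j a c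
  \<comment> \<open>Up to a positive factor, the average of the leaf values below \<open>a\<close>
    minus the average below its parent \<open>tl a\<close>; so the sum over siblings is 0.\<close>
  define z where "z x j a c = (if j < ?k \<and> valid_addr ns j a \<and> c < d - 1
    then real (ns ! j) * S x j a c - S x (Suc j) (tl a) c else 0)" for x :: cfg and j a c
  define T where "T x = (\<Sum>j<?k. \<Sum>a | valid_addr ns j a. \<Sum>c<d - 1. (z x j a c)\<^sup>2)" for x
  define f where "f x = (\<lambda>j a c. z x j a c / sqrt (T x))" for x
  have contS: "continuous_on (Cspace d ns) (\<lambda>x. S x j a c)" for j a c
  proof -
    have "continuous_on (Cspace d ns) (\<lambda>x. if drop j b = a then q x b c else 0)" for b
      by (cases "drop j b = a") (simp_all add: cont)
    then show ?thesis unfolding S_def subtree_sum_def by (intro continuous_intros)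
  qed
  have contz: "continuous_on (Cspace d ns) (\<lambda>x. z x j a c)" for j a c
  proof (cases "j < ?k \<and> valid_addr ns j a \<and> c < d - 1")
    case True
    then show ?thesis by (simp add: z_def contS continuous_on_diff continuous_on_mult)
  next
    case False
    then show ?thesis by (simp only: z_def if_False continuous_on_const)
  qed
  have contT: "continuous_on (Cspace d ns) T"
    unfolding T_def[abs_def] by (intro continuous_intros contz)
  have Tpos: "T x > 0" if x: "x \<in> Cspace d ns" for x
  proof (rule ccontr)
    assume "\<not> T x > 0"
    moreover have "T x \<ge> 0" unfolding T_def by (intro sum_nonneg) auto
    ultimately have T0: "T x = 0" by simp
    have zero: "z x j a c = 0" if "j < ?k" "valid_addr ns j a" "c < d - 1" for j a c
    proof -
      have "\<forall>j\<in>{..<?k}. (\<Sum>a | valid_addr ns j a. \<Sum>c<d - 1. (z x j a c)\<^sup>2) = 0"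
        using T0 unfolding T_def by (subst (asm) sum_nonneg_eq_0_iff) (auto intro!: sum_nonneg)
      then have "\<forall>a\<in>{a. valid_addr ns j a}. (\<Sum>c<d - 1. (z x j a c)\<^sup>2) = 0"
        using that(1) finite_valid_addr by (subst (asm) sum_nonneg_eq_0_iff) (auto intro!: sum_nonneg)
      then have "\<forall>c\<in>{..<d - 1}. (z x j a c)\<^sup>2 = 0"
        using that(2) by (subst (asm) sum_nonneg_eq_0_iff) auto
      then show ?thesis using that(3) by simp
    qed
    \<comment> \<open>The induction descends from the root: if all differences vanish, every node
      inherits the average of its parent, and the leaf values would be constant.\<close>
    have same: "\<forall>a b. valid_addr ns j a \<longrightarrow> valid_addr ns j b \<longrightarrow> S x j a c = S x j b c" if c: "c < d - 1" and "j \<le> ?k" for j c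
      using \<open>j \<le> ?k\<close>
    proof (induction j rule: inc_induct)
      case base show ?case by (simp add: valid_addr_ge)
    next
      case (step j)
      have "ns ! j \<ge> 2" using n2 step nth_mem by blast
      then have pos: "real (ns ! j) \<noteq> 0" by simp
      show ?case
      proof (intro allI impI)
        fix a b assume v: "valid_addr ns j a" "valid_addr ns j b"
        have "real (ns ! j) * S x j a c = S x (Suc j) (tl a) c" "real (ns ! j) * S x j b c = S x (Suc j) (tl b) c"
          using zero[OF step(2) v(1) c] zero[OF step(2) v(2) c] v c step by (simp_all add: z_def)
        moreover have "S x (Suc j) (tl a) c = S x (Suc j) (tl b) c"
          using step.IH valid_addr_tl[OF step(2)] v by blast
        ultimately have "real (ns ! j) * S x j a c = real (ns ! j) * S x j b c" by argo
        then show "S x j a c = S x j b c" using pos by simp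
      qed
    qed
    obtain c a b where c: "c < d - 1" and v: "valid_addr ns 0 a" "valid_addr ns 0 b" and ne: "q x a c \<noteq> q x b c"
      using nonconst[OF x] by blast
    have "S x 0 a c = S x 0 b c" using same[OF c, of 0] v by blast
    then show False using ne by (simp add: S_def subtree_sum_leaf v)
  qed
  have "continuous_on (Cspace d ns) f"
    unfolding f_def[abs_def]
    by (intro continuous_on_coordinatewise_then_product continuous_on_divide contz continuous_on_real_sqrt contT)
      (use Tpos in fastforce)
  moreover have "f x \<in> SW d ns" if x: "x \<in> Cspace d ns" for x
  proof -
    have "(\<Sum>i<ns ! j. z x j (i # ts) c) = 0" if j: "j < ?k" and v: "valid_addr ns (Suc j) ts" for j ts c
    proof (cases "c < d - 1")
      case True
      then have "(\<Sum>i<ns ! j. z x j (i # ts) c) = (\<Sum>i<ns ! j. real (ns ! j) * S x j (i # ts) c - S x (Suc j) ts c)"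
        using j v by (intro sum.cong) (auto simp: z_def)
      also have "\<dots> = 0"
        using subtree_sum_split[OF j] by (simp add: sum_subtractf S_def flip: sum_distrib_left)
      finally show ?thesis .
    qed (simp add: z_def)
    then have "(\<Sum>i<ns ! j. f x j (i # ts) c) = 0" if "j < ?k" "valid_addr ns (Suc j) ts" for j ts c
      using that by (simp add: f_def flip: sum_divide_distrib)
    then have "f x \<in> Wspace d ns"
      by (auto simp: Wspace_def f_def z_def split: if_splits)
    moreover have "(\<Sum>j<?k. \<Sum>a | valid_addr ns j a. \<Sum>c<d - 1. (f x j a c)\<^sup>2) = T x / T x"
      using Tpos[OF x] unfolding T_def[of x] f_def sum_divide_distrib
      by (simp add: power_divide T_def[symmetric])
    ultimately show ?thesis using Tpos[OF x] by (simp add: SW_def)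
  qed
  moreover have "f (act ns \<sigma> x) = act ns \<sigma> (f x)" if s: "\<sigma> \<in> Sigma_grp ns" for \<sigma> x
  proof -
    have Sact: "S (act ns \<sigma> x) j a c = S x j (reindex \<sigma> j a) c" if "valid_addr ns j a" for j a c
      unfolding S_def by (rule subtree_sum_reindex[OF s that]) (simp add: equi[OF s])
    have zact: "z (act ns \<sigma> x) j a c = z x j (reindex \<sigma> j a) c" if j: "j < ?k" and v: "valid_addr ns j a" for j a c
    proof -
      have "tl (reindex \<sigma> j a) = reindex \<sigma> (Suc j) (tl a)" using drop_reindex[of 1 \<sigma> j a] by (simp add: drop_Suc)
      then show ?thesis using j v valid_addr_reindex[OF s v] Sact[OF v] Sact[OF valid_addr_tl[OF j v]] by (simp add: z_def)
    qed
    have "T (act ns \<sigma> x) = (\<Sum>j<?k. \<Sum>a | valid_addr ns j a. \<Sum>c<d - 1. (z x j (reindex \<sigma> j a) c)\<^sup>2)"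
      unfolding T_def by (intro sum.cong refl) (simp add: zact)
    also have "\<dots> = T x" unfolding T_def by (rule sum.cong[OF refl]) (rule sum_reindex_addr[OF s])
    finally have T: "T (act ns \<sigma> x) = T x" .
    show ?thesis
    proof (intro ext)
      fix j a c
      have "act ns \<sigma> (f x) j a c = (if j < ?k \<and> valid_addr ns j a then f x j (reindex \<sigma> j a) c else 0)"
        by (simp add: act_def)
      then show "f (act ns \<sigma> x) j a c = act ns \<sigma> (f x) j a c"
      proof (cases "j < ?k \<and> valid_addr ns j a")
        case True
        then show ?thesis using \<open>act ns \<sigma> (f x) j a c = _\<close> zact[of j a c] by (simp add: f_def T)
      next
        case False
        then show ?thesis using \<open>act ns \<sigma> (f x) j a c = _\<close> by (auto simp: f_def z_def)
      qed
    qed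
  qed
  ultimately show ?thesis by (intro exI[of _ f]) blast
qed

theorem theorem1p3:
  fixes ns :: "nat list" and d :: nat
  assumes "ns \<noteq> []" and "d \<ge> 2" and "\<forall>n\<in>set ns. n \<ge> 2"
  shows "(\<not> (\<exists>f. continuous_on (Cspace d ns) f \<and> f ` Cspace d ns \<subseteq> SW d ns \<and>
              (\<forall>\<sigma>\<in>Sigma_grp ns. \<forall>x\<in>Cspace d ns. f (act ns \<sigma> x) = act ns \<sigma> (f x))))
         \<longleftrightarrow> (\<exists>p::nat. prime p \<and> (\<forall>n\<in>set ns. \<exists>e. n = p ^ e))"
proof
  assume no_map: "\<not> (\<exists>f. continuous_on (Cspace d ns) f \<and> f ` Cspace d ns \<subseteq> SW d ns \<and>
              (\<forall>\<sigma>\<in>Sigma_grp ns. \<forall>x\<in>Cspace d ns. f (act ns \<sigma> x) = act ns \<sigma> (f x)))"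
  show "\<exists>p::nat. prime p \<and> (\<forall>n\<in>set ns. \<exists>e. n = p ^ e)"
  proof (rule ccontr)
    assume "\<not> ?thesis"
    then have "\<exists>n\<in>set ns. \<forall>e. n \<noteq> p ^ e" if "prime p" for p using that by blast
    then show False using equivariant_map_exists[OF assms] no_map by blast
  qed
next
  assume "\<exists>p::nat. prime p \<and> (\<forall>n\<in>set ns. \<exists>e. n = p ^ e)"
  then obtain p :: nat where p: "prime p" and pow: "\<forall>n\<in>set ns. n \<ge> 2 \<and> (\<exists>e. n = p ^ e)"
    using assms(3) by blast
  \<comment> \<open>The sheets use the last coordinate separately, so the dimension is split as
    \<open>Suc (d - 1)\<close>.\<close>
  have D: "d - 1 > 0" "Suc (d - 1) = d" using assms(2) by simp_all
  show "\<not> (\<exists>f. continuous_on (Cspace d ns) f \<and> f ` Cspace d ns \<subseteq> SW d ns \<and>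
              (\<forall>\<sigma>\<in>Sigma_grp ns. \<forall>x\<in>Cspace d ns. f (act ns \<sigma> x) = act ns \<sigma> (f x)))"
  proof
    assume "\<exists>f. continuous_on (Cspace d ns) f \<and> f ` Cspace d ns \<subseteq> SW d ns \<and>
              (\<forall>\<sigma>\<in>Sigma_grp ns. \<forall>x\<in>Cspace d ns. f (act ns \<sigma> x) = act ns \<sigma> (f x))"
    then obtain f where "continuous_on (Cspace d ns) f" "f ` Cspace d ns \<subseteq> SW d ns"
      "\<And>\<sigma> x. \<sigma> \<in> Sigma_grp ns \<Longrightarrow> x \<in> Cspace d ns \<Longrightarrow> f (act ns \<sigma> x) = act ns \<sigma> (f x)" by blast
    then show False using no_equivariant_map[OF assms(1) D(1) p pow, of f] unfolding D(2) by blast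
  qed
qed

end
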